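(* The Riemann tensor $R_\nabla:\Omega\to\Omega^2\otimes_{\mathcal{B}}\Omega$ of the quantum Levi-Civita connection on the quantum projective space satisfies $$R_\nabla(\bar\partial p)=-\mathsf{E}_{23}\mathsf{E}_{23}\,\bar\partial p\wedge\partial p\otimes\bar\partial p-q^{-(\omega_s,2\rho)}\,\bar\partial p\wedge g_{+-},$$ where $\bar\partial p\wedge g_{+-}:=(\wedge\otimes\mathrm{id})(\bar\partial p\otimes g_{+-})$.
   Context: **Quantum group data.** Fix an integer $r\ge 1$, a real number $0<q<1$ and $s\in\{1,r\}$. $U_q(\mathfrak{sl}_{r+1})$ is the quantized enveloping algebra with generators $K_i^{\pm1},E_i,F_i$, $1\le i\le r$ (Klimyk–Schmüdgen conventions: $\Delta(K_i)=K_i\otimes K_i$, $\Delta(E_i)=E_i\otimes K_i+1\otimes E_i$, $\Delta(F_i)=F_i\otimes 1+K_i^{-1}\otimes F_i$; $K_i$ acts on a vector of weight $\mu$ by $q^{(\alpha_i,\mu)}$). Here $\alpha_i$ are the simple roots, $\omega_i$ the fundamental weights, $\rho=\sum_i\omega_i$, $w_0$ the longest Weyl group element, $(\cdot,\cdot)$ the invariant form with $(\alpha_i,\alpha_i)=2$. Put $a=(\alpha_s,\alpha_s)=2$, $w=(\omega_s,\omega_s)$, $m=(\omega_s,2\rho)=r$. $V(\lambda)$ is the simple type 1 module of highest weight $\lambda$, $V=V(\omega_s)$, and $V^*$ is its dual with $(Xf)(v)=f(S(X)v)$, $S$ the antipode. $\hat{R}_{X,Y}:X\otimes Y\to Y\otimes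 X$ is the braiding on finite-dimensional type 1 modules determined by being a module map with $\hat{R}_{V(\lambda),V(\mu)}(v\otimes u)=q^{(\lambda,w_0\mu)}u\otimes v$ for $v$ a highest weight vector of $V(\lambda)$ and $u$ a lowest weight vector of $V(\mu)$. Let $(v_i)$ be a weight basis of $V$ with weights $\lambda_i$ and dual basis $(f^i)$ of $V^*$. Define $\mathsf{E}:V^*\otimes V\to\mathbb{C}$, $\mathsf{E}(f^i\otimes v_j)=\delta_{ij}$, and $\mathsf{E}':V\otimes V^*\to\mathbb{C}$, $\mathsf{E}'(v_i\otimes f^j)=q^{(\lambda_i,2\rho)}\delta_{ij}$. Subscripts indicate the tensor legs on which a map acts; products of maps are compositions (rightmost first), legs being renumbered after each contraction. Put $$\mathsf{S}_{123}=(\hat{R}_{V,V^*})_{23}(\hat{R}_{V,V})_{12}(\hat{R}_{V,V^*}^{-1})_{23},\quad \tilde{\mathsf{S}}_{234}=(\hat{R}_{V,V^*})_{23}(\hat{R}_{V^*,V^*}^{-1})_{34}(\hat{R}_{V,V^*}^{-1})_{23},\quad \mathsf{T}_{1234}=\mathsf{S}_{123}\tilde{\mathsf{S}}_{234}=\tilde{\mathsf{S}}_{234}\mathsf{S}_{123}$$ (acting on $V\otimes V^*\otimes V$, $V^*\otimes V\otimes V^*$, $V\otimes V^*\otimes V\otimes V^*$ at the indicated legs). **Index-free notation.** A family $x=(x^{ij})_{1\le i,j\le r+1}$ is identified with $\sum_{i,j}v_i\otimes f^j\otimes x^{ij}$; products of families $xy$ (also $x\otimes y$, $x\wedge y$)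 denote $\sum v_i\otimes f^j\otimes v_k\otimes f^l\otimes x^{ij}y^{kl}$ (resp. with $\otimes_{\mathcal{B}}$, $\wedge$), and similarly for more factors. The maps above act on the $V,V^*$ legs; other maps act on components. Elements such as $g_{+-}$ below carry no legs. **Algebra and first-order calculus.** $\mathcal{B}$ is the unital algebra generated by $p^{ij}$, $1\le i,j\le r+1$, with relations $\mathsf{S}_{123}pp=q^{w}pp$, $\tilde{\mathsf{S}}_{234}pp=q^{-w}pp$, $\mathsf{E}'_{12}p=q^{m}$. The Heckenberger–Kolb first-order differential calculus is $\Omega=\Omega_+\oplus\Omega_-$, with $\Omega_+,\Omega_-$ generated as left $\mathcal{B}$-modules by $\partial p^{ij}$, resp. $\bar\partial p^{ij}$, with relations $$\tilde{\mathsf{S}}_{234}p\,\partial p=q^{-w}p\,\partial p,\quad \mathsf{E}'_{12}\partial p=0,\qquad \mathsf{S}_{123}p\,\bar\partial p=q^{w}p\,\bar\partial p,\quad \mathsf{E}'_{12}\bar\partial p=0,$$ right module structure $\partial p\,p=q^{a}\mathsf{T}_{1234}p\,\partial p$, $\bar\partial p\,p=q^{-a}\mathsf{T}_{1234}p\,\bar\partial p$, and differential $\mathrm{d}=\partial+\bar\partial$, where $\partial,\bar\partial:\mathcal{B}\to\Omega_\pm$ are the derivations with $p^{ij}\mapsto\partial p^{ij},\bar\partial p^{ij}$. **Universal calculus.** $\Omega^\bullet$ is the quotient of the tensor algebra $T_{\mathcal{B}}(\Omega)$ by the two-sided ideal generated by $\{\sum_i\mathrm{d}a_i\otimes\mathrm{d}b_i:\sum_i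 a_i\mathrm{d}b_i=0\}\subset\Omega\otimes_{\mathcal{B}}\Omega$; its product is $\wedge$, and $\mathrm{d}(a\,\mathrm{d}b)=\mathrm{d}a\wedge\mathrm{d}b$. **Metric components.** $g_{+-}=\mathsf{E}'_{12}\mathsf{E}_{23}\,\partial p\otimes\bar\partial p$ and $g_{-+}=\mathsf{E}'_{12}\mathsf{E}_{23}\,\bar\partial p\otimes\partial p$ in $\Omega\otimes_{\mathcal{B}}\Omega$ (central elements). **Connection.** The quantum Levi-Civita connection is the (well-defined) linear map $\nabla:\Omega\to\Omega\otimes_{\mathcal{B}}\Omega$ with $\nabla(b\omega)=\mathrm{d}b\otimes\omega+b\nabla(\omega)$ for $b\in\mathcal{B}$, $\omega\in\Omega$, and $$\nabla(\partial p)=q^{a}\mathsf{E}_{23}\mathsf{T}_{1234}\,\bar\partial p\otimes\partial p-q^{a}q^{-m}\,p\,g_{-+},\qquad \nabla(\bar\partial p)=\mathsf{E}_{23}\,\partial p\otimes\bar\partial p-q^{-m}\,p\,g_{+-}.$$ **Riemann tensor.** $R_\nabla:=(\mathrm{d}\otimes\mathrm{id}-(\wedge\otimes\mathrm{id})\circ(\mathrm{id}\otimes\nabla))\circ\nabla:\Omega\to\Omega^2\otimes_{\mathcal{B}}\Omega$. *)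

theory Defs
  imports "HOL-Analysis.Analysis" "HOL-Library.Poly_Mapping"
begin

section \<open>Weights of \<open>sl\<^bsub>r+1\<^esub>\<close>\<close>

text \<open>Weights are written in the coordinates \<open>1, \<dots>, r + 1\<close> in which the invariant form is the
  standard dot product, the simple roots are \<open>e\<^sub>i - e\<^bsub>i+1\<^esub>\<close> (so \<open>(\<alpha>\<^sub>i, \<alpha>\<^sub>i) = 2\<close>), the weight space is
  the sum-zero hyperplane, the Weyl group is the symmetric group permuting the coordinates, and
  its longest element reverses their order.\<close>

type_synonym weight = "nat \<Rightarrow> real"

definition wt_form :: "nat \<Rightarrow> weight \<Rightarrow> weight \<Rightarrow> real" where
  "wt_form r \<nu> \<mu> = (\<Sum>k=1..r+1. \<nu> k * \<mu> k)"

definition simple_root :: "nat \<Rightarrow> weight" where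
  "simple_root i = (\<lambda>k. if k = i then 1 else if k = i + 1 then -1 else 0)"

definition fund_weight :: "nat \<Rightarrow> nat \<Rightarrow> weight" where
  "fund_weight r i =
     (\<lambda>k. if k \<in> {1..r+1} then (if k \<le> i then 1 else 0) - real i / real (r + 1) else 0)"

definition two_rho :: "nat \<Rightarrow> weight" where
  "two_rho r = (\<lambda>k. 2 * (\<Sum>i=1..r. fund_weight r i k))"

definition w0 :: "nat \<Rightarrow> weight \<Rightarrow> weight" where
  "w0 r \<mu> = (\<lambda>k. \<mu> (r + 2 - k))"

definition weight_lattice :: "nat \<Rightarrow> weight set" where
  "weight_lattice r = {\<nu>. \<exists>n :: nat \<Rightarrow> int. \<nu> = (\<lambda>k. \<Sum>i=1..r. of_int (n i) * fund_weight r i k)}"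


section \<open>Matrix representations of \<open>U\<^sub>q(sl\<^bsub>r+1\<^esub>)\<close>\<close>

text \<open>A finite-dimensional module with a basis indexed by a finite type \<open>'n\<close> is given by the matrices
  of the generators in that basis (columns are the images of basis vectors).\<close>

datatype uq_gen = UK nat | UKinv nat | UE nat | UF nat

type_synonym 'n uq_rep = "uq_gen \<Rightarrow> complex ^ 'n ^ 'n"

definition uq_gens :: "nat \<Rightarrow> uq_gen set" where
  "uq_gens r = UK ` {1..r} \<union> UKinv ` {1..r} \<union> UE ` {1..r} \<union> UF ` {1..r}"

definition uq_module :: "nat \<Rightarrow> real \<Rightarrow> 'n::finite uq_rep \<Rightarrow> bool" where
  "uq_module r q \<rho> \<longleftrightarrow>
     (\<forall>i\<in>{1..r}. \<rho> (UK i) ** \<rho> (UKinv i) = mat 1 \<and> \<rho> (UKinv i) ** \<rho> (UK i) = mat 1) \<and>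
     (\<forall>i\<in>{1..r}. \<forall>j\<in>{1..r}.
        \<rho> (UK i) ** \<rho> (UK j) = \<rho> (UK j) ** \<rho> (UK i) \<and>
        \<rho> (UK i) ** \<rho> (UE j) ** \<rho> (UKinv i)
          = q powr wt_form r (simple_root i) (simple_root j) *\<^sub>R \<rho> (UE j) \<and>
        \<rho> (UK i) ** \<rho> (UF j) ** \<rho> (UKinv i)
          = q powr (- wt_form r (simple_root i) (simple_root j)) *\<^sub>R \<rho> (UF j) \<and>
        \<rho> (UE i) ** \<rho> (UF j) - \<rho> (UF j) ** \<rho> (UE i)
          = (if i = j then (1 / (q - 1 / q)) *\<^sub>R (\<rho> (UK i) - \<rho> (UKinv i)) else 0)) \<and>
     (\<forall>X\<in>{UE, UF}. \<forall>i\<in>{1..r}. \<forall>j\<in>{1..r}.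
        (wt_form r (simple_root i) (simple_root j) = 0 \<longrightarrow>
           \<rho> (X i) ** \<rho> (X j) = \<rho> (X j) ** \<rho> (X i)) \<and>
        (wt_form r (simple_root i) (simple_root j) = -1 \<longrightarrow>
           \<rho> (X i) ** \<rho> (X i) ** \<rho> (X j) - (q + 1 / q) *\<^sub>R (\<rho> (X i) ** \<rho> (X j) ** \<rho> (X i))
             + \<rho> (X j) ** \<rho> (X i) ** \<rho> (X i) = 0))"

definition weight_vector :: "nat \<Rightarrow> real \<Rightarrow> 'n::finite uq_rep \<Rightarrow> weight \<Rightarrow> complex ^ 'n \<Rightarrow> bool" where
  "weight_vector r q \<rho> \<mu> v \<longleftrightarrow> v \<noteq> 0 \<and>
     (\<forall>i\<in>{1..r}. \<rho> (UK i) *v v = q powr wt_form r (simple_root i) \<mu> *\<^sub>R v)"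

definition highest_vector :: "nat \<Rightarrow> real \<Rightarrow> 'n::finite uq_rep \<Rightarrow> weight \<Rightarrow> complex ^ 'n \<Rightarrow> bool" where
  "highest_vector r q \<rho> \<mu> v \<longleftrightarrow> weight_vector r q \<rho> \<mu> v \<and> (\<forall>i\<in>{1..r}. \<rho> (UE i) *v v = 0)"

definition lowest_vector :: "nat \<Rightarrow> real \<Rightarrow> 'n::finite uq_rep \<Rightarrow> weight \<Rightarrow> complex ^ 'n \<Rightarrow> bool" where
  "lowest_vector r q \<rho> \<mu> v \<longleftrightarrow> weight_vector r q \<rho> \<mu> v \<and> (\<forall>i\<in>{1..r}. \<rho> (UF i) *v v = 0)"

definition simple_hw_module :: "nat \<Rightarrow> real \<Rightarrow> 'n::finite uq_rep \<Rightarrow> weight \<Rightarrow> bool" where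
  "simple_hw_module r q \<rho> \<nu> \<longleftrightarrow> uq_module r q \<rho> \<and> (\<exists>v. highest_vector r q \<rho> \<nu> v) \<and>
     (\<forall>W. vec.subspace W \<and> (\<forall>g\<in>uq_gens r. \<forall>v\<in>W. \<rho> g *v v \<in> W) \<longrightarrow> W = {0} \<or> W = UNIV)"

definition kron :: "complex ^ 'n ^ 'n \<Rightarrow> complex ^ 'm ^ 'm \<Rightarrow> complex ^ ('n \<times> 'm) ^ ('n \<times> 'm)" where
  "kron A B = (\<chi> i j. A $ fst i $ fst j * B $ snd i $ snd j)"

definition vtensor :: "complex ^ 'n \<Rightarrow> complex ^ 'm \<Rightarrow> complex ^ ('n \<times> 'm)" where
  "vtensor v u = (\<chi> i. v $ fst i * u $ snd i)"

fun tensor_rep :: "'n::finite uq_rep \<Rightarrow> 'm::finite uq_rep \<Rightarrow> ('n \<times> 'm) uq_rep" where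
  "tensor_rep \<rho> \<sigma> (UK i) = kron (\<rho> (UK i)) (\<sigma> (UK i))"
| "tensor_rep \<rho> \<sigma> (UKinv i) = kron (\<rho> (UKinv i)) (\<sigma> (UKinv i))"
| "tensor_rep \<rho> \<sigma> (UE i) = kron (\<rho> (UE i)) (\<sigma> (UK i)) + kron (mat 1) (\<sigma> (UE i))"
| "tensor_rep \<rho> \<sigma> (UF i) = kron (\<rho> (UF i)) (mat 1) + kron (\<rho> (UKinv i)) (\<sigma> (UF i))"

text \<open>The dual module in the dual basis: \<open>X\<close> acts by the transpose of the matrix of \<open>S(X)\<close>, where
  \<open>S(K\<^sub>i) = K\<^sub>i\<^sup>-\<^sup>1\<close>, \<open>S(E\<^sub>i) = - E\<^sub>i K\<^sub>i\<^sup>-\<^sup>1\<close>, \<open>S(F\<^sub>i) = - K\<^sub>i F\<^sub>i\<close> is the antipode belonging to the coproduct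
  used in \<^const>\<open>tensor_rep\<close>.\<close>

fun dual_rep :: "'n::finite uq_rep \<Rightarrow> 'n uq_rep" where
  "dual_rep \<rho> (UK i) = transpose (\<rho> (UKinv i))"
| "dual_rep \<rho> (UKinv i) = transpose (\<rho> (UK i))"
| "dual_rep \<rho> (UE i) = transpose (- (\<rho> (UE i) ** \<rho> (UKinv i)))"
| "dual_rep \<rho> (UF i) = transpose (- (\<rho> (UK i) ** \<rho> (UF i)))"

definition dual_weight :: "nat \<Rightarrow> weight \<Rightarrow> weight" where
  "dual_weight r \<nu> = (\<lambda>k. - w0 r \<nu> k)"

text \<open>The braiding \<open>V(\<nu>) \<otimes> V(\<mu>) \<rightarrow> V(\<mu>) \<otimes> V(\<nu>)\<close>, for \<open>\<rho>\<close> and \<open>\<sigma>\<close> matrix forms of \<open>V(\<nu>)\<close> and \<open>V(\<mu>)\<close>.\<close>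

definition braiding :: "nat \<Rightarrow> real \<Rightarrow> 'n::finite uq_rep \<Rightarrow> weight \<Rightarrow> 'm::finite uq_rep \<Rightarrow> weight
    \<Rightarrow> complex ^ ('n \<times> 'm) ^ ('m \<times> 'n)" where
  "braiding r q \<rho> \<nu> \<sigma> \<mu> = (THE R.
     (\<forall>g\<in>uq_gens r. R ** tensor_rep \<rho> \<sigma> g = tensor_rep \<sigma> \<rho> g ** R) \<and>
     (\<forall>v u. highest_vector r q \<rho> \<nu> v \<and> lowest_vector r q \<sigma> (w0 r \<mu>) u \<longrightarrow>
        R *v vtensor v u = q powr wt_form r \<nu> (w0 r \<mu>) *\<^sub>R vtensor u v))"


section \<open>Families and maps on their legs\<close>

text \<open>A family with \<open>k\<close> legs has its components indexed by lists of length \<open>k\<close>; its values on other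
  lists are irrelevant. Legs are numbered from 1. The argument \<open>sc\<close> is the action of the complex
  numbers on the components.\<close>

definition leg_map :: "(complex \<Rightarrow> 'x \<Rightarrow> 'x) \<Rightarrow> complex ^ ('n::finite \<times> 'n) ^ ('n \<times> 'n) \<Rightarrow> nat
    \<Rightarrow> ('n list \<Rightarrow> 'x::ab_group_add) \<Rightarrow> 'n list \<Rightarrow> 'x" where
  "leg_map sc M k X = (\<lambda>l. \<Sum>(a, b)\<in>UNIV.
     sc (M $ (l ! (k - 1), l ! k) $ (a, b)) (X (l[k - 1 := a, k := b])))"

definition leg_contract :: "(complex \<Rightarrow> 'x \<Rightarrow> 'x) \<Rightarrow> ('n::finite \<Rightarrow> 'n \<Rightarrow> complex) \<Rightarrow> nat
    \<Rightarrow> ('n list \<Rightarrow> 'x::ab_group_add) \<Rightarrow> 'n list \<Rightarrow> 'x" where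
  "leg_contract sc e k X = (\<lambda>l. \<Sum>a\<in>UNIV. \<Sum>b\<in>UNIV.
     sc (e a b) (X (take (k - 1) l @ [a, b] @ drop (k - 1) l)))"

definition fam2 :: "('n \<times> 'n \<Rightarrow> 'x) \<Rightarrow> 'n list \<Rightarrow> 'x" where
  "fam2 x = (\<lambda>l. x (l ! 0, l ! 1))"

text \<open>Product, with respect to the product \<open>f\<close> of components, of a family with \<open>k\<close> legs and another
  family.\<close>

definition fprod :: "nat \<Rightarrow> ('x \<Rightarrow> 'y \<Rightarrow> 'z) \<Rightarrow> ('n list \<Rightarrow> 'x) \<Rightarrow> ('n list \<Rightarrow> 'y) \<Rightarrow> 'n list \<Rightarrow> 'z" where
  "fprod k f X Y = (\<lambda>l. f (X (take k l)) (Y (drop k l)))"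

definition qpow :: "real \<Rightarrow> real \<Rightarrow> complex" where
  "qpow q x = of_real (q powr x)"

text \<open>\<open>lam i\<close> is the weight of the basis vector \<open>v\<^sub>i\<close> of \<open>V(\<omega>\<^sub>s)\<close>.\<close>

definition quantum_group_data ::
    "nat \<Rightarrow> real \<Rightarrow> nat \<Rightarrow> 'n::finite uq_rep \<Rightarrow> ('n \<Rightarrow> weight) \<Rightarrow> bool" where
  "quantum_group_data r q s \<rho> lam \<longleftrightarrow>
     1 \<le> r \<and> 0 < q \<and> q < 1 \<and> s \<in> {1, r} \<and> CARD('n) = r + 1 \<and>
     simple_hw_module r q \<rho> (fund_weight r s) \<and>
     (\<forall>i. lam i \<in> weight_lattice r \<and> weight_vector r q \<rho> (lam i) (axis i 1))"

definition par_a :: "nat \<Rightarrow> nat \<Rightarrow> real" where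
  "par_a r s = wt_form r (simple_root s) (simple_root s)"
definition par_w :: "nat \<Rightarrow> nat \<Rightarrow> real" where
  "par_w r s = wt_form r (fund_weight r s) (fund_weight r s)"
definition par_m :: "nat \<Rightarrow> nat \<Rightarrow> real" where
  "par_m r s = wt_form r (fund_weight r s) (two_rho r)"

definition E_leg where
  "E_leg sc = leg_contract sc (\<lambda>i j. if i = j then 1 else 0)"

definition E'_leg where
  "E'_leg r q lam sc =
     leg_contract sc (\<lambda>i j. if i = j then qpow q (wt_form r (lam i) (two_rho r)) else 0)"

definition R_VV :: "nat \<Rightarrow> real \<Rightarrow> nat \<Rightarrow> 'n::finite uq_rep \<Rightarrow> complex ^ ('n \<times> 'n) ^ ('n \<times> 'n)" where
  "R_VV r q s \<rho> = braiding r q \<rho> (fund_weight r s) \<rho> (fund_weight r s)"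

definition R_VD :: "nat \<Rightarrow> real \<Rightarrow> nat \<Rightarrow> 'n::finite uq_rep \<Rightarrow> complex ^ ('n \<times> 'n) ^ ('n \<times> 'n)" where
  "R_VD r q s \<rho> =
     braiding r q \<rho> (fund_weight r s) (dual_rep \<rho>) (dual_weight r (fund_weight r s))"

definition R_DD :: "nat \<Rightarrow> real \<Rightarrow> nat \<Rightarrow> 'n::finite uq_rep \<Rightarrow> complex ^ ('n \<times> 'n) ^ ('n \<times> 'n)" where
  "R_DD r q s \<rho> = braiding r q (dual_rep \<rho>) (dual_weight r (fund_weight r s))
                               (dual_rep \<rho>) (dual_weight r (fund_weight r s))"

definition S123 where
  "S123 r q s \<rho> sc = leg_map sc (R_VD r q s \<rho>) 2 \<circ> leg_map sc (R_VV r q s \<rho>) 1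
     \<circ> leg_map sc (matrix_inv (R_VD r q s \<rho>)) 2"

definition St234 where
  "St234 r q s \<rho> sc = leg_map sc (R_VD r q s \<rho>) 2 \<circ> leg_map sc (matrix_inv (R_DD r q s \<rho>)) 3
     \<circ> leg_map sc (matrix_inv (R_VD r q s \<rho>)) 2"

definition T1234 where
  "T1234 r q s \<rho> sc = S123 r q s \<rho> sc \<circ> St234 r q s \<rho> sc"


section \<open>Algebras and bimodules by generators and relations\<close>

text \<open>A unital complex algebra is a ring with a central ring homomorphism \<open>\<iota>\<close> from the complex
  numbers.\<close>

definition complex_algebra :: "(complex \<Rightarrow> 'b::ring_1) \<Rightarrow> bool" where
  "complex_algebra \<iota> \<longleftrightarrow> \<iota> 1 = 1 \<and> (\<forall>c d. \<iota> (c + d) = \<iota> c + \<iota> d \<and> \<iota> (c * d) = \<iota> c * \<iota> d) \<and>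
     (\<forall>c b. \<iota> c * b = b * \<iota> c)"

text \<open>Words form the free monoid (written additively), so \<open>'g word \<Rightarrow>\<^sub>0 complex\<close> with its
  convolution product is the free unital algebra on \<open>'g\<close>.\<close>

datatype 'g word = Word "'g list"

instantiation word :: (type) monoid_add
begin
definition "0 = Word []"
fun plus_word :: "'a word \<Rightarrow> 'a word \<Rightarrow> 'a word" where "Word u + Word v = Word (u @ v)"
instance
proof
  fix a b c :: "'a word"
  show "a + b + c = a + (b + c)" by (cases a; cases b; cases c) simp
  show "0 + a = a" "a + 0 = a" by (cases a; simp add: zero_word_def)+
qed
end

type_synonym 'g free_algebra = "'g word \<Rightarrow>\<^sub>0 complex"

inductive_set ideal_hull :: "'a::ring_1 set \<Rightarrow> 'a set" for Rel where
  zero: "0 \<in> ideal_hull Rel"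
| base: "x \<in> Rel \<Longrightarrow> a * x * b \<in> ideal_hull Rel"
| add: "x \<in> ideal_hull Rel \<Longrightarrow> y \<in> ideal_hull Rel \<Longrightarrow> x + y \<in> ideal_hull Rel"

definition presented_algebra ::
    "(complex \<Rightarrow> 'b::ring_1) \<Rightarrow> ('g \<Rightarrow> 'b) \<Rightarrow> 'g free_algebra set \<Rightarrow> bool" where
  "presented_algebra \<iota> gen Rel \<longleftrightarrow> complex_algebra \<iota> \<and>
     (\<exists>\<pi> :: 'g free_algebra \<Rightarrow> 'b.
        (\<forall>x y. \<pi> (x + y) = \<pi> x + \<pi> y \<and> \<pi> (x * y) = \<pi> x * \<pi> y) \<and>
        (\<forall>c. \<pi> (Poly_Mapping.single 0 c) = \<iota> c) \<and>
        (\<forall>g. \<pi> (Poly_Mapping.single (Word [g]) 1) = gen g) \<and>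
        surj \<pi> \<and> {x. \<pi> x = 0} = ideal_hull Rel)"

record ('b, 'm) bimod =
  lact :: "'b \<Rightarrow> 'm \<Rightarrow> 'm"
  ract :: "'m \<Rightarrow> 'b \<Rightarrow> 'm"

definition bimodule :: "(complex \<Rightarrow> 'b::ring_1) \<Rightarrow> ('b, 'm::ab_group_add) bimod \<Rightarrow> bool" where
  "bimodule \<iota> M \<longleftrightarrow>
     (\<forall>a x y. lact M a (x + y) = lact M a x + lact M a y \<and>
              ract M (x + y) a = ract M x a + ract M y a) \<and>
     (\<forall>a b x. lact M (a + b) x = lact M a x + lact M b x \<and>
              ract M x (a + b) = ract M x a + ract M x b \<and>
              lact M (a * b) x = lact M a (lact M b x) \<and>
              ract M x (a * b) = ract M (ract M x a) b \<and>
              lact M a (ract M x b) = ract M (lact M a x) b) \<and>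
     (\<forall>x. lact M 1 x = x \<and> ract M x 1 = x) \<and>
     (\<forall>c x. lact M (\<iota> c) x = ract M x (\<iota> c))"

definition cscale :: "(complex \<Rightarrow> 'b) \<Rightarrow> ('b, 'm) bimod \<Rightarrow> complex \<Rightarrow> 'm \<Rightarrow> 'm" where
  "cscale \<iota> M c x = lact M (\<iota> c) x"

definition bimod_sum :: "('b, 'x) bimod \<Rightarrow> ('b, 'y) bimod \<Rightarrow> ('b, 'x \<times> 'y) bimod" where
  "bimod_sum M N = \<lparr> lact = (\<lambda>b z. (lact M b (fst z), lact N b (snd z))),
                     ract = (\<lambda>z b. (ract M (fst z) b, ract N (snd z) b)) \<rparr>"

text \<open>\<open>'g \<Rightarrow>\<^sub>0 'b\<close> is the free left module on \<open>'g\<close>.\<close>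

definition free_scale :: "'b::ring_1 \<Rightarrow> ('g \<Rightarrow>\<^sub>0 'b) \<Rightarrow> 'g \<Rightarrow>\<^sub>0 'b" where
  "free_scale b x = Poly_Mapping.map ((*) b) x"

inductive_set left_hull :: "('g \<Rightarrow>\<^sub>0 'b::ring_1) set \<Rightarrow> ('g \<Rightarrow>\<^sub>0 'b) set" for Rel where
  zero: "0 \<in> left_hull Rel"
| base: "x \<in> Rel \<Longrightarrow> free_scale b x \<in> left_hull Rel"
| add: "x \<in> left_hull Rel \<Longrightarrow> y \<in> left_hull Rel \<Longrightarrow> x + y \<in> left_hull Rel"

definition presented_left_module ::
    "('b::ring_1 \<Rightarrow> 'm::ab_group_add \<Rightarrow> 'm) \<Rightarrow> ('g \<Rightarrow> 'm) \<Rightarrow> ('g \<Rightarrow>\<^sub>0 'b) set \<Rightarrow> bool" where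
  "presented_left_module l gen Rel \<longleftrightarrow>
     (\<exists>\<pi> :: ('g \<Rightarrow>\<^sub>0 'b) \<Rightarrow> 'm. (\<forall>x y. \<pi> (x + y) = \<pi> x + \<pi> y) \<and>
        (\<forall>b g. \<pi> (Poly_Mapping.single g b) = l b (gen g)) \<and>
        surj \<pi> \<and> {x. \<pi> x = 0} = left_hull Rel)"


section \<open>Tensor products over the algebra\<close>

inductive_set subgroup_hull :: "'a::ab_group_add set \<Rightarrow> 'a set" for Rel where
  zero: "0 \<in> subgroup_hull Rel"
| base: "x \<in> Rel \<Longrightarrow> x \<in> subgroup_hull Rel"
| add: "x \<in> subgroup_hull Rel \<Longrightarrow> y \<in> subgroup_hull Rel \<Longrightarrow> x + y \<in> subgroup_hull Rel"
| minus: "x \<in> subgroup_hull Rel \<Longrightarrow> - x \<in> subgroup_hull Rel"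

definition tensor_relators ::
    "('b, 'm::ab_group_add) bimod \<Rightarrow> ('b, 'n::ab_group_add) bimod \<Rightarrow> (('m \<times> 'n) \<Rightarrow>\<^sub>0 int) set" where
  "tensor_relators M N = (let e = (\<lambda>x y. Poly_Mapping.single (x, y) 1) in
     {e (x + x') y - e x y - e x' y | x x' y. True} \<union>
     {e x (y + y') - e x y - e x y' | x y y'. True} \<union>
     {e (ract M x b) y - e x (lact N b y) | x b y. True})"

text \<open>\<open>T\<close> with the map \<open>t\<close> is the tensor product bimodule of \<open>M\<close> and \<open>N\<close> over the algebra: the free
  abelian group on pairs modulo biadditivity and balancedness.\<close>

definition tensor_product :: "(complex \<Rightarrow> 'b::ring_1) \<Rightarrow> ('b, 'm::ab_group_add) bimod
    \<Rightarrow> ('b, 'n::ab_group_add) bimod \<Rightarrow> ('b, 't::ab_group_add) bimod \<Rightarrow> ('m \<Rightarrow> 'n \<Rightarrow> 't) \<Rightarrow> bool" where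
  "tensor_product \<iota> M N T t \<longleftrightarrow> bimodule \<iota> T \<and>
     (\<forall>b x y. lact T b (t x y) = t (lact M b x) y \<and> ract T (t x y) b = t x (ract N y b)) \<and>
     (\<exists>\<pi> :: (('m \<times> 'n) \<Rightarrow>\<^sub>0 int) \<Rightarrow> 't. (\<forall>x y. \<pi> (x + y) = \<pi> x + \<pi> y) \<and>
        (\<forall>x y. \<pi> (Poly_Mapping.single (x, y) 1) = t x y) \<and>
        surj \<pi> \<and> {z. \<pi> z = 0} = subgroup_hull (tensor_relators M N))"

text \<open>The additive map on a tensor product with \<open>x \<otimes> y \<mapsto> \<beta> x y\<close>.\<close>

definition tensor_lift ::
    "('m \<Rightarrow> 'n \<Rightarrow> 't::ab_group_add) \<Rightarrow> ('m \<Rightarrow> 'n \<Rightarrow> 'z::ab_group_add) \<Rightarrow> 't \<Rightarrow> 'z" where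
  "tensor_lift t \<beta> =
     (THE f. (\<forall>x y. f (x + y) = f x + f y) \<and> (\<forall>x y. f (t x y) = \<beta> x y))"


section \<open>Quantum projective space and its first-order calculus\<close>

definition B_relators :: "nat \<Rightarrow> real \<Rightarrow> nat \<Rightarrow> 'n::finite uq_rep \<Rightarrow> ('n \<Rightarrow> weight)
    \<Rightarrow> ('n \<times> 'n) free_algebra set" where
  "B_relators r q s \<rho> lam =
    (let sc = (\<lambda>c x. Poly_Mapping.single 0 c * x);
         P = fam2 (\<lambda>g. Poly_Mapping.single (Word [g]) 1);
         PP = fprod 2 (*) P P
     in {S123 r q s \<rho> sc PP l - sc (qpow q (par_w r s)) (PP l) | l. length l = 4} \<union>
        {St234 r q s \<rho> sc PP l - sc (qpow q (- par_w r s)) (PP l) | l. length l = 4} \<union>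
        {E'_leg r q lam sc 1 P [] - Poly_Mapping.single 0 (qpow q (par_m r s))})"

definition Omega_plus_relators :: "nat \<Rightarrow> real \<Rightarrow> nat \<Rightarrow> 'n::finite uq_rep \<Rightarrow> ('n \<Rightarrow> weight)
    \<Rightarrow> (complex \<Rightarrow> 'b::ring_1) \<Rightarrow> ('n \<times> 'n \<Rightarrow> 'b) \<Rightarrow> (('n \<times> 'n) \<Rightarrow>\<^sub>0 'b) set" where
  "Omega_plus_relators r q s \<rho> lam \<iota> p =
    (let sc = (\<lambda>c. free_scale (\<iota> c));
         D = fam2 (\<lambda>g. Poly_Mapping.single g 1);
         PD = fprod 2 free_scale (fam2 p) D
     in {St234 r q s \<rho> sc PD l - sc (qpow q (- par_w r s)) (PD l) | l. length l = 4} \<union>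
        {E'_leg r q lam sc 1 D []})"

definition Omega_minus_relators :: "nat \<Rightarrow> real \<Rightarrow> nat \<Rightarrow> 'n::finite uq_rep \<Rightarrow> ('n \<Rightarrow> weight)
    \<Rightarrow> (complex \<Rightarrow> 'b::ring_1) \<Rightarrow> ('n \<times> 'n \<Rightarrow> 'b) \<Rightarrow> (('n \<times> 'n) \<Rightarrow>\<^sub>0 'b) set" where
  "Omega_minus_relators r q s \<rho> lam \<iota> p =
    (let sc = (\<lambda>c. free_scale (\<iota> c));
         D = fam2 (\<lambda>g. Poly_Mapping.single g 1);
         PD = fprod 2 free_scale (fam2 p) D
     in {S123 r q s \<rho> sc PD l - sc (qpow q (par_w r s)) (PD l) | l. length l = 4} \<union>
        {E'_leg r q lam sc 1 D []})"

definition derivation ::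
    "(complex \<Rightarrow> 'b::ring_1) \<Rightarrow> ('b, 'm::ab_group_add) bimod \<Rightarrow> ('b \<Rightarrow> 'm) \<Rightarrow> bool" where
  "derivation \<iota> M \<delta> \<longleftrightarrow> (\<forall>x y. \<delta> (x + y) = \<delta> x + \<delta> y) \<and> (\<forall>c x. \<delta> (\<iota> c * x) = cscale \<iota> M c (\<delta> x)) \<and>
     (\<forall>x y. \<delta> (x * y) = ract M (\<delta> x) y + lact M x (\<delta> y))"

text \<open>\<open>del\<close> and \<open>delb\<close> are the derivations \<open>\<partial>\<close> and its conjugate; the generators of the two summands are
  \<open>del (p (i, j))\<close> and \<open>delb (p (i, j))\<close>.\<close>

definition hk_calculus :: "nat \<Rightarrow> real \<Rightarrow> nat \<Rightarrow> 'n::finite uq_rep \<Rightarrow> ('n \<Rightarrow> weight)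
    \<Rightarrow> (complex \<Rightarrow> 'b::ring_1) \<Rightarrow> ('n \<times> 'n \<Rightarrow> 'b)
    \<Rightarrow> ('b, 'x::ab_group_add) bimod \<Rightarrow> ('b \<Rightarrow> 'x)
    \<Rightarrow> ('b, 'y::ab_group_add) bimod \<Rightarrow> ('b \<Rightarrow> 'y) \<Rightarrow> bool" where
  "hk_calculus r q s \<rho> lam \<iota> p Op del Om delb \<longleftrightarrow>
     presented_algebra \<iota> p (B_relators r q s \<rho> lam) \<and>
     bimodule \<iota> Op \<and> bimodule \<iota> Om \<and>
     presented_left_module (lact Op) (del \<circ> p) (Omega_plus_relators r q s \<rho> lam \<iota> p) \<and>
     presented_left_module (lact Om) (delb \<circ> p) (Omega_minus_relators r q s \<rho> lam \<iota> p) \<and>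
     (\<forall>l. length l = 4 \<longrightarrow>
        fprod 2 (ract Op) (fam2 (del \<circ> p)) (fam2 p) l
          = cscale \<iota> Op (qpow q (par_a r s))
              (T1234 r q s \<rho> (cscale \<iota> Op) (fprod 2 (lact Op) (fam2 p) (fam2 (del \<circ> p))) l)) \<and>
     (\<forall>l. length l = 4 \<longrightarrow>
        fprod 2 (ract Om) (fam2 (delb \<circ> p)) (fam2 p) l
          = cscale \<iota> Om (qpow q (- par_a r s))
              (T1234 r q s \<rho> (cscale \<iota> Om) (fprod 2 (lact Om) (fam2 p) (fam2 (delb \<circ> p))) l)) \<and>
     derivation \<iota> Op del \<and> derivation \<iota> Om delb"

definition diff :: "('b \<Rightarrow> 'x) \<Rightarrow> ('b \<Rightarrow> 'y) \<Rightarrow> 'b \<Rightarrow> 'x \<times> 'y" where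
  "diff del delb b = (del b, delb b)"

text \<open>The families \<open>\<partial>p\<close> and its conjugate, with components in the direct sum of the two summands.\<close>

definition dp :: "('n \<times> 'n \<Rightarrow> 'b) \<Rightarrow> ('b \<Rightarrow> 'x) \<Rightarrow> 'n list \<Rightarrow> 'x \<times> 'y::ab_group_add" where
  "dp p del = fam2 (\<lambda>g. (del (p g), 0))"

definition dbp :: "('n \<times> 'n \<Rightarrow> 'b) \<Rightarrow> ('b \<Rightarrow> 'y) \<Rightarrow> 'n list \<Rightarrow> 'x::ab_group_add \<times> 'y" where
  "dbp p delb = fam2 (\<lambda>g. (0, delb (p g)))"


section \<open>Two-forms of the universal calculus\<close>

inductive_set subbimodule_hull :: "('b, 'm::ab_group_add) bimod \<Rightarrow> 'm set \<Rightarrow> 'm set" for M Rel where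
  zero: "0 \<in> subbimodule_hull M Rel"
| base: "x \<in> Rel \<Longrightarrow> lact M a (ract M x b) \<in> subbimodule_hull M Rel"
| add: "x \<in> subbimodule_hull M Rel \<Longrightarrow> y \<in> subbimodule_hull M Rel \<Longrightarrow> x + y \<in> subbimodule_hull M Rel"

definition universal_relators ::
    "('b, 'o::ab_group_add) bimod \<Rightarrow> ('b \<Rightarrow> 'o) \<Rightarrow> ('o \<Rightarrow> 'o \<Rightarrow> 't::ab_group_add) \<Rightarrow> 't set" where
  "universal_relators M d t = {\<Sum>(a, b)\<leftarrow>xs. t (d a) (d b) | xs. (\<Sum>(a, b)\<leftarrow>xs. lact M a (d b)) = 0}"

text \<open>\<open>U\<close> is the degree 2 component of the universal calculus: the degree 2 part of the two-sided
  ideal of the tensor algebra generated by the degree 2 elements \<^const>\<open>universal_relators\<close> is the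
  sub-bimodule they generate. The map \<open>pr\<close> is the projection from the tensor square \<open>T\<close>.\<close>

definition two_forms :: "(complex \<Rightarrow> 'b::ring_1) \<Rightarrow> ('b, 'o::ab_group_add) bimod \<Rightarrow> ('b \<Rightarrow> 'o)
    \<Rightarrow> ('b, 't::ab_group_add) bimod \<Rightarrow> ('o \<Rightarrow> 'o \<Rightarrow> 't)
    \<Rightarrow> ('b, 'u::ab_group_add) bimod \<Rightarrow> ('t \<Rightarrow> 'u) \<Rightarrow> bool" where
  "two_forms \<iota> M d T t U pr \<longleftrightarrow> bimodule \<iota> U \<and>
     (\<forall>x y. pr (x + y) = pr x + pr y) \<and>
     (\<forall>b x. pr (lact T b x) = lact U b (pr x) \<and> pr (ract T x b) = ract U (pr x) b) \<and>
     surj pr \<and> {x. pr x = 0} = subbimodule_hull T (universal_relators M d t)"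

definition wedge :: "('o \<Rightarrow> 'o \<Rightarrow> 't) \<Rightarrow> ('t \<Rightarrow> 'u) \<Rightarrow> 'o \<Rightarrow> 'o \<Rightarrow> 'u" where
  "wedge t pr x y = pr (t x y)"

definition is_exterior_d :: "('b, 'o::ab_group_add) bimod \<Rightarrow> ('b \<Rightarrow> 'o) \<Rightarrow> ('o \<Rightarrow> 'o \<Rightarrow> 'u::ab_group_add)
    \<Rightarrow> ('o \<Rightarrow> 'u) \<Rightarrow> bool" where
  "is_exterior_d M d wdg d1 \<longleftrightarrow> (\<forall>x y. d1 (x + y) = d1 x + d1 y) \<and>
     (\<forall>a b. d1 (lact M a (d b)) = wdg (d a) (d b))"


section \<open>Metric, connection and curvature\<close>

text \<open>\<open>metric_comp sc t x y\<close> is \<open>E'\<^bsub>12\<^esub> E\<^bsub>23\<^esub> x \<otimes> y\<close> for two-leg families \<open>x\<close> and \<open>y\<close>.\<close>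

definition metric_comp where
  "metric_comp r q lam sc t x y = E'_leg r q lam sc 1 (E_leg sc 2 (fprod 2 t x y)) []"

definition levi_civita :: "nat \<Rightarrow> real \<Rightarrow> nat \<Rightarrow> 'n::finite uq_rep \<Rightarrow> ('n \<Rightarrow> weight)
    \<Rightarrow> (complex \<Rightarrow> 'b::ring_1) \<Rightarrow> ('n \<times> 'n \<Rightarrow> 'b)
    \<Rightarrow> ('b, 'x::ab_group_add) bimod \<Rightarrow> ('b \<Rightarrow> 'x) \<Rightarrow> ('b, 'y::ab_group_add) bimod \<Rightarrow> ('b \<Rightarrow> 'y)
    \<Rightarrow> ('b, 't::ab_group_add) bimod \<Rightarrow> ('x \<times> 'y \<Rightarrow> 'x \<times> 'y \<Rightarrow> 't) \<Rightarrow> ('x \<times> 'y \<Rightarrow> 't) \<Rightarrow> bool" where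
  "levi_civita r q s \<rho> lam \<iota> p Op del Om delb T t nabla \<longleftrightarrow>
     (let M = bimod_sum Op Om; sc = cscale \<iota> T; P = dp p del; Q = dbp p delb;
          g_pm = metric_comp r q lam sc t P Q; g_mp = metric_comp r q lam sc t Q P
      in (\<forall>x y. nabla (x + y) = nabla x + nabla y) \<and>
         (\<forall>c x. nabla (cscale \<iota> M c x) = sc c (nabla x)) \<and>
         (\<forall>b x. nabla (lact M b x) = t (diff del delb b) x + lact T b (nabla x)) \<and>
         (\<forall>i j. nabla (P [i, j]) =
            sc (qpow q (par_a r s)) (E_leg sc 2 (T1234 r q s \<rho> sc (fprod 2 t Q P)) [i, j])
            - sc (qpow q (par_a r s) * qpow q (- par_m r s)) (lact T (p (i, j)) g_mp)) \<and>
         (\<forall>i j. nabla (Q [i, j]) =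
            E_leg sc 2 (fprod 2 t P Q) [i, j]
            - sc (qpow q (- par_m r s)) (lact T (p (i, j)) g_pm)))"

text \<open>\<open>(\<and> \<otimes> id) (x \<otimes> z)\<close> for a one-form \<open>x\<close> and an element \<open>z\<close> of the tensor square; \<open>t\<close> and \<open>t2\<close> are the
  tensor product maps of one-forms with one-forms and of two-forms with one-forms.\<close>

definition wedge_id :: "('o \<Rightarrow> 'o \<Rightarrow> 't::ab_group_add) \<Rightarrow> ('t \<Rightarrow> 'u) \<Rightarrow> ('u \<Rightarrow> 'o \<Rightarrow> 'z::ab_group_add)
    \<Rightarrow> 'o \<Rightarrow> 't \<Rightarrow> 'z" where
  "wedge_id t pr t2 x z = tensor_lift t (\<lambda>y y'. t2 (wedge t pr x y) y') z"

text \<open>The two summands of \<open>d \<otimes> id - (\<and> \<otimes> id) \<circ> (id \<otimes> \<nabla>)\<close> are not balanced separately, only their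
  difference descends to the tensor product over the algebra.\<close>

definition riemann :: "('o \<Rightarrow> 'o \<Rightarrow> 't::ab_group_add) \<Rightarrow> ('t \<Rightarrow> 'u) \<Rightarrow> ('u \<Rightarrow> 'o \<Rightarrow> 'z::ab_group_add)
    \<Rightarrow> ('o \<Rightarrow> 'u) \<Rightarrow> ('o \<Rightarrow> 't) \<Rightarrow> 'o \<Rightarrow> 'z" where
  "riemann t pr t2 d1 nabla x =
     tensor_lift t (\<lambda>y y'. t2 (d1 y) y' - wedge_id t pr t2 y (nabla y')) (nabla x)"

end

theory Submission
  imports Defs
begin

text \<open>Write \<open>P\<close> and \<open>Q\<close> for the matrices of one-forms \<open>\<partial>p\<close> and its conjugate, let juxtaposition be the
  matrix product (contraction of inner legs by \<open>E\<close>, combined with \<open>\<and>\<close> or \<open>\<otimes>\<close>), and let \<open>tr\<close> be the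
  quantum trace, the contraction by \<open>E'\<close> of the outer legs. Then \<open>\<nabla>Q = P \<otimes> Q - q\<^sup>-\<^sup>m p g\<close> with
  \<open>g = tr (P \<otimes> Q)\<close>, and the curvature is \<open>D \<circ> \<nabla>\<close>, where \<open>D (x \<otimes> y) = dx \<otimes> y - x \<and> \<nabla>y\<close> satisfies
  \<open>D (b z) = db \<and> z + b D z\<close>.

  The relations of the calculus collapse to \<open>p p = p\<close>, \<open>p P = 0\<close>, \<open>P p = P\<close>, \<open>p Q = Q\<close>, \<open>Q p = 0\<close>. The
  left-hand ones result from contracting the defining eigenvalue relations by \<open>E'\<close> and pulling the
  contracted strand through the braidings; the right-hand ones follow by differentiating \<open>p p = p\<close>.
  Hence \<open>P \<and> P = (P p) \<and> P = P \<and> (p P) = 0\<close>, likewise \<open>Q \<and> Q = 0\<close> and \<open>Q \<otimes> Q = 0\<close>. Since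
  \<open>P = (1 - p) dp\<close>, one gets \<open>dP = - dp \<and> dp = - P \<and> Q - Q \<and> P\<close>, and therefore
  \<open>D (P \<otimes> Q) = - Q \<and> P \<otimes> Q + q\<^sup>-\<^sup>m P \<and> g\<close>. As \<open>tr P = 0\<close>, this gives \<open>D g = - h\<close> for
  \<open>h = tr (Q \<and> P \<otimes> Q)\<close>.

  The element \<open>h\<close> vanishes. Moving \<open>p\<close> past a matrix of forms costs the operator \<open>T\<close> and a scalar, \<open>q\<^sup>a\<close>
  for \<open>P\<close> and \<open>q\<^sup>-\<^sup>a\<close> for \<open>Q\<close>; as \<open>T\<close> only moves the two legs of \<open>p\<close> over and under the other two legs, it
  is compatible with contractions of those, so that \<open>h p = q\<^sup>-\<^sup>a p h\<close>. Taking the quantum trace, where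
  \<open>tr p = q\<^sup>m\<close> is a scalar, yields \<open>h = q\<^sup>-\<^sup>a h\<close>, that is \<open>h = 0\<close>. So \<open>D g = 0\<close> and the curvature of \<open>Q\<close> is
  \<open>- Q \<and> P \<otimes> Q + q\<^sup>-\<^sup>m P \<and> g - q\<^sup>-\<^sup>m (P + Q) \<and> g\<close>, as claimed.

  Two foundations are needed. First, the braidings are given only by a description that must be shown
  to have exactly one solution: \<open>V(\<omega>\<^sub>s)\<close> is determined up to scaling the basis vectors
  (\<open>quantum_group_chain_rep\<close>), highest tensor lowest weight vectors generate
  (\<open>chain_rep_unique_intertwiner\<close>), and explicit Hecke-type matrices are intertwiners. The rest of the
  argument rests on the rigidity properties collected in \<open>rigid_braiding\<close>. Second, maps out of tensor products are
  evaluated by their universal property (\<open>tensor_lift_universal\<close>); \<open>D\<close> is balanced because every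
  one-form is a sum of terms \<open>a db\<close> (\<open>form_induct\<close>).\<close>

section \<open>The module \<open>V(\<omega>\<^sub>s)\<close> in a weight basis\<close>

text \<open>The eigenvalue of the \<open>k\<close>-th Cartan generator on the \<open>p\<close>-th vector of a chain
  \<open>v\<^sub>1, \<dots>, v\<^bsub>r+1\<^esub>\<close> on which \<open>F\<^sub>k\<close> maps \<open>v\<^sub>k\<close> to a multiple of \<open>v\<^bsub>k+1\<^esub>\<close>.\<close>

definition chain_char :: "real \<Rightarrow> nat \<Rightarrow> nat \<Rightarrow> complex" where
  "chain_char q k p = (if p = k then of_real q else if p = Suc k then 1 / of_real q else 1)"

definition chain_exp :: "nat \<Rightarrow> nat \<Rightarrow> real" where
  "chain_exp k p = of_bool (p = k) - of_bool (p = Suc k)"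

lemma chain_char_powr:
  assumes "0 < q"
  shows "complex_of_real (q powr chain_exp k p) = chain_char q k p"
  using assms by (auto simp: chain_exp_def chain_char_def powr_minus_divide)

text \<open>The shape of the vector representation and of its dual in any weight basis. The function \<open>\<tau>\<close>
  renumbers the simple roots along the chain and \<open>\<phi>\<close> records the scaling of the basis vectors, on
  which the data impose no condition.\<close>

definition chain_rep ::
    "nat \<Rightarrow> real \<Rightarrow> 'n::finite uq_rep \<Rightarrow> (nat \<Rightarrow> nat) \<Rightarrow> ('n \<Rightarrow> nat) \<Rightarrow> (nat \<Rightarrow> complex) \<Rightarrow> bool" where
  "chain_rep r q \<rho> \<tau> pos \<phi> \<longleftrightarrow>
     \<tau> ` {1..r} = {1..r} \<and> bij_betw pos UNIV {1..r+1} \<and>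
     (\<forall>k\<in>{1..r}. \<phi> k \<noteq> 0 \<and> (\<forall>x y.
        \<rho> (UK (\<tau> k)) $ x $ y = (if x = y then chain_char q k (pos x) else 0) \<and>
        \<rho> (UKinv (\<tau> k)) $ x $ y = (if x = y then 1 / chain_char q k (pos x) else 0) \<and>
        \<rho> (UE (\<tau> k)) $ x $ y = (if pos x = k \<and> pos y = Suc k then \<phi> k else 0) \<and>
        \<rho> (UF (\<tau> k)) $ x $ y = (if pos x = Suc k \<and> pos y = k then 1 / \<phi> k else 0)))"

lemma matrix_axis_component:
  fixes A :: "complex ^ 'n::finite ^ 'm"
  shows "(A *v axis y 1) $ x = A $ x $ y"
  by (simp add: matrix_vector_mult_def axis_def if_distrib cong: if_cong)

lemma simple_root_form:
  assumes "j \<in> {1..r}"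
  shows "wt_form r (simple_root j) \<mu> = \<mu> j - \<mu> (Suc j)"
proof -
  have "wt_form r (simple_root j) \<mu> =
     (\<Sum>k=1..r+1. (if k = j then \<mu> k else 0) - (if k = Suc j then \<mu> k else 0))"
    unfolding wt_form_def simple_root_def by (intro sum.cong) auto
  also have "\<dots> = \<mu> j - \<mu> (Suc j)"
    using assms by (simp add: sum_subtractf)
  finally show ?thesis .
qed

lemma fund_weight_root:
  assumes "j \<in> {1..r}" "i \<in> {1..r}"
  shows "wt_form r (simple_root j) (fund_weight r i) = of_bool (j = i)"
  using assms unfolding simple_root_form[OF assms(1)] by (auto simp: fund_weight_def)

text \<open>The numbering of the simple roots in which the chain of \<open>V(\<omega>\<^sub>s)\<close> starts with \<open>\<alpha>\<^sub>s\<close>; it makes the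
  cases \<open>s = 1\<close> and \<open>s = r\<close> identical from here on.\<close>

definition diagram_flip :: "nat \<Rightarrow> nat \<Rightarrow> nat \<Rightarrow> nat" where
  "diagram_flip r s k = (if s = 1 then k else r + 1 - k)"

lemma diagram_flip_image: "diagram_flip r s ` {1..r} = {1..r}"
proof -
  have "(\<lambda>k. r + 1 - k) ` {1..r} = {1..r}"
  proof (intro equalityI subsetI)
    fix x assume "x \<in> {1..r}"
    then show "x \<in> (\<lambda>k. r + 1 - k) ` {1..r}" by (intro image_eqI[of _ _ "r + 1 - x"]) auto
  qed auto
  then show ?thesis by (cases "s = 1") (auto simp: diagram_flip_def[abs_def])
qed

lemma diagram_flip_mem: "k \<in> {1..r} \<Longrightarrow> diagram_flip r s k \<in> {1..r}"
  using diagram_flip_image by blast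

lemma cartan_diagram_flip:
  assumes "j \<in> {1..r}" "i \<in> {1..r}"
  shows "wt_form r (simple_root (diagram_flip r s j)) (simple_root (diagram_flip r s i))
    = chain_exp j i - chain_exp j (Suc i)"
  unfolding simple_root_form[OF diagram_flip_mem[OF assms(1)]]
  using assms by (auto simp: diagram_flip_def simple_root_def chain_exp_def)

lemma scaleR_matrix_vector:
  fixes A :: "complex ^ 'n::finite ^ 'm"
  shows "(c *\<^sub>R A) *v u = c *\<^sub>R (A *v u)"
  by (simp add: vec_eq_iff matrix_vector_mult_def scaleR_sum_right)

lemma matrix_vector_scaleR:
  fixes A :: "complex ^ 'n::finite ^ 'm"
  shows "A *v (c *\<^sub>R u) = c *\<^sub>R (A *v u)"
  by (simp add: vec_eq_iff matrix_vector_mult_def scaleR_sum_right)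

lemma wt_form_commute: "wt_form r a b = wt_form r b a"
  by (simp add: wt_form_def mult.commute)

text \<open>In coordinates: \<open>e\<^bsub>k'\<^esub> = e\<^sub>k - \<alpha>\<^sub>i\<close> modulo the constant vectors forces \<open>k = i\<close> and \<open>k' = i + 1\<close>. The
  difference \<open>u\<close> of the two sides is constant, and its coordinates sum to zero.\<close>

lemma chain_exp_step:
  assumes k: "k \<in> {1..r+1}" "k' \<in> {1..r+1}" and i: "i \<in> {1..r}"
    and eq: "\<And>j. j \<in> {1..r} \<Longrightarrow> chain_exp j k' = chain_exp j k - (chain_exp j i - chain_exp j (Suc i))"
  shows "k = i \<and> k' = Suc i"
proof -
  define u :: "nat \<Rightarrow> real" where
    "u j = of_bool (k' = j) - of_bool (k = j) + of_bool (i = j) - of_bool (Suc i = j)" for j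
  have step: "u (Suc j) = u j" if "j \<in> {1..r}" for j
    using eq[OF that] by (simp add: u_def chain_exp_def)
  have const: "u j = u 1" if "j \<ge> 1" "j \<le> r + 1" for j
    using that
  proof (induction j rule: dec_induct)
    case (step n)
    then show ?case using \<open>\<And>j. j \<in> {1..r} \<Longrightarrow> u (Suc j) = u j\<close>[of n] by simp
  qed simp
  have "(\<Sum>j\<in>{1..r+1}. u j) = 0"
    using k i by (simp add: u_def sum.distrib sum_subtractf of_bool_def)
  moreover have "(\<Sum>j\<in>{1..r+1}. u j) = (\<Sum>j\<in>{1..r+1}. u 1)"
    by (intro sum.cong refl const) auto
  ultimately have "u 1 = 0" by simp
  then have z: "u j = 0" if "j \<in> {1..r+1}" for j using const[of j] that by simp
  have "u k' = 0" "u k = 0" "u i = 0" using z k i by auto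
  then show ?thesis by (auto simp: u_def of_bool_def split: if_splits)
qed

lemma chain_exp_inj:
  assumes k: "k \<in> {1..r+1}" "k' \<in> {1..r+1}"
    and eq: "\<And>j. j \<in> {1..r} \<Longrightarrow> chain_exp j k = chain_exp j k'"
  shows "k = k'"
proof -
  have "\<not> k < k'" if "k \<in> {1..r+1}" "k' \<in> {1..r+1}"
      "\<And>j. j \<in> {1..r} \<Longrightarrow> chain_exp j k = chain_exp j k'" for k k' :: nat
  proof
    assume "k < k'"
    then show False using that(1,2) that(3)[of k] by (auto simp: chain_exp_def of_bool_def split: if_splits)
  qed
  from this[OF k eq] this[OF k(2,1) eq[symmetric]] show ?thesis by simp
qed

lemma uq_module_relations:
  assumes "uq_module r q \<rho>" "i \<in> {1..r}" "j \<in> {1..r}"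
  shows "\<rho> (UKinv i) ** \<rho> (UK i) = mat 1"
    and "\<rho> (UK i) ** \<rho> (UE j) ** \<rho> (UKinv i)
          = q powr (wt_form r (simple_root i) (simple_root j)) *\<^sub>R \<rho> (UE j)"
    and "\<rho> (UK i) ** \<rho> (UF j) ** \<rho> (UKinv i)
          = q powr (- wt_form r (simple_root i) (simple_root j)) *\<^sub>R \<rho> (UF j)"
    and "\<rho> (UE i) ** \<rho> (UF j) - \<rho> (UF j) ** \<rho> (UE i)
          = (if i = j then (1 / (q - 1 / q)) *\<^sub>R (\<rho> (UK i) - \<rho> (UKinv i)) else 0)"
  using assms unfolding uq_module_def by blast+

lemma q_minus_inverse_nonzero:
  fixes q :: real
  assumes "0 < q" "q < 1"
  shows "q - 1 / q \<noteq> 0"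
proof
  assume "q - 1 / q = 0"
  then have "q * q = 1" using assms by (simp add: field_simps)
  moreover have "q * q < 1 * 1" using assms by (intro mult_strict_mono) auto
  ultimately show False by simp
qed

text \<open>Applying \<open>F\<^sub>1, F\<^sub>2, \<dots>\<close> successively to the highest weight vector never gives zero, because
  \<open>E\<^sub>k F\<^sub>k v\<^sub>k = v\<^sub>k\<close>: the vector \<open>v\<^sub>k\<close> is killed by \<open>E\<^sub>k\<close> and has \<open>K\<^sub>k\<close>-eigenvalue \<open>q\<close>.\<close>

lemma quantum_group_chain_vectors:
  fixes \<rho> :: "'n::finite uq_rep"
  assumes qg: "quantum_group_data r q s \<rho> lam"
  defines "\<tau> \<equiv> diagram_flip r s"
  obtains v where "\<And>k. k \<in> {1..r+1} \<Longrightarrow> v k \<noteq> 0"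
    and "\<And>k j. k \<in> {1..r+1} \<Longrightarrow> j \<in> {1..r} \<Longrightarrow>
          \<rho> (UK (\<tau> j)) *v v k = (q powr chain_exp j k) *\<^sub>R v k"
proof -
  have r: "1 \<le> r" and q: "0 < q" "q < 1" and s: "s = 1 \<or> s = r"
    and um: "uq_module r q \<rho>" and "\<exists>v. highest_vector r q \<rho> (fund_weight r s) v"
    using qg by (auto simp: quantum_group_data_def simple_hw_module_def)
  then obtain v0 where v0: "highest_vector r q \<rho> (fund_weight r s) v0" by blast
  have \<tau>: "\<tau> k \<in> {1..r}" if "k \<in> {1..r}" for k using that diagram_flip_mem by (simp add: \<tau>_def)
  have \<tau>s: "\<tau> k = s \<longleftrightarrow> k = 1" if "k \<in> {1..r}" for k
    using that s by (auto simp: \<tau>_def diagram_flip_def)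
  have \<tau>inj: "\<tau> k = \<tau> j \<longleftrightarrow> k = j" if "k \<in> {1..r}" "j \<in> {1..r}" for k j
    using that by (auto simp: \<tau>_def diagram_flip_def)
  note rel = uq_module_relations[OF um]
  define v where "v = rec_nat v0 (\<lambda>k u. if k = 0 then u else \<rho> (UF (\<tau> k)) *v u)"
  have v1: "v (Suc 0) = v0" by (simp add: v_def)
  have vS: "v (Suc k) = \<rho> (UF (\<tau> k)) *v v k" if "k \<ge> 1" for k using that by (simp add: v_def)
  have KF: "\<rho> (UK (\<tau> j)) *v (\<rho> (UF (\<tau> i)) *v u) =
      (q powr - (chain_exp j i - chain_exp j (Suc i))) *\<^sub>R (\<rho> (UF (\<tau> i)) *v (\<rho> (UK (\<tau> j)) *v u))"
    if "j \<in> {1..r}" "i \<in> {1..r}" for j i u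
  proof -
    let ?K = "\<rho> (UK (\<tau> j))" and ?L = "\<rho> (UKinv (\<tau> j))" and ?F = "\<rho> (UF (\<tau> i))"
    have LK: "?L ** ?K = mat 1" using rel(1) \<tau>[OF that(1)] by blast
    have "?K ** ?F ** ?L = q powr - (chain_exp j i - chain_exp j (Suc i)) *\<^sub>R ?F"
      using rel(3)[OF \<tau>[OF that(1)] \<tau>[OF that(2)]] cartan_diagram_flip[OF that, of s]
      by (simp add: \<tau>_def)
    then have "?K ** ?F ** ?L ** ?K = (q powr - (chain_exp j i - chain_exp j (Suc i)) *\<^sub>R ?F) ** ?K"
      by simp
    then have "?K ** ?F = q powr - (chain_exp j i - chain_exp j (Suc i)) *\<^sub>R (?F ** ?K)"
      by (simp add: matrix_mul_assoc[symmetric] LK scalar_matrix_assoc)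
    then show ?thesis
      by (metis matrix_vector_mul_assoc scaleR_matrix_vector)
  qed
  have EF: "\<rho> (UE (\<tau> i)) *v (\<rho> (UF (\<tau> j)) *v u) = \<rho> (UF (\<tau> j)) *v (\<rho> (UE (\<tau> i)) *v u) +
       (if i = j then (1 / (q - 1 / q)) *\<^sub>R (\<rho> (UK (\<tau> i)) *v u - \<rho> (UKinv (\<tau> i)) *v u) else 0)"
    if "j \<in> {1..r}" "i \<in> {1..r}" for i j u
  proof -
    have "\<rho> (UE (\<tau> i)) ** \<rho> (UF (\<tau> j)) - \<rho> (UF (\<tau> j)) ** \<rho> (UE (\<tau> i))
        = (if i = j then (1 / (q - 1 / q)) *\<^sub>R (\<rho> (UK (\<tau> i)) - \<rho> (UKinv (\<tau> i))) else 0)"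
      using rel(4)[OF \<tau>[OF that(2)] \<tau>[OF that(1)]] \<tau>inj[OF that(2,1)] by simp
    then have "(\<rho> (UE (\<tau> i)) ** \<rho> (UF (\<tau> j)) - \<rho> (UF (\<tau> j)) ** \<rho> (UE (\<tau> i))) *v u
        = (if i = j then (1 / (q - 1 / q)) *\<^sub>R (\<rho> (UK (\<tau> i)) - \<rho> (UKinv (\<tau> i))) else 0) *v u"
      by simp
    then show ?thesis
      by (auto simp: matrix_vector_mult_diff_rdistrib matrix_vector_mul_assoc
          scaleR_matrix_vector algebra_simps)
  qed
  have main: "v k \<noteq> 0 \<and> (\<forall>j\<in>{1..r}. \<rho> (UK (\<tau> j)) *v v k = (q powr chain_exp j k) *\<^sub>R v k) \<and>
      (\<forall>j\<in>{1..r}. k \<le> j \<longrightarrow> \<rho> (UE (\<tau> j)) *v v k = 0)" if "k \<ge> 1" "k \<le> r + 1" for k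
    using that
  proof (induction k rule: dec_induct)
    case base
    have "chain_exp j 1 = wt_form r (simple_root (\<tau> j)) (fund_weight r s)" if "j \<in> {1..r}" for j
      using fund_weight_root[OF \<tau>[OF that], of s] \<tau>s[OF that] s r that by (auto simp: chain_exp_def)
    then show ?case using v0 \<tau> by (auto simp: v1 highest_vector_def weight_vector_def)
  next
    case (step k)
    then have k: "k \<in> {1..r}" by simp
    have IH: "v k \<noteq> 0" "\<And>j. j \<in> {1..r} \<Longrightarrow> \<rho> (UK (\<tau> j)) *v v k = (q powr chain_exp j k) *\<^sub>R v k"
      "\<And>j. j \<in> {1..r} \<Longrightarrow> k \<le> j \<Longrightarrow> \<rho> (UE (\<tau> j)) *v v k = 0"
      using step by auto
    have K: "\<rho> (UK (\<tau> j)) *v v (Suc k) = (q powr chain_exp j (Suc k)) *\<^sub>R v (Suc k)"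
      if "j \<in> {1..r}" for j
      using step.hyps KF[OF that k] IH(2)[OF that]
      by (simp add: vS powr_add[symmetric] scaleR_matrix_vector matrix_vector_scaleR)
    have E: "\<rho> (UE (\<tau> j)) *v v (Suc k) = 0" if "j \<in> {1..r}" "Suc k \<le> j" for j
      using that step.hyps by (simp add: vS EF[OF k that(1)] IH(3))
    have "\<rho> (UKinv (\<tau> k)) *v v k = (1 / q) *\<^sub>R v k"
    proof -
      have "v k = (\<rho> (UKinv (\<tau> k)) ** \<rho> (UK (\<tau> k))) *v v k" using rel(1) \<tau>[OF k] by simp
      also have "\<dots> = \<rho> (UKinv (\<tau> k)) *v (q *\<^sub>R v k)"
        using IH(2)[OF k] q by (simp add: chain_exp_def matrix_vector_mul_assoc[symmetric])
      finally have "v k = \<rho> (UKinv (\<tau> k)) *v (q *\<^sub>R v k)" .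
      then have "v k = q *\<^sub>R (\<rho> (UKinv (\<tau> k)) *v v k)"
        by (simp only: matrix_vector_scaleR)
      then have "(1 / q) *\<^sub>R v k = (1 / q) *\<^sub>R (q *\<^sub>R (\<rho> (UKinv (\<tau> k)) *v v k))"
        by (rule arg_cong)
      then show ?thesis using q by simp
    qed
    then have "\<rho> (UE (\<tau> k)) *v v (Suc k) = (1 / (q - 1 / q)) *\<^sub>R (q *\<^sub>R v k - (1 / q) *\<^sub>R v k)"
      using step.hyps q by (simp add: vS EF[OF k k] IH(3)[OF k] IH(2)[OF k] chain_exp_def)
    also have "\<dots> = v k"
    proof -
      have "q - 1 / q \<noteq> 0" by (rule q_minus_inverse_nonzero[OF q])
      then show ?thesis by (simp add: scaleR_diff_left[symmetric])
    qed
    finally have "v (Suc k) \<noteq> 0" using IH(1) by auto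
    then show ?case using K E by auto
  qed
  show ?thesis by (rule that[of v]) (use main in auto)
qed

text \<open>The weight shift of a nonzero matrix entry of a generator, read off from its commutation with a
  diagonal Cartan generator.\<close>

lemma diagonal_conjugation_entry:
  fixes K L A :: "complex ^ 'n::finite ^ 'n"
  assumes q: "0 < q" "q < 1"
    and K: "\<And>x y. K $ x $ y = (if x = y then of_real (q powr \<theta> x) else 0)"
    and inv: "L ** K = mat 1" and rel: "K ** A ** L = (q powr c) *\<^sub>R A"
    and nz: "A $ x $ y \<noteq> 0"
  shows "\<theta> x = c + \<theta> y"
proof -
  have "K ** A = (q powr c) *\<^sub>R (A ** K)"
    using arg_cong[OF rel, of "\<lambda>M. M ** K"] inv
    by (simp add: matrix_mul_assoc[symmetric] scalar_matrix_assoc)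
  then have "(K ** A) $ x $ y = ((q powr c) *\<^sub>R (A ** K)) $ x $ y" by simp
  moreover have "(K ** A) $ x $ y = of_real (q powr \<theta> x) * A $ x $ y"
    by (simp add: matrix_matrix_mult_def K if_distrib[of "\<lambda>z. z * _"] cong: if_cong)
  moreover have "(A ** K) $ x $ y = A $ x $ y * of_real (q powr \<theta> y)"
    by (simp add: matrix_matrix_mult_def K if_distrib[of "\<lambda>z. _ * z"] cong: if_cong)
  ultimately have "complex_of_real (q powr \<theta> x) * A $ x $ y = of_real (q powr (c + \<theta> y)) * A $ x $ y"
    by (simp add: powr_add scaleR_conv_of_real[where 'a=complex] mult_ac)
  then have "q powr \<theta> x = q powr (c + \<theta> y)" using nz by (simp del: of_real_mult)
  then show ?thesis using q by (simp add: powr_inj)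
qed

text \<open>The \<open>r + 1\<close> chain vectors have distinct characters, and the Cartan generators are diagonal in the
  given basis, so the supports of the chain vectors are disjoint nonempty subsets of a basis with
  \<open>r + 1\<close> elements. Hence every chain vector is a multiple of a basis vector, and the weights leave
  room for a single nonzero entry in each \<open>E\<^sub>k\<close> and \<open>F\<^sub>k\<close>; the relation for \<open>E\<^sub>k F\<^sub>k - F\<^sub>k E\<^sub>k\<close> makes the two
  entries inverse to each other.\<close>

lemma quantum_group_chain_rep:
  fixes \<rho> :: "'n::finite uq_rep"
  assumes qg: "quantum_group_data r q s \<rho> lam"
  defines "\<tau> \<equiv> diagram_flip r s"
  obtains pos \<phi> where "chain_rep r q \<rho> \<tau> pos \<phi>"
    and "\<And>j x. j \<in> {1..r} \<Longrightarrow> wt_form r (simple_root (\<tau> j)) (lam x) = chain_exp j (pos x)"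
proof -
  have r: "1 \<le> r" and q: "0 < q" "q < 1" and card: "CARD('n) = r + 1"
    and um: "uq_module r q \<rho>" and wv: "\<And>x. weight_vector r q \<rho> (lam x) (axis x 1)"
    using qg by (auto simp: quantum_group_data_def simple_hw_module_def)
  have \<tau>: "\<tau> k \<in> {1..r}" if "k \<in> {1..r}" for k using that diagram_flip_mem by (simp add: \<tau>_def)
  have \<tau>inj: "\<tau> k = \<tau> j \<longleftrightarrow> k = j" if "k \<in> {1..r}" "j \<in> {1..r}" for k j
    using that by (auto simp: \<tau>_def diagram_flip_def)
  obtain v where v: "\<And>k. k \<in> {1..r+1} \<Longrightarrow> v k \<noteq> 0"
    and Kv: "\<And>k j. k \<in> {1..r+1} \<Longrightarrow> j \<in> {1..r} \<Longrightarrow>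
          \<rho> (UK (\<tau> j)) *v v k = (q powr chain_exp j k) *\<^sub>R v k"
    using quantum_group_chain_vectors[OF qg] unfolding \<tau>_def by blast
  define \<theta> where "\<theta> j x = wt_form r (simple_root (\<tau> j)) (lam x)" for j x
  have K: "\<rho> (UK (\<tau> j)) $ x $ y = (if x = y then of_real (q powr \<theta> j x) else 0)"
    if "j \<in> {1..r}" for j x y
  proof -
    have "\<rho> (UK (\<tau> j)) *v axis y 1 = q powr \<theta> j y *\<^sub>R axis y 1"
      using wv[of y] \<tau>[OF that] by (auto simp: weight_vector_def \<theta>_def)
    then have "(\<rho> (UK (\<tau> j)) *v axis y 1) $ x = (q powr \<theta> j y *\<^sub>R axis y 1) $ x" by simp
    then have "\<rho> (UK (\<tau> j)) $ x $ y = q powr \<theta> j y *\<^sub>R (axis y 1 $ x)"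
      by (simp only: matrix_axis_component vector_scaleR_component)
    then show ?thesis by (auto simp: axis_def scaleR_conv_of_real)
  qed
  have supp: "\<theta> j x = chain_exp j k" if "k \<in> {1..r+1}" "j \<in> {1..r}" "v k $ x \<noteq> 0" for j k x
  proof -
    have "(\<rho> (UK (\<tau> j)) *v v k) $ x = of_real (q powr \<theta> j x) * v k $ x"
      by (simp add: matrix_vector_mult_def K[OF that(2)] if_distrib[of "\<lambda>z. z * _"] cong: if_cong)
    moreover have "(\<rho> (UK (\<tau> j)) *v v k) $ x = of_real (q powr chain_exp j k) * v k $ x"
      unfolding Kv[OF that(1,2)] vector_scaleR_component by (simp add: scaleR_conv_of_real)
    ultimately have "q powr \<theta> j x = q powr chain_exp j k" using that(3) by simp
    then show ?thesis using q by (simp add: powr_inj)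
  qed
  have "\<exists>x. v k $ x \<noteq> 0" if "k \<in> {1..r+1}" for k using v[OF that] by (auto simp: vec_eq_iff)
  then obtain e where e: "\<And>k. k \<in> {1..r+1} \<Longrightarrow> v k $ e k \<noteq> 0" by metis
  have inj: "inj_on e {1..r+1}"
  proof (rule inj_onI)
    fix k k' assume k: "k \<in> {1..r+1}" "k' \<in> {1..r+1}" and eq: "e k = e k'"
    show "k = k'"
    proof (rule chain_exp_inj[OF k])
      fix j assume j: "j \<in> {1..r}"
      show "chain_exp j k = chain_exp j k'"
        using supp[OF k(1) j e[OF k(1)]] supp[OF k(2) j e[OF k(2)]] eq by simp
    qed
  qed
  have "e ` {1..r+1} = UNIV"
    by (rule card_subset_eq) (use card card_image[OF inj] in auto)
  then have bij: "bij_betw e {1..r+1} UNIV" using inj by (simp add: bij_betw_def)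
  define pos where "pos = inv_into {1..r+1} e"
  have pos: "bij_betw pos UNIV {1..r+1}" unfolding pos_def by (rule bij_betw_inv_into[OF bij])
  have pos_mem: "pos x \<in> {1..r+1}" for x using pos by (auto simp: bij_betw_def)
  have e_pos: "e (pos x) = x" for x unfolding pos_def by (rule bij_betw_inv_into_right[OF bij]) simp
  have pos_e: "pos (e k) = k" if "k \<in> {1..r+1}" for k
    unfolding pos_def by (rule bij_betw_inv_into_left[OF bij that])
  have \<theta>: "\<theta> j x = chain_exp j (pos x)" if "j \<in> {1..r}" for j x
    using supp[OF pos_mem that e[OF pos_mem], of x] by (simp add: e_pos)
  note rel = uq_module_relations[OF um]
  have cK: "\<rho> (UK (\<tau> k)) $ x $ y = (if x = y then chain_char q k (pos x) else 0)"
    if "k \<in> {1..r}" for k x y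
    using q by (simp add: K[OF that] \<theta>[OF that] chain_char_powr)
  have cK_nz: "chain_char q k p \<noteq> 0" for k p using q by (auto simp: chain_char_def)
  have cL: "\<rho> (UKinv (\<tau> k)) $ x $ y = (if x = y then 1 / chain_char q k (pos x) else 0)"
    if "k \<in> {1..r}" for k x y
  proof -
    have "(\<rho> (UKinv (\<tau> k)) ** \<rho> (UK (\<tau> k))) $ x $ y = mat 1 $ x $ y"
      using rel(1)[OF \<tau>[OF that] \<tau>[OF that]] by simp
    then have "\<rho> (UKinv (\<tau> k)) $ x $ y * chain_char q k (pos y) = (if x = y then 1 else 0)"
      by (simp add: matrix_matrix_mult_def cK[OF that] mat_def if_distrib[of "\<lambda>z. _ * z"] cong: if_cong)
    then show ?thesis using cK_nz[of k "pos y"] by (auto simp: field_simps split: if_splits)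
  qed
  have E: "pos x = k \<and> pos y = Suc k" if "k \<in> {1..r}" "\<rho> (UE (\<tau> k)) $ x $ y \<noteq> 0" for k x y
  proof -
    have "chain_exp j (pos x) = (chain_exp j k - chain_exp j (Suc k)) + chain_exp j (pos y)"
      if j: "j \<in> {1..r}" for j
      using diagonal_conjugation_entry[OF q K[OF j] rel(1)[OF \<tau>[OF j] \<tau>[OF j]]
          rel(2)[OF \<tau>[OF j] \<tau>[OF \<open>k \<in> {1..r}\<close>]]  \<open>\<rho> (UE (\<tau> k)) $ x $ y \<noteq> 0\<close>]
        cartan_diagram_flip[OF j \<open>k \<in> {1..r}\<close>, of s] by (simp add: \<theta>[OF j] \<tau>_def)
    then have "chain_exp j (pos y) = chain_exp j (pos x) - (chain_exp j k - chain_exp j (Suc k))"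
      if "j \<in> {1..r}" for j using that by fastforce
    then show ?thesis by (rule chain_exp_step[OF pos_mem pos_mem that(1)])
  qed
  have F: "pos x = Suc k \<and> pos y = k" if "k \<in> {1..r}" "\<rho> (UF (\<tau> k)) $ x $ y \<noteq> 0" for k x y
  proof -
    have "chain_exp j (pos x) = - (chain_exp j k - chain_exp j (Suc k)) + chain_exp j (pos y)"
      if j: "j \<in> {1..r}" for j
      using diagonal_conjugation_entry[OF q K[OF j] rel(1)[OF \<tau>[OF j] \<tau>[OF j]]
          rel(3)[OF \<tau>[OF j] \<tau>[OF \<open>k \<in> {1..r}\<close>]]  \<open>\<rho> (UF (\<tau> k)) $ x $ y \<noteq> 0\<close>]
        cartan_diagram_flip[OF j \<open>k \<in> {1..r}\<close>, of s] by (simp add: \<theta>[OF j] \<tau>_def)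
    then have "chain_exp j (pos x) = chain_exp j (pos y) - (chain_exp j k - chain_exp j (Suc k))"
      if "j \<in> {1..r}" for j using that by fastforce
    then have "pos y = k \<and> pos x = Suc k" by (rule chain_exp_step[OF pos_mem pos_mem that(1)])
    then show ?thesis by simp
  qed
  define \<phi> where "\<phi> k = \<rho> (UE (\<tau> k)) $ e k $ e (Suc k)" for k
  \<comment> \<open>The diagonal entry at \<open>v\<^sub>k\<close> of the relation between \<open>E\<^sub>k\<close> and \<open>F\<^sub>k\<close>, where \<open>F\<^sub>k E\<^sub>k\<close> vanishes.\<close>
  have EF: "\<phi> k * \<rho> (UF (\<tau> k)) $ e (Suc k) $ e k = 1" if k: "k \<in> {1..r}" for k
  proof -
    have "q - 1 / q \<noteq> 0" by (rule q_minus_inverse_nonzero[OF q])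
    then have qz: "complex_of_real (q - 1 / q) \<noteq> 0" using of_real_eq_0_iff by blast
    have pe: "pos (e k) = k" "pos (e (Suc k)) = Suc k" using pos_e k by auto
    have "(\<rho> (UE (\<tau> k)) ** \<rho> (UF (\<tau> k)) - \<rho> (UF (\<tau> k)) ** \<rho> (UE (\<tau> k))) $ e k $ e k
        = ((1 / (q - 1 / q)) *\<^sub>R (\<rho> (UK (\<tau> k)) - \<rho> (UKinv (\<tau> k)))) $ e k $ e k"
      using rel(4)[OF \<tau>[OF k] \<tau>[OF k]] by simp
    also have "\<dots> = of_real (1 / (q - 1 / q)) * (of_real q - 1 / of_real q)"
      unfolding vector_scaleR_component vector_minus_component cK[OF k] cL[OF k] pe
      by (simp add: chain_char_def scaleR_conv_of_real)
    also have "\<dots> = 1" using qz by simp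
    also have "(\<rho> (UE (\<tau> k)) ** \<rho> (UF (\<tau> k)) - \<rho> (UF (\<tau> k)) ** \<rho> (UE (\<tau> k))) $ e k $ e k
        = (\<rho> (UE (\<tau> k)) ** \<rho> (UF (\<tau> k))) $ e k $ e k - (\<rho> (UF (\<tau> k)) ** \<rho> (UE (\<tau> k))) $ e k $ e k"
      by simp
    also have "(\<rho> (UF (\<tau> k)) ** \<rho> (UE (\<tau> k))) $ e k $ e k = 0"
    proof -
      have "\<rho> (UE (\<tau> k)) $ x $ e k = 0" for x using E[OF k, of x "e k"] pe by auto
      then show ?thesis by (simp add: matrix_matrix_mult_def)
    qed
    also have "(\<rho> (UE (\<tau> k)) ** \<rho> (UF (\<tau> k))) $ e k $ e k
        = (\<Sum>y\<in>UNIV. \<rho> (UE (\<tau> k)) $ e k $ y * \<rho> (UF (\<tau> k)) $ y $ e k)"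
      by (simp add: matrix_matrix_mult_def)
    also have "\<dots> = (\<Sum>y\<in>{e (Suc k)}. \<rho> (UE (\<tau> k)) $ e k $ y * \<rho> (UF (\<tau> k)) $ y $ e k)"
      using E[OF k, of "e k"] e_pos by (intro sum.mono_neutral_right) (auto, metis)
    finally show ?thesis by (simp add: \<phi>_def)
  qed
  have entry: "\<phi> k \<noteq> 0 \<and>
      \<rho> (UE (\<tau> k)) $ x $ y = (if pos x = k \<and> pos y = Suc k then \<phi> k else 0) \<and>
      \<rho> (UF (\<tau> k)) $ x $ y = (if pos x = Suc k \<and> pos y = k then 1 / \<phi> k else 0)"
    if k: "k \<in> {1..r}" for k x y
  proof -
    have nz: "\<phi> k \<noteq> 0" using EF[OF k] by auto
    then have Fv: "\<rho> (UF (\<tau> k)) $ e (Suc k) $ e k = 1 / \<phi> k"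
      using EF[OF k] by (simp add: field_simps)
    have "\<rho> (UE (\<tau> k)) $ x $ y = (if pos x = k \<and> pos y = Suc k then \<phi> k else 0)"
      using E[OF k, of x y] e_pos[of x] e_pos[of y] by (cases "pos x = k \<and> pos y = Suc k") (auto simp: \<phi>_def)
    moreover have "\<rho> (UF (\<tau> k)) $ x $ y = (if pos x = Suc k \<and> pos y = k then 1 / \<phi> k else 0)"
    proof (cases "pos x = Suc k \<and> pos y = k")
      case True
      then have "x = e (Suc k)" "y = e k" using e_pos[of x] e_pos[of y] by auto
      then show ?thesis using True Fv by simp
    next
      case False
      then show ?thesis using F[OF k, of x y] by auto
    qed
    ultimately show ?thesis using nz by simp
  qed
  show ?thesis
  proof (rule that)
    show "chain_rep r q \<rho> \<tau> pos \<phi>"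
      unfolding chain_rep_def using pos cK cL entry diagram_flip_image by (auto simp: \<tau>_def)
    show "wt_form r (simple_root (\<tau> j)) (lam x) = chain_exp j (pos x)" if "j \<in> {1..r}" for j x
      using \<theta>[OF that] by (simp add: \<theta>_def)
  qed
qed

text \<open>Dualizing reverses the chain and renumbers the simple roots accordingly, so everything proved
  about \<open>V \<otimes> V\<close> applies to \<open>V\<^sup>* \<otimes> V\<^sup>*\<close>.\<close>

lemma chain_rep_dual:
  fixes \<rho> :: "'n::finite uq_rep"
  assumes \<rho>: "chain_rep r q \<rho> \<tau> pos \<phi>" and q: "0 < q"
  shows "chain_rep r q (dual_rep \<rho>) (\<lambda>k. \<tau> (r + 1 - k)) (\<lambda>x. r + 2 - pos x)
      (\<lambda>k. - (of_real q * \<phi> (r + 1 - k)))"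
proof -
  have bij: "bij_betw pos UNIV {1..r+1}" and \<tau>: "\<tau> ` {1..r} = {1..r}"
    using \<rho> by (auto simp: chain_rep_def)
  have pos_mem: "pos x \<in> {1..r+1}" for x using bij by (auto simp: bij_betw_def)
  have "bij_betw (\<lambda>p. r + 2 - p) {1..r+1} {1..r+1}"
    by (rule bij_betwI[where g = "\<lambda>p. r + 2 - p"]) auto
  from bij_betw_trans[OF bij this] have bij': "bij_betw (\<lambda>x. r + 2 - pos x) UNIV {1..r+1}"
    by (simp add: comp_def)
  have "(\<lambda>k. \<tau> (r + 1 - k)) ` {1..r} = \<tau> ` ((\<lambda>k. r + 1 - k) ` {1..r})" by auto
  also have "(\<lambda>k. r + 1 - k) ` {1..r} = {1..r}"
    using diagram_flip_image[of r 2] by (simp add: diagram_flip_def[abs_def])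
  finally have \<tau>': "(\<lambda>k. \<tau> (r + 1 - k)) ` {1..r} = {1..r}" using \<tau> by simp
  show ?thesis
    unfolding chain_rep_def
  proof (intro conjI ballI allI bij' \<tau>')
    fix k x y assume k: "k \<in> {1..r}"
    define j where "j = r + 1 - k"
    have j: "j \<in> {1..r}" using k by (auto simp: j_def)
    have M: "\<phi> j \<noteq> 0"
      "\<And>x y. \<rho> (UK (\<tau> j)) $ x $ y = (if x = y then chain_char q j (pos x) else 0)"
      "\<And>x y. \<rho> (UKinv (\<tau> j)) $ x $ y = (if x = y then 1 / chain_char q j (pos x) else 0)"
      "\<And>x y. \<rho> (UE (\<tau> j)) $ x $ y = (if pos x = j \<and> pos y = Suc j then \<phi> j else 0)"
      "\<And>x y. \<rho> (UF (\<tau> j)) $ x $ y = (if pos x = Suc j \<and> pos y = j then 1 / \<phi> j else 0)"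
      using \<rho> j by (auto simp: chain_rep_def)
    have flip: "r + 2 - pos x = k \<longleftrightarrow> pos x = Suc j" "r + 2 - pos x = Suc k \<longleftrightarrow> pos x = j" for x
      using pos_mem[of x] k by (auto simp: j_def)
    have char: "chain_char q k (r + 2 - pos x) = 1 / chain_char q j (pos x)" for x
      using q flip[of x] by (auto simp: chain_char_def)
    show "- (of_real q * \<phi> (r + 1 - k)) \<noteq> 0" using M(1) q by (simp add: j_def)
    show "dual_rep \<rho> (UK (\<tau> (r + 1 - k))) $ x $ y
        = (if x = y then chain_char q k (r + 2 - pos x) else 0)"
      unfolding j_def[symmetric] char by (simp add: transpose_def M(3))
    show "dual_rep \<rho> (UKinv (\<tau> (r + 1 - k))) $ x $ y
        = (if x = y then 1 / chain_char q k (r + 2 - pos x) else 0)"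
      unfolding j_def[symmetric] char by (simp add: transpose_def M(2))
    have "(\<rho> (UE (\<tau> j)) ** \<rho> (UKinv (\<tau> j))) $ y $ x = \<rho> (UE (\<tau> j)) $ y $ x / chain_char q j (pos x)"
      by (simp add: matrix_matrix_mult_def M(3) if_distrib[of "\<lambda>z. _ * z"] cong: if_cong)
    then show "dual_rep \<rho> (UE (\<tau> (r + 1 - k))) $ x $ y =
        (if r + 2 - pos x = k \<and> r + 2 - pos y = Suc k then - (of_real q * \<phi> (r + 1 - k)) else 0)"
      unfolding j_def[symmetric] flip by (auto simp: transpose_def M(4) chain_char_def)
    have "(\<rho> (UK (\<tau> j)) ** \<rho> (UF (\<tau> j))) $ y $ x = chain_char q j (pos y) * \<rho> (UF (\<tau> j)) $ y $ x"
      by (simp add: matrix_matrix_mult_def M(2) if_distrib[of "\<lambda>z. z * _"] cong: if_cong)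
    then show "dual_rep \<rho> (UF (\<tau> (r + 1 - k))) $ x $ y =
        (if r + 2 - pos x = Suc k \<and> r + 2 - pos y = k then 1 / - (of_real q * \<phi> (r + 1 - k)) else 0)"
      unfolding j_def[symmetric] flip by (auto simp: transpose_def M(5) chain_char_def)
  qed
qed

section \<open>Hecke-type matrices\<close>

text \<open>The braiding of the vector representation: a flip with weight \<open>d\<close> on equal and \<open>c\<close> on distinct
  basis vectors, plus \<open>h\<close> times the identity on one of the two orders of distinct basis vectors. With
  \<open>d = \<kappa> q\<close>, \<open>c = \<kappa>\<close>, \<open>h = \<kappa> (q - q\<^sup>-\<^sup>1)\<close> it satisfies a Hecke relation.\<close>

definition hecke :: "complex \<Rightarrow> complex \<Rightarrow> complex \<Rightarrow> ('n \<Rightarrow> 'n \<Rightarrow> bool) \<Rightarrow> complex ^ ('n::finite \<times> 'n) ^ ('n \<times> 'n)" where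
  "hecke d c h lt = (\<chi> i u.
     (if fst i = snd u \<and> snd i = fst u then if fst u = snd u then d else c else 0) +
     (if i = u \<and> lt (snd u) (fst u) then h else 0))"

lemma hecke_entry:
  "hecke d c h lt $ (i, j) $ (u, v) =
     (if i = v \<and> j = u then if u = v then d else c else 0) +
     (if i = u \<and> j = v \<and> lt v u then h else 0)"
  by (simp add: hecke_def)

lemma sum_pair_UNIV: "(\<Sum>x\<in>UNIV. f x) = (\<Sum>a\<in>UNIV. \<Sum>b\<in>UNIV. f (a, b))"
  for f :: "'a::finite \<times> 'b::finite \<Rightarrow> 'c::comm_monoid_add"
  unfolding UNIV_Times_UNIV[symmetric] sum.cartesian_product by simp

lemma sum_delta2:
  fixes f :: "'a::finite \<Rightarrow> 'b::finite \<Rightarrow> 'c::comm_monoid_add"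
  shows "(\<Sum>u\<in>UNIV. \<Sum>v\<in>UNIV. if u = a \<and> v = b then f u v else 0) = f a b"
proof -
  have "(\<Sum>u\<in>UNIV. \<Sum>v\<in>UNIV. if u = a \<and> v = b then f u v else 0)
      = (\<Sum>u\<in>UNIV. if u = a then f u b else 0)"
    by (intro sum.cong) auto
  then show ?thesis by simp
qed

lemma hecke_mult_left:
  "(hecke d c h lt ** M) $ (i, j) $ x = (if i = j then d else c) * M $ (j, i) $ x +
     (if lt j i then h * M $ (i, j) $ x else 0)" (is "_ = ?r")
proof -
  have "(hecke d c h lt ** M) $ (i, j) $ x =
    (\<Sum>u\<in>UNIV. \<Sum>v\<in>UNIV. (if u = j \<and> v = i then (if u = v then d else c) * M $ (u, v) $ x else 0) +
      (if u = i \<and> v = j then (if lt v u then h * M $ (u, v) $ x else 0) else 0))"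
    unfolding matrix_matrix_mult_def vec_lambda_beta sum_pair_UNIV
    by (intro sum.cong refl) (simp only: hecke_entry distrib_right distrib_left, rule arg_cong2[of _ _ _ _ "(+)"], auto)
  also have "\<dots> = ?r" unfolding sum.distrib sum_delta2 by (simp cong: if_cong)
  finally show ?thesis .
qed

lemma hecke_mult_right:
  "(M ** hecke d c h lt) $ x $ (u, v) = M $ x $ (v, u) * (if u = v then d else c) +
     (if lt v u then M $ x $ (u, v) * h else 0)" (is "_ = ?r")
proof -
  have "(M ** hecke d c h lt) $ x $ (u, v) =
    (\<Sum>i\<in>UNIV. \<Sum>j\<in>UNIV. (if i = v \<and> j = u then M $ x $ (i, j) * (if u = v then d else c) else 0) +
      (if i = u \<and> j = v then (if lt v u then M $ x $ (i, j) * h else 0) else 0))"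
    unfolding matrix_matrix_mult_def vec_lambda_beta sum_pair_UNIV
    by (intro sum.cong refl) (simp only: hecke_entry distrib_right distrib_left, rule arg_cong2[of _ _ _ _ "(+)"], auto)
  also have "\<dots> = ?r" unfolding sum.distrib sum_delta2 by (simp cong: if_cong)
  finally show ?thesis .
qed

text \<open>The inverse is of the same type, for the opposite order of the basis.\<close>

lemma hecke_inverse:
  assumes "d * d' = 1" "c * c' = 1" "c * h' + h * c' = 0"
    and lt: "\<And>x y. lt x y \<Longrightarrow> \<not> lt y x" "\<And>x y. x \<noteq> y \<Longrightarrow> lt x y \<or> lt y x"
  shows "hecke d c h lt ** hecke d' c' h' (\<lambda>x y. lt y x) = mat 1"
proof -
  have irr: "\<not> lt x x" for x using lt(1) by blast
  let ?H = "hecke d' c' h' (\<lambda>x y. lt y x)"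
  have "(hecke d c h lt ** ?H) $ (i, j) $ (u, v) = mat 1 $ (i, j) $ (u, v)" for i j u v
  proof -
    consider "u = i" "v = j" | "u = j" "v = i" "i \<noteq> j" | "\<not> (u = i \<and> v = j)" "\<not> (u = j \<and> v = i)"
      by blast
    then show ?thesis
    proof cases
      case 1
      then show ?thesis using assms(1,2) irr lt(1)[of i j] unfolding hecke_mult_left hecke_entry mat_def
        by (cases "i = j") simp_all
    next
      case 2
      have "?H $ (j, i) $ (j, i) = (if lt j i then h' else 0)" "?H $ (i, j) $ (j, i) = c'"
        using 2(3) by (simp_all add: hecke_entry)
      then have "(hecke d c h lt ** ?H) $ (i, j) $ (u, v) = c * (if lt j i then h' else 0) + (if lt j i then h * c' else 0)"
        unfolding hecke_mult_left 2(1,2) using 2(3) by (simp only: if_False)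
      moreover have "mat 1 $ (i, j) $ (u, v) = (0 :: complex)" using 2 by (simp add: mat_def)
      ultimately show ?thesis using assms(3) by simp
    next
      case 3
      have "?H $ (j, i) $ (u, v) = 0" "?H $ (i, j) $ (u, v) = 0"
        unfolding hecke_entry
        by (subst if_not_P, use 3 in blast, subst if_not_P, use 3 in blast, rule add_0)+
      moreover have "mat 1 $ (i, j) $ (u, v) = (0 :: complex)" using 3 by (auto simp: mat_def)
      ultimately show ?thesis unfolding hecke_mult_left by simp
    qed
  qed
  then show ?thesis by (simp add: vec_eq_iff split_paired_All)
qed

lemma kron_entry: "kron A B $ (i, j) $ (x, y) = A $ i $ x * B $ j $ y"
  by (simp add: kron_def)

lemma less_Suc_upper: "a \<noteq> Suc k \<Longrightarrow> Suc k < a \<longleftrightarrow> k < a" for a k :: nat by auto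
lemma less_Suc_lower: "a \<noteq> k \<Longrightarrow> a < Suc k \<longleftrightarrow> a < k" for a k :: nat by auto

text \<open>Matrix entries of the intertwining relations for \<open>E\<^sub>k\<close> and \<open>F\<^sub>k\<close>, with basis vectors replaced by
  their positions. Positions other than \<open>k\<close> and \<open>k + 1\<close> compare equally with these two, so only
  finitely many configurations have to be checked.\<close>

lemma hecke_E_identity:
  fixes Q \<phi> \<kappa> :: complex and a b c d k :: nat
  assumes Q: "Q \<noteq> 0"
  defines "K \<equiv> \<lambda>p. if p = k then Q else if p = Suc k then 1 / Q else 1"
    and "E \<equiv> \<lambda>x y. if x = k \<and> y = Suc k then \<phi> else 0"
    and "h \<equiv> \<kappa> * (Q - 1 / Q)"
  shows "(if a = b then \<kappa> * Q else \<kappa>) * (E b c * (if a = d then K a else 0) + (if b = c then 1 else 0) * E a d)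
      + (if b < a then h * (E a c * (if b = d then K b else 0) + (if a = c then 1 else 0) * E b d) else 0)
    = (E a d * (if b = c then K b else 0) + (if a = d then 1 else 0) * E b c) * (if c = d then \<kappa> * Q else \<kappa>)
      + (if d < c then (E a c * (if b = d then K b else 0) + (if a = c then 1 else 0) * E b d) * h else 0)"
  using Q [[linarith_neq_limit = 0]] [[linarith_split_limit = 0]] unfolding K_def E_def h_def
  by (cases "a = k"; cases "a = Suc k"; cases "b = k"; cases "b = Suc k"; cases "c = k"; cases "c = Suc k";
      cases "d = k"; cases "d = Suc k"; simp add: less_Suc_upper less_Suc_lower right_diff_distrib left_diff_distrib distrib_left distrib_right)

lemma hecke_F_identity:
  fixes Q \<phi> \<kappa> :: complex and a b c d k :: nat
  assumes Q: "Q \<noteq> 0"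
  defines "K \<equiv> \<lambda>p. 1 / (if p = k then Q else if p = Suc k then 1 / Q else 1)"
    and "E \<equiv> \<lambda>x y. if x = Suc k \<and> y = k then \<phi> else 0"
    and "h \<equiv> \<kappa> * (Q - 1 / Q)"
  shows "(if a = b then \<kappa> * Q else \<kappa>) * (E b c * (if a = d then 1 else 0) + (if b = c then K b else 0) * E a d)
      + (if b < a then h * (E a c * (if b = d then 1 else 0) + (if a = c then K a else 0) * E b d) else 0)
    = (E a d * (if b = c then 1 else 0) + (if a = d then K a else 0) * E b c) * (if c = d then \<kappa> * Q else \<kappa>)
      + (if d < c then (E a c * (if b = d then 1 else 0) + (if a = c then K a else 0) * E b d) * h else 0)"
  using Q [[linarith_neq_limit = 0]] [[linarith_split_limit = 0]] unfolding K_def E_def h_def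
  by (cases "a = k"; cases "a = Suc k"; cases "b = k"; cases "b = Suc k"; cases "c = k"; cases "c = Suc k";
      cases "d = k"; cases "d = Suc k"; simp add: less_Suc_upper less_Suc_lower right_diff_distrib left_diff_distrib distrib_left distrib_right)

lemma uq_gens_chain_cases:
  assumes "\<tau> ` {1..r} = {1..r}" "g \<in> uq_gens r"
  obtains k where "k \<in> {1..r}" "g = UK (\<tau> k)" | k where "k \<in> {1..r}" "g = UKinv (\<tau> k)"
    | k where "k \<in> {1..r}" "g = UE (\<tau> k)" | k where "k \<in> {1..r}" "g = UF (\<tau> k)"
proof -
  have "\<exists>k\<in>{1..r}. i = \<tau> k" if "i \<in> {1..r}" for i using assms(1) that by (metis imageE)
  then show ?thesis using assms(2) that unfolding uq_gens_def by blast
qed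

lemma chain_rep_entries:
  assumes "chain_rep r q \<rho> \<tau> pos \<phi>" "k \<in> {1..r}"
  shows "\<phi> k \<noteq> 0"
      "\<And>x y. \<rho> (UK (\<tau> k)) $ x $ y = (if x = y then chain_char q k (pos x) else 0)"
      "\<And>x y. \<rho> (UKinv (\<tau> k)) $ x $ y = (if x = y then 1 / chain_char q k (pos x) else 0)"
      "\<And>x y. \<rho> (UE (\<tau> k)) $ x $ y = (if pos x = k \<and> pos y = Suc k then \<phi> k else 0)"
      "\<And>x y. \<rho> (UF (\<tau> k)) $ x $ y = (if pos x = Suc k \<and> pos y = k then 1 / \<phi> k else 0)"
  using assms by (auto simp: chain_rep_def)

lemma chain_rep_pos:
  assumes "chain_rep r q \<rho> \<tau> pos \<phi>"
  shows "pos x \<in> {1..r+1}" "pos x = pos y \<longleftrightarrow> x = y"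
  using assms by (auto simp: chain_rep_def bij_betw_def inj_on_def)

text \<open>Each row and column of a Hecke-type matrix has at most two entries, so the products have no sums left
  and the relations for \<open>E\<^sub>k\<close> and \<open>F\<^sub>k\<close> become the two identities above.\<close>

lemma hecke_intertwiner:
  fixes \<rho> :: "'n::finite uq_rep" and \<kappa> :: complex
  assumes \<rho>: "chain_rep r q \<rho> \<tau> pos \<phi>" and q: "0 < q" and g: "g \<in> uq_gens r"
  defines "R \<equiv> hecke (\<kappa> * of_real q) \<kappa> (\<kappa> * (of_real q - 1 / of_real q)) (\<lambda>x y. pos x < pos y)"
  shows "R ** tensor_rep \<rho> \<rho> g = tensor_rep \<rho> \<rho> g ** R"
proof -
  have \<tau>: "\<tau> ` {1..r} = {1..r}" using \<rho> by (simp add: chain_rep_def)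
  have inj: "x = y \<longleftrightarrow> pos x = pos y" for x y using chain_rep_pos[OF \<rho>] by simp
  have ne: "complex_of_real q \<noteq> 0" using q by simp
  have "(R ** tensor_rep \<rho> \<rho> g) $ (i, j) $ (x, y) = (tensor_rep \<rho> \<rho> g ** R) $ (i, j) $ (x, y)" for i j x y
    using \<tau> g
  proof (cases rule: uq_gens_chain_cases)
    case (1 k)
    note e = chain_rep_entries[OF \<rho> 1(1)]
    show ?thesis unfolding R_def hecke_mult_left hecke_mult_right 1(2) tensor_rep.simps kron_entry e
      by (cases "x = i"; cases "y = j"; cases "x = j"; cases "y = i"; simp)
  next
    case (2 k)
    note e = chain_rep_entries[OF \<rho> 2(1)]
    show ?thesis unfolding R_def hecke_mult_left hecke_mult_right 2(2) tensor_rep.simps kron_entry e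
      by (cases "x = i"; cases "y = j"; cases "x = j"; cases "y = i"; simp)
  next
    case (3 k)
    note e = chain_rep_entries[OF \<rho> 3(1)]
    show ?thesis unfolding R_def hecke_mult_left hecke_mult_right 3(2) tensor_rep.simps vector_add_component
        kron_entry e mat_def vec_lambda_beta chain_char_def inj
      by (rule hecke_E_identity[OF ne])
  next
    case (4 k)
    note e = chain_rep_entries[OF \<rho> 4(1)]
    show ?thesis unfolding R_def hecke_mult_left hecke_mult_right 4(2) tensor_rep.simps vector_add_component
        kron_entry e mat_def vec_lambda_beta chain_char_def inj
      by (rule hecke_F_identity[OF ne])
  qed
  then show ?thesis by (simp add: vec_eq_iff split_paired_All)
qed

section \<open>Uniqueness of braidings\<close>

lemma kron_vtensor: "kron A B *v vtensor u v = vtensor (A *v u) (B *v v)"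
  by (simp add: vec_eq_iff kron_def vtensor_def matrix_vector_mult_def sum_pair_UNIV sum_product mult_ac)

lemma vtensor_axis: "vtensor (axis x 1) (axis y 1) = axis (x, y) 1"
  by (auto simp: vec_eq_iff vtensor_def axis_def)

lemma matrix_vtensor_axis_zero:
  fixes D :: "complex ^ ('n::finite \<times> 'm::finite) ^ 'k"
  assumes "\<And>x. D *v axis (x, y) 1 = 0"
  shows "D *v vtensor w (c *s axis y 1) = 0"
proof -
  have "D $ i $ (x, y) = 0" for i x
    using assms[of x] matrix_axis_component[of D "(x, y)" i] by simp
  then have "D $ i $ (x, z) * (w $ x * (c * axis y 1 $ z)) = 0" for i x z
    by (cases "z = y") (auto simp: axis_def)
  note zero = this
  show ?thesis
    by (simp add: vec_eq_iff matrix_vector_mult_def vtensor_def sum_pair_UNIV zero)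
qed

text \<open>A module map that kills the product of the first vector of \<open>\<rho>\<close> and the last vector of \<open>\<sigma>\<close> is
  zero. On \<open>x \<otimes> y\<^sub>0\<close>, with \<open>y\<^sub>0\<close> killed by all \<open>F\<^sub>k\<close>, these generators act through the first factor only and
  reach every \<open>x\<close>. The \<open>E\<^sub>k\<close> then move the second factor up the chain, modulo vectors already known to be
  killed.\<close>

lemma chain_rep_unique_intertwiner:
  fixes \<rho> :: "'n::finite uq_rep" and \<sigma> :: "'m::finite uq_rep"
  assumes \<rho>: "chain_rep r q \<rho> \<tau> pos \<phi>" and \<sigma>: "chain_rep r q \<sigma> \<tau>' pos' \<phi>'" and q: "0 < q"
    and D: "\<And>g. g \<in> uq_gens r \<Longrightarrow> D ** tensor_rep \<rho> \<sigma> g = X g ** D"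
    and x0: "pos x0 = 1" and y0: "pos' y0 = r + 1" and z: "D *v axis (x0, y0) 1 = 0"
  shows "D = 0"
proof -
  have step: "D *v (tensor_rep \<rho> \<sigma> g *v w) = 0" if "g \<in> uq_gens r" "D *v w = 0" for g w
    using D[OF that(1)] that(2) by (metis matrix_vector_mul_assoc matrix_vector_mult_0_right)
  have \<tau>: "\<tau> ` {1..r} = {1..r}" and \<tau>': "\<tau>' ` {1..r} = {1..r}"
    and bij: "bij_betw pos UNIV {1..r+1}" and bij': "bij_betw pos' UNIV {1..r+1}"
    using \<rho> \<sigma> by (auto simp: chain_rep_def)
  have ex: "\<exists>x. pos x = k" "\<exists>y. pos' y = k" if "k \<in> {1..r+1}" for k
  proof -
    have "k \<in> range pos" "k \<in> range pos'" using bij bij' that by (auto simp: bij_betw_def)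
    then show "\<exists>x. pos x = k" "\<exists>y. pos' y = k" by (metis rangeE)+
  qed
  have left: "D *v axis (x, y0) 1 = 0" if "pos x = k" "1 \<le> k" "k \<le> r + 1" for k x
    using that(2,3,1)
  proof (induction k arbitrary: x rule: dec_induct)
    case base
    then show ?case using z x0 chain_rep_pos(2)[OF \<rho>, of x x0] by simp
  next
    case (step k)
    then have k: "k \<in> {1..r}" by simp
    obtain x' where x': "pos x' = k" using ex[of k] k by auto
    note e = chain_rep_entries[OF \<rho> k]
    have Fx: "\<rho> (UF (\<tau> k)) *v axis x' 1 = (1 / \<phi> k) *s axis x 1"
      using step.prems(2) x' unfolding vec_eq_iff matrix_axis_component e(5)
      by (auto simp: axis_def chain_rep_pos(2)[OF \<rho>, of _ x, symmetric])
    obtain j where j: "j \<in> {1..r}" "\<tau> k = \<tau>' j" using \<tau> \<tau>' k by (metis imageE imageI)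
    have Fy: "\<sigma> (UF (\<tau> k)) *v axis y0 1 = 0"
      using j(1) y0 unfolding j(2)
      by (auto simp: vec_eq_iff matrix_axis_component chain_rep_entries(5)[OF \<sigma> j(1)])
    have "UF (\<tau> k) \<in> uq_gens r" using \<tau> k by (auto simp: uq_gens_def)
    moreover have "D *v axis (x', y0) 1 = 0" using step.IH[OF _ x'] step.prems step.hyps by simp
    ultimately have "D *v (tensor_rep \<rho> \<sigma> (UF (\<tau> k)) *v axis (x', y0) 1) = 0"
      by (rule \<open>\<And>w g. g \<in> uq_gens r \<Longrightarrow> D *v w = 0 \<Longrightarrow> D *v (tensor_rep \<rho> \<sigma> g *v w) = 0\<close>)
    moreover have "tensor_rep \<rho> \<sigma> (UF (\<tau> k)) *v axis (x', y0) 1 = (1 / \<phi> k) *s axis (x, y0) 1"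
      unfolding vtensor_axis[symmetric] tensor_rep.simps matrix_vector_mult_add_rdistrib kron_vtensor Fx Fy
      by (simp add: vec_eq_iff vtensor_def)
    ultimately show ?case using e(1) by (simp add: vec.scale)
  qed
  have all: "\<forall>x. D *v axis (x, y) 1 = 0" if "k \<le> r" "pos' y = r + 1 - k" for k y
    using that
  proof (induction k arbitrary: y)
    case 0
    then have "y = y0" using y0 chain_rep_pos(2)[OF \<sigma>, of y y0] by simp
    then show ?case using left chain_rep_pos(1)[OF \<rho>] by auto
  next
    case (Suc k)
    define j where "j = r - k"
    have j: "j \<in> {1..r}" using Suc.prems by (simp add: j_def)
    have yj: "pos' y = j" using Suc.prems by (simp add: j_def)
    obtain y' where y': "pos' y' = Suc j" using ex(2)[of "Suc j"] j by auto
    have IH: "D *v axis (x, y') 1 = 0" for x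
      using Suc.IH[of y'] y' Suc.prems by (auto simp: j_def)
    note e = chain_rep_entries[OF \<sigma> j]
    have Ey: "\<sigma> (UE (\<tau>' j)) *v axis y' 1 = \<phi>' j *s axis y 1"
      using yj y' unfolding vec_eq_iff matrix_axis_component e(4)
      by (auto simp: axis_def chain_rep_pos(2)[OF \<sigma>, of _ y, symmetric])
    have Ky: "\<sigma> (UK (\<tau>' j)) *v axis y' 1 = chain_char q j (Suc j) *s axis y' 1"
      using y' unfolding vec_eq_iff matrix_axis_component e(2) by (auto simp: axis_def)
    show ?case
    proof
      fix x
      have "UE (\<tau>' j) \<in> uq_gens r" using \<tau>' j by (auto simp: uq_gens_def)
      then have "D *v (tensor_rep \<rho> \<sigma> (UE (\<tau>' j)) *v axis (x, y') 1) = 0"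
        using IH by (rule step)
      moreover have "tensor_rep \<rho> \<sigma> (UE (\<tau>' j)) *v axis (x, y') 1 =
          vtensor (\<rho> (UE (\<tau>' j)) *v axis x 1) (chain_char q j (Suc j) *s axis y' 1) + \<phi>' j *s axis (x, y) 1"
        unfolding vtensor_axis[symmetric] tensor_rep.simps matrix_vector_mult_add_rdistrib kron_vtensor Ey Ky
        by (simp add: vec_eq_iff vtensor_def)
      ultimately have "D *v (\<phi>' j *s axis (x, y) 1) = 0"
        by (simp add: matrix_vector_right_distrib matrix_vtensor_axis_zero[OF IH])
      then show "D *v axis (x, y) 1 = 0" using e(1) by (simp add: vec.scale)
    qed
  qed
  have "D *v axis (x, y) 1 = 0" for x y
    using all[of "r + 1 - pos' y" y] chain_rep_pos(1)[OF \<sigma>, of y] by auto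
  then have "D $ i $ (x, y) = 0" for i x y using matrix_axis_component[of D "(x, y)" i] by simp
  then show "D = 0" by (simp add: vec_eq_iff split_paired_All)
qed

lemma chain_rep_weight_support:
  assumes \<rho>: "chain_rep r q \<rho> \<tau> pos \<phi>" and q: "0 < q" "q < 1"
    and v: "weight_vector r q \<rho> \<nu> v" "v $ x \<noteq> 0" and k: "k \<in> {1..r}"
  shows "chain_exp k (pos x) = wt_form r (simple_root (\<tau> k)) \<nu>"
proof -
  have "\<tau> k \<in> {1..r}" using \<rho> k by (auto simp: chain_rep_def)
  then have "\<rho> (UK (\<tau> k)) *v v = q powr wt_form r (simple_root (\<tau> k)) \<nu> *\<^sub>R v"
    using v(1) by (auto simp: weight_vector_def)
  then have "(\<rho> (UK (\<tau> k)) *v v) $ x = q powr wt_form r (simple_root (\<tau> k)) \<nu> *\<^sub>R (v $ x)"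
    by simp
  moreover have "(\<rho> (UK (\<tau> k)) *v v) $ x = of_real (q powr chain_exp k (pos x)) * v $ x"
    by (simp add: matrix_vector_mult_def chain_rep_entries(2)[OF \<rho> k] chain_char_powr[OF q(1)]
        if_distrib[of "\<lambda>z. z * _"] cong: if_cong)
  ultimately have "complex_of_real (q powr chain_exp k (pos x))
      = of_real (q powr wt_form r (simple_root (\<tau> k)) \<nu>)"
    using v(2) by (simp add: scaleR_conv_of_real)
  then have "q powr chain_exp k (pos x) = q powr wt_form r (simple_root (\<tau> k)) \<nu>"
    by (simp only: of_real_eq_iff)
  then show ?thesis using q by (simp add: powr_inj)
qed

lemma chain_rep_axis_weight_vector:
  assumes \<rho>: "chain_rep r q \<rho> \<tau> pos \<phi>" and q: "0 < q"
    and w: "\<And>k. k \<in> {1..r} \<Longrightarrow> wt_form r (simple_root (\<tau> k)) \<nu> = chain_exp k (pos x)"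
  shows "weight_vector r q \<rho> \<nu> (axis x 1)"
  unfolding weight_vector_def
proof (intro conjI ballI)
  show "axis x 1 \<noteq> (0 :: complex ^ 'a)" by (simp add: axis_eq_0_iff)
  fix i assume "i \<in> {1..r}"
  then obtain k where k: "k \<in> {1..r}" "i = \<tau> k" using \<rho> unfolding chain_rep_def by (metis imageE)
  show "\<rho> (UK i) *v axis x 1 = q powr wt_form r (simple_root i) \<nu> *\<^sub>R axis x 1"
    unfolding vec_eq_iff vector_scaleR_component k(2) matrix_axis_component
      chain_rep_entries(2)[OF \<rho> k(1)] w[OF k(1)] chain_char_powr[OF q, symmetric]
    by (auto simp: axis_def scaleR_conv_of_real)
qed

text \<open>The characters of the chain are distinct, so highest and lowest weight vectors are unique up to
  scalars and the normalization has to be checked on one pair of basis vectors only.\<close>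

lemma braiding_eqI:
  fixes \<rho> :: "'n::finite uq_rep" and \<sigma> :: "'m::finite uq_rep"
  assumes \<rho>: "chain_rep r q \<rho> \<tau> pos \<phi>" and \<sigma>: "chain_rep r q \<sigma> \<tau>' pos' \<phi>'" and q: "0 < q" "q < 1"
    and hw: "\<And>k. k \<in> {1..r} \<Longrightarrow> wt_form r (simple_root (\<tau> k)) \<nu> = of_bool (k = 1)"
    and lw: "\<And>k. k \<in> {1..r} \<Longrightarrow> wt_form r (simple_root (\<tau>' k)) (w0 r \<mu>) = - of_bool (k = r)"
    and R: "\<And>g. g \<in> uq_gens r \<Longrightarrow> R ** tensor_rep \<rho> \<sigma> g = tensor_rep \<sigma> \<rho> g ** R"
    and norm: "\<And>x y. pos x = 1 \<Longrightarrow> pos' y = r + 1 \<Longrightarrow>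
       R *v axis (x, y) 1 = of_real (q powr wt_form r \<nu> (w0 r \<mu>)) *s axis (y, x) 1"
  shows "braiding r q \<rho> \<nu> \<sigma> \<mu> = R"
proof -
  have \<tau>: "\<tau> ` {1..r} = {1..r}" and \<tau>': "\<tau>' ` {1..r} = {1..r}"
    and bij: "bij_betw pos UNIV {1..r+1}" and bij': "bij_betw pos' UNIV {1..r+1}"
    using \<rho> \<sigma> by (auto simp: chain_rep_def)
  have "1 \<in> pos ` UNIV" "r + 1 \<in> pos' ` UNIV" using bij bij' by (auto simp: bij_betw_def)
  then obtain x0 y0 where x0: "pos x0 = 1" and y0: "pos' y0 = r + 1" by (metis imageE)
  let ?c = "q powr wt_form r \<nu> (w0 r \<mu>)"
  have hwe: "wt_form r (simple_root (\<tau> k)) \<nu> = chain_exp k 1" if "k \<in> {1..r}" for k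
    using hw[OF that] that by (auto simp: chain_exp_def)
  have lwe: "wt_form r (simple_root (\<tau>' k)) (w0 r \<mu>) = chain_exp k (r + 1)" if "k \<in> {1..r}" for k
    using lw[OF that] that by (auto simp: chain_exp_def)
  \<comment> \<open>The first and the last vector of a chain are determined by their characters.\<close>
  have high: "v = v $ x0 *s axis x0 1" if "weight_vector r q \<rho> \<nu> v" for v
  proof -
    have "v $ x = 0" if "x \<noteq> x0" for x
    proof (rule ccontr)
      assume nz: "v $ x \<noteq> 0"
      have "pos x = 1"
      proof (rule chain_exp_inj[OF chain_rep_pos(1)[OF \<rho>]])
        fix k assume k: "k \<in> {1..r}"
        show "chain_exp k (pos x) = chain_exp k 1"
          using chain_rep_weight_support[OF \<rho> q \<open>weight_vector r q \<rho> \<nu> v\<close> nz k] hwe[OF k] by simp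
      qed simp
      then show False using x0 that chain_rep_pos(2)[OF \<rho>, of x x0] by simp
    qed
    then show ?thesis by (auto simp: vec_eq_iff axis_def)
  qed
  have low: "u = u $ y0 *s axis y0 1" if "weight_vector r q \<sigma> (w0 r \<mu>) u" for u
  proof -
    have "u $ y = 0" if "y \<noteq> y0" for y
    proof (rule ccontr)
      assume nz: "u $ y \<noteq> 0"
      have "pos' y = r + 1"
      proof (rule chain_exp_inj[OF chain_rep_pos(1)[OF \<sigma>]])
        fix k assume k: "k \<in> {1..r}"
        show "chain_exp k (pos' y) = chain_exp k (r + 1)"
          using chain_rep_weight_support[OF \<sigma> q \<open>weight_vector r q \<sigma> (w0 r \<mu>) u\<close> nz k] lwe[OF k] by simp
      qed simp
      then show False using y0 that chain_rep_pos(2)[OF \<sigma>, of y y0] by simp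
    qed
    then show ?thesis by (auto simp: vec_eq_iff axis_def)
  qed
  have hv: "highest_vector r q \<rho> \<nu> (axis x0 1)"
    unfolding highest_vector_def
  proof (intro conjI ballI)
    show "weight_vector r q \<rho> \<nu> (axis x0 1)"
      by (rule chain_rep_axis_weight_vector[OF \<rho> q(1)]) (simp add: hwe x0)
    fix i assume "i \<in> {1..r}"
    then obtain k where k: "k \<in> {1..r}" "i = \<tau> k" using \<tau> by (metis imageE)
    show "\<rho> (UE i) *v axis x0 1 = 0"
      using k(1) x0 by (auto simp: vec_eq_iff matrix_axis_component k(2) chain_rep_entries(4)[OF \<rho> k(1)])
  qed
  have lv: "lowest_vector r q \<sigma> (w0 r \<mu>) (axis y0 1)"
    unfolding lowest_vector_def
  proof (intro conjI ballI)
    show "weight_vector r q \<sigma> (w0 r \<mu>) (axis y0 1)"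
      by (rule chain_rep_axis_weight_vector[OF \<sigma> q(1)]) (simp add: lwe y0)
    fix i assume "i \<in> {1..r}"
    then obtain k where k: "k \<in> {1..r}" "i = \<tau>' k" using \<tau>' by (metis imageE)
    show "\<sigma> (UF i) *v axis y0 1 = 0"
      using k(1) y0 by (auto simp: vec_eq_iff matrix_axis_component k(2) chain_rep_entries(5)[OF \<sigma> k(1)])
  qed
  have R0: "R *v vtensor (axis x0 1) (axis y0 1) = ?c *\<^sub>R vtensor (axis y0 1) (axis x0 1)"
    unfolding vtensor_axis norm[OF x0 y0] by (simp add: vec_eq_iff) (simp add: scaleR_conv_of_real)
  show ?thesis
    unfolding braiding_def
  proof (rule the_equality)
    show "(\<forall>g\<in>uq_gens r. R ** tensor_rep \<rho> \<sigma> g = tensor_rep \<sigma> \<rho> g ** R) \<and>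
     (\<forall>v u. highest_vector r q \<rho> \<nu> v \<and> lowest_vector r q \<sigma> (w0 r \<mu>) u \<longrightarrow>
        R *v vtensor v u = ?c *\<^sub>R vtensor u v)"
    proof (intro conjI ballI allI impI R)
      fix v u assume "highest_vector r q \<rho> \<nu> v \<and> lowest_vector r q \<sigma> (w0 r \<mu>) u"
      then obtain a b where v: "v = a *s axis x0 1" and u: "u = b *s axis y0 1"
        using high low unfolding highest_vector_def lowest_vector_def by blast
      have "vtensor v u = (a * b) *s vtensor (axis x0 1) (axis y0 1)"
        "vtensor u v = (a * b) *s vtensor (axis y0 1) (axis x0 1)"
        unfolding v u by (simp_all add: vec_eq_iff vtensor_def)
      moreover have "(a * b) *s (?c *\<^sub>R w) = ?c *\<^sub>R ((a * b) *s w)" for w :: "complex ^ ('m \<times> 'n)"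
        by (simp add: vec_eq_iff)
      ultimately show "R *v vtensor v u = ?c *\<^sub>R vtensor u v"
        using R0 by (simp add: vec.scale)
    qed
    fix R' assume R': "(\<forall>g\<in>uq_gens r. R' ** tensor_rep \<rho> \<sigma> g = tensor_rep \<sigma> \<rho> g ** R') \<and>
     (\<forall>v u. highest_vector r q \<rho> \<nu> v \<and> lowest_vector r q \<sigma> (w0 r \<mu>) u \<longrightarrow>
        R' *v vtensor v u = ?c *\<^sub>R vtensor u v)"
    have "R' - R = 0"
    proof (rule chain_rep_unique_intertwiner[OF \<rho> \<sigma> q(1) _ x0 y0])
      show "(R' - R) ** tensor_rep \<rho> \<sigma> g = tensor_rep \<sigma> \<rho> g ** (R' - R)" if "g \<in> uq_gens r" for g
        using R' R[OF that] that by (simp add: vec_eq_iff matrix_matrix_mult_def left_diff_distrib right_diff_distrib sum_subtractf)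
      have "R' *v vtensor (axis x0 1) (axis y0 1) = ?c *\<^sub>R vtensor (axis y0 1) (axis x0 1)"
        using R' hv lv by blast
      then have "R' *v axis (x0, y0) 1 = R *v axis (x0, y0) 1"
        using R0 by (simp only: vtensor_axis)
      then show "(R' - R) *v axis (x0, y0) 1 = 0" by (simp add: matrix_vector_mult_diff_rdistrib)
    qed
    then show "R' = R" by simp
  qed
qed

section \<open>The mixed braiding\<close>

text \<open>If \<open>M\<close> is the braiding of \<open>V \<otimes> V\<close>, this is the inverse of the braiding of \<open>V \<otimes> V\<^sup>*\<close>, obtained by bending
  one strand with the evaluation \<open>E\<close> and its coevaluation.\<close>

definition partial_transpose :: "complex ^ ('n::finite \<times> 'n) ^ ('n \<times> 'n) \<Rightarrow> complex ^ ('n \<times> 'n) ^ ('n \<times> 'n)" where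
  "partial_transpose M = (\<chi> i u. M $ (fst u, fst i) $ (snd u, snd i))"

text \<open>Applied to the inverse of the braiding of \<open>V \<otimes> V\<close>, with \<open>D\<close> the weights of \<open>E'\<close>, this is the braiding
  of \<open>V \<otimes> V\<^sup>*\<close>: the strand is now bent with \<open>E'\<close>.\<close>

definition weighted_transpose ::
    "('n \<Rightarrow> complex) \<Rightarrow> complex ^ ('n::finite \<times> 'n) ^ ('n \<times> 'n) \<Rightarrow> complex ^ ('n \<times> 'n) ^ ('n \<times> 'n)" where
  "weighted_transpose D M = (\<chi> i u. D (snd u) / D (fst i) * M $ (snd i, snd u) $ (fst i, fst u))"

lemma partial_transpose_entry: "partial_transpose M $ (n, m) $ (k, l) = M $ (k, n) $ (l, m)"
  by (simp add: partial_transpose_def)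

lemma weighted_transpose_entry:
  "weighted_transpose D M $ (a, l) $ (i, j) = D j / D a * M $ (l, j) $ (a, i)"
  by (simp add: weighted_transpose_def)

lemma partial_transpose_hecke_mult_left:
  "(partial_transpose (hecke d c h lt) ** M) $ (n, m) $ x = (if m = n then d else c) * M $ (m, n) $ x +
     (if n = m then \<Sum>v\<in>UNIV. if lt m v then h * M $ (v, v) $ x else 0 else 0)" (is "_ = ?r")
proof -
  have "(partial_transpose (hecke d c h lt) ** M) $ (n, m) $ x =
    (\<Sum>u\<in>UNIV. \<Sum>v\<in>UNIV. (if u = m \<and> v = n then (if v = m then d else c) * M $ (u, v) $ x else 0) +
      (if u = v then (if n = m \<and> lt m v then h * M $ (u, v) $ x else 0) else 0))"
    unfolding matrix_matrix_mult_def vec_lambda_beta sum_pair_UNIV partial_transpose_entry hecke_entry distrib_right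
    by (intro sum.cong refl arg_cong2[of _ _ _ _ "(+)"]) auto
  also have "\<dots> = ?r" unfolding sum.distrib sum_delta2
    by (cases "n = m") (auto simp: sum.delta cong: if_cong intro!: sum.cong)
  finally show ?thesis .
qed

lemma partial_transpose_hecke_mult_right:
  "(M ** partial_transpose (hecke d c h lt)) $ x $ (k, l) = M $ x $ (l, k) * (if l = k then d else c) +
     (if k = l then \<Sum>v\<in>UNIV. if lt v l then M $ x $ (v, v) * h else 0 else 0)" (is "_ = ?r")
proof -
  have "(M ** partial_transpose (hecke d c h lt)) $ x $ (k, l) =
    (\<Sum>u\<in>UNIV. \<Sum>v\<in>UNIV. (if u = l \<and> v = k then M $ x $ (u, v) * (if l = v then d else c) else 0) +
      (if u = v then (if k = l \<and> lt v l then M $ x $ (u, v) * h else 0) else 0))"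
    unfolding matrix_matrix_mult_def vec_lambda_beta sum_pair_UNIV partial_transpose_entry hecke_entry distrib_left
    by (intro sum.cong refl arg_cong2[of _ _ _ _ "(+)"]) auto
  also have "\<dots> = ?r" unfolding sum.distrib sum_delta2
    by (cases "k = l") (auto simp: sum.delta cong: if_cong intro!: sum.cong)
  finally show ?thesis .
qed

text \<open>The two bendings are inverse to each other. Away from the weight zero vectors \<open>v\<^sub>x \<otimes> f\<^sup>x\<close> this is
  immediate; on those both matrices are triangular, and the off-diagonal entries cancel by the
  geometric sum in the assumption \<open>geo\<close>.\<close>

lemma weighted_transpose_inverse:
  fixes D :: "'n::finite \<Rightarrow> complex"
  assumes dd: "d' * d = 1" and cc: "c' * c = 1" and D: "\<And>x. D x \<noteq> 0"
    and irr: "\<And>x. \<not> lt x x"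
    and geo: "\<And>a k. lt a k \<Longrightarrow> h' * d * D k + d' * h * D a
        + h * h' * (\<Sum>v\<in>UNIV. if lt a v \<and> lt v k then D v else 0) = 0"
    and trans: "\<And>a v k. lt a v \<Longrightarrow> lt v k \<Longrightarrow> lt a k"
  shows "weighted_transpose D (hecke d' c' h' (\<lambda>x y. lt y x)) ** partial_transpose (hecke d c h lt) = mat 1"
proof -
  let ?R = "weighted_transpose D (hecke d' c' h' (\<lambda>x y. lt y x))"
  have e: "?R $ (a, l) $ (i, j) = (if l = i \<and> j = a then D j / D a * (if a = i then d' else c') else 0)
      + (if l = a \<and> j = i \<and> lt a i then D j / D a * h' else 0)" for a l i j
    unfolding weighted_transpose_entry hecke_entry distrib_left by (intro arg_cong2[of _ _ _ _ "(+)"]) auto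
  have "(?R ** partial_transpose (hecke d c h lt)) $ (a, l) $ (k, m) = mat 1 $ (a, l) $ (k, m)" for a l k m
  proof -
    consider "k \<noteq> m" | "k = m" "a \<noteq> l" | "k = m" "a = l" by blast
    then show ?thesis
    proof cases
      case 1
      then have "(?R ** partial_transpose (hecke d c h lt)) $ (a, l) $ (k, m) = ?R $ (a, l) $ (m, k) * c"
        by (simp add: partial_transpose_hecke_mult_right)
      also have "\<dots> = (if l = m \<and> k = a then 1 else 0)"
        using 1 cc D by (auto simp: e)
      finally show ?thesis by (auto simp: mat_def)
    next
      case 2
      have z: "?R $ (a, l) $ (i, i) = 0" for i using 2(2) unfolding e by (cases "l = i") simp_all
      show ?thesis unfolding partial_transpose_hecke_mult_right 2(1) z using 2
        by (auto simp: mat_def intro!: sum.neutral)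
    next
      case 3
      have f: "?R $ (a, a) $ (i, i) = (if a = i then d' else 0) + (if lt a i then D i / D a * h' else 0)" for i
        unfolding e using D by auto
      have "(?R ** partial_transpose (hecke d c h lt)) $ (a, l) $ (k, m) = ?R $ (a, a) $ (k, k) * d
          + (\<Sum>v\<in>UNIV. if lt v k then ?R $ (a, a) $ (v, v) * h else 0)"
        unfolding partial_transpose_hecke_mult_right 3 by simp
      also have "(\<Sum>v\<in>UNIV. if lt v k then ?R $ (a, a) $ (v, v) * h else 0)
          = (\<Sum>v\<in>UNIV. (if v = a then (if lt a k then d' * h else 0) else 0)
             + h * h' / D a * (if lt a v \<and> lt v k then D v else 0))"
        unfolding f by (intro sum.cong refl) (use irr in auto)
      also have "\<dots> = (if lt a k then d' * h else 0)
          + h * h' / D a * (\<Sum>v\<in>UNIV. if lt a v \<and> lt v k then D v else 0)"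
        by (simp add: sum.distrib sum_distrib_left)
      finally have eq: "(?R ** partial_transpose (hecke d c h lt)) $ (a, l) $ (k, m) = ?R $ (a, a) $ (k, k) * d
          + ((if lt a k then d' * h else 0)
          + h * h' / D a * (\<Sum>v\<in>UNIV. if lt a v \<and> lt v k then D v else 0))" .
      show ?thesis
      proof (cases "lt a k")
        case True
        then have "a \<noteq> k" using irr by blast
        have "(?R ** partial_transpose (hecke d c h lt)) $ (a, l) $ (k, m)
           = (h' * d * D k + d' * h * D a + h * h' * (\<Sum>v\<in>UNIV. if lt a v \<and> lt v k then D v else 0)) / D a"
          unfolding eq f using True \<open>a \<noteq> k\<close> D[of a] by (simp add: add_divide_distrib mult_ac)
        then show ?thesis using geo[OF True] \<open>a \<noteq> k\<close> by (simp add: mat_def)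
      next
        case False
        have "(\<Sum>v\<in>UNIV. if lt a v \<and> lt v k then D v else 0) = 0"
          using trans False by (intro sum.neutral) auto
        then show ?thesis unfolding eq f using False dd 3 by (auto simp: mat_def)
      qed
    qed
  qed
  then show ?thesis by (simp add: vec_eq_iff split_paired_All)
qed

text \<open>Matrix entries of the intertwining relations between \<open>V\<^sup>* \<otimes> V\<close> and \<open>V \<otimes> V\<^sup>*\<close>, where \<open>E'\<close> and \<open>F'\<close> are the
  entries of the generators in the dual.\<close>

lemma dual_E_identity:
  fixes Q \<phi> \<kappa> :: complex and n m k l j :: nat
  assumes Q: "Q \<noteq> 0"
  defines "K \<equiv> \<lambda>p. if p = j then Q else if p = Suc j then 1 / Q else 1"
    and "E \<equiv> \<lambda>x y. if x = j \<and> y = Suc j then \<phi> else 0"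
    and "E' \<equiv> \<lambda>x y. if y = j \<and> x = Suc j then - (Q * \<phi>) else 0"
    and "h \<equiv> \<kappa> * (Q - 1 / Q)"
  shows "(if m = n then \<kappa> * Q else \<kappa>) * (E' m k * (if n = l then K n else 0) + (if m = k then 1 else 0) * E n l)
      + (if n = m then (if m < l then h * (E' l k * K l) else 0) + (if m < k then h * (1 * E k l) else 0) else 0)
    = (E n l * (if m = k then 1 / K m else 0) + (if n = l then 1 else 0) * E' m k) * (if l = k then \<kappa> * Q else \<kappa>)
      + (if k = l then (if m < l then E n m * (1 / K m) * h else 0) + (if n < l then 1 * E' m n * h else 0) else 0)"
  using Q [[linarith_neq_limit = 0]] [[linarith_split_limit = 0]] unfolding K_def E_def E'_def h_def
  by (cases "m = j"; cases "m = Suc j"; cases "n = j"; cases "n = Suc j"; cases "k = j"; cases "k = Suc j";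
      cases "l = j"; cases "l = Suc j";
      simp add: less_Suc_upper less_Suc_lower right_diff_distrib left_diff_distrib distrib_left distrib_right)

lemma dual_F_identity:
  fixes Q \<phi> \<kappa> :: complex and n m k l j :: nat
  assumes Q: "Q \<noteq> 0"
  defines "K \<equiv> \<lambda>p. if p = j then Q else if p = Suc j then 1 / Q else 1"
    and "F \<equiv> \<lambda>x y. if x = Suc j \<and> y = j then \<phi> else 0"
    and "F' \<equiv> \<lambda>x y. if y = Suc j \<and> x = j then - (\<phi> / Q) else 0"
    and "h \<equiv> \<kappa> * (Q - 1 / Q)"
  shows "(if m = n then \<kappa> * Q else \<kappa>) * (F' m k * (if n = l then 1 else 0) + (if m = k then K m else 0) * F n l)
      + (if n = m then (if m < l then h * (F' l k * 1) else 0) + (if m < k then h * (K k * F k l) else 0) else 0)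
    = (F n l * (if m = k then 1 else 0) + (if n = l then 1 / K n else 0) * F' m k) * (if l = k then \<kappa> * Q else \<kappa>)
      + (if k = l then (if m < l then F n m * 1 * h else 0) + (if n < l then 1 / K n * F' m n * h else 0) else 0)"
  using Q [[linarith_neq_limit = 0]] [[linarith_split_limit = 0]] unfolding K_def F_def F'_def h_def
  by (cases "m = j"; cases "m = Suc j"; cases "n = j"; cases "n = Suc j"; cases "k = j"; cases "k = Suc j";
      cases "l = j"; cases "l = Suc j";
      simp add: less_Suc_upper less_Suc_lower right_diff_distrib left_diff_distrib distrib_left distrib_right)
    (simp add: field_simps)

lemma dual_chain_entries:
  assumes \<rho>: "chain_rep r q \<rho> \<tau> pos \<phi>" and q: "0 < q" and k: "k \<in> {1..r}"
  shows "dual_rep \<rho> (UK (\<tau> k)) $ x $ y = (if x = y then 1 / chain_char q k (pos x) else 0)"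
    and "dual_rep \<rho> (UKinv (\<tau> k)) $ x $ y = (if x = y then chain_char q k (pos x) else 0)"
    and "dual_rep \<rho> (UE (\<tau> k)) $ x $ y = (if pos y = k \<and> pos x = Suc k then - (of_real q * \<phi> k) else 0)"
    and "dual_rep \<rho> (UF (\<tau> k)) $ x $ y = (if pos y = Suc k \<and> pos x = k then - (1 / \<phi> k / of_real q) else 0)"
proof -
  note e = chain_rep_entries[OF \<rho> k]
  show "dual_rep \<rho> (UK (\<tau> k)) $ x $ y = (if x = y then 1 / chain_char q k (pos x) else 0)"
    "dual_rep \<rho> (UKinv (\<tau> k)) $ x $ y = (if x = y then chain_char q k (pos x) else 0)"
    by (simp_all add: transpose_def e(2,3))
  have "(\<rho> (UE (\<tau> k)) ** \<rho> (UKinv (\<tau> k))) $ y $ x = \<rho> (UE (\<tau> k)) $ y $ x / chain_char q k (pos x)"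
    by (simp add: matrix_matrix_mult_def e(3) if_distrib[of "\<lambda>z. _ * z"] cong: if_cong)
  then show "dual_rep \<rho> (UE (\<tau> k)) $ x $ y = (if pos y = k \<and> pos x = Suc k then - (of_real q * \<phi> k) else 0)"
    by (auto simp: transpose_def e(4) chain_char_def)
  have "(\<rho> (UK (\<tau> k)) ** \<rho> (UF (\<tau> k))) $ y $ x = chain_char q k (pos y) * \<rho> (UF (\<tau> k)) $ y $ x"
    by (simp add: matrix_matrix_mult_def e(2) if_distrib[of "\<lambda>z. z * _"] cong: if_cong)
  then show "dual_rep \<rho> (UF (\<tau> k)) $ x $ y = (if pos y = Suc k \<and> pos x = k then - (1 / \<phi> k / of_real q) else 0)"
    by (auto simp: transpose_def e(5) chain_char_def)
qed

text \<open>In each tensor product of generators one factor is diagonal, so the sums over the weight zero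
  vectors reduce to single terms.\<close>

lemma sum_if_diag_right:
  fixes f :: "'n::finite \<Rightarrow> complex"
  shows "(\<Sum>v\<in>UNIV. if P v then h * (f v * (if v = l then g v else 0)) else 0) = (if P l then h * (f l * g l) else 0)"
    "(\<Sum>v\<in>UNIV. if P v then h * ((if v = l then g v else 0) * f v) else 0) = (if P l then h * (g l * f l) else 0)"
    "(\<Sum>v\<in>UNIV. if P v then (f v * (if l = v then c else 0)) * h else 0) = (if P l then f l * c * h else 0)"
    "(\<Sum>v\<in>UNIV. if P v then ((if l = v then c else 0) * f v) * h else 0) = (if P l then c * f l * h else 0)"
proof -
  have "(\<Sum>v\<in>UNIV. if P v then h * (f v * (if v = l then g v else 0)) else 0)
     = (\<Sum>v\<in>UNIV. if v = l then (if P l then h * (f l * g l) else 0) else 0)"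
    "(\<Sum>v\<in>UNIV. if P v then h * ((if v = l then g v else 0) * f v) else 0)
     = (\<Sum>v\<in>UNIV. if v = l then (if P l then h * (g l * f l) else 0) else 0)"
    "(\<Sum>v\<in>UNIV. if P v then (f v * (if l = v then c else 0)) * h else 0)
     = (\<Sum>v\<in>UNIV. if v = l then (if P l then f l * c * h else 0) else 0)"
    "(\<Sum>v\<in>UNIV. if P v then ((if l = v then c else 0) * f v) * h else 0)
     = (\<Sum>v\<in>UNIV. if v = l then (if P l then c * f l * h else 0) else 0)"
    by (intro sum.cong refl; auto)+
  then show "(\<Sum>v\<in>UNIV. if P v then h * (f v * (if v = l then g v else 0)) else 0) = (if P l then h * (f l * g l) else 0)"
    "(\<Sum>v\<in>UNIV. if P v then h * ((if v = l then g v else 0) * f v) else 0) = (if P l then h * (g l * f l) else 0)"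
    "(\<Sum>v\<in>UNIV. if P v then (f v * (if l = v then c else 0)) * h else 0) = (if P l then f l * c * h else 0)"
    "(\<Sum>v\<in>UNIV. if P v then ((if l = v then c else 0) * f v) * h else 0) = (if P l then c * f l * h else 0)"
    by simp_all
qed

lemma if_sum_add:
  fixes f :: "'n::finite \<Rightarrow> complex"
  shows "(\<Sum>v\<in>UNIV. if P v then h * (f v + g v) else 0)
     = (\<Sum>v\<in>UNIV. if P v then h * f v else 0) + (\<Sum>v\<in>UNIV. if P v then h * g v else 0)"
    "(\<Sum>v\<in>UNIV. if P v then (f v + g v) * h else 0)
     = (\<Sum>v\<in>UNIV. if P v then f v * h else 0) + (\<Sum>v\<in>UNIV. if P v then g v * h else 0)"
  by (auto simp: sum.distrib[symmetric] distrib_left distrib_right intro!: sum.cong)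

lemma partial_transpose_hecke_intertwiner:
  fixes \<rho> :: "'n::finite uq_rep" and \<kappa> :: complex
  assumes \<rho>: "chain_rep r q \<rho> \<tau> pos \<phi>" and q: "0 < q" and g: "g \<in> uq_gens r"
  defines "B \<equiv> partial_transpose (hecke (\<kappa> * of_real q) \<kappa> (\<kappa> * (of_real q - 1 / of_real q)) (\<lambda>x y. pos x < pos y))"
  shows "B ** tensor_rep (dual_rep \<rho>) \<rho> g = tensor_rep \<rho> (dual_rep \<rho>) g ** B"
proof -
  have \<tau>: "\<tau> ` {1..r} = {1..r}" using \<rho> by (simp add: chain_rep_def)
  have inj: "x = y \<longleftrightarrow> pos x = pos y" for x y using chain_rep_pos[OF \<rho>] by simp
  have ne: "complex_of_real q \<noteq> 0" using q by simp
  have cn: "chain_char q k p \<noteq> 0" for k p using q by (auto simp: chain_char_def)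
  have "(B ** tensor_rep (dual_rep \<rho>) \<rho> g) $ (n, m) $ (k, l)
      = (tensor_rep \<rho> (dual_rep \<rho>) g ** B) $ (n, m) $ (k, l)" for n m k l
    using \<tau> g
  proof (cases rule: uq_gens_chain_cases)
    case (1 j)
    note e = chain_rep_entries[OF \<rho> 1(1)] dual_chain_entries[OF \<rho> q 1(1)]
    show ?thesis unfolding B_def partial_transpose_hecke_mult_left partial_transpose_hecke_mult_right
        1(2) tensor_rep.simps kron_entry e sum_if_diag_right
      using cn[of j]
      by (cases "n = m"; cases "k = l"; cases "m = k"; cases "n = l"; simp)
  next
    case (2 j)
    note e = chain_rep_entries[OF \<rho> 2(1)] dual_chain_entries[OF \<rho> q 2(1)]
    show ?thesis unfolding B_def partial_transpose_hecke_mult_left partial_transpose_hecke_mult_right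
        2(2) tensor_rep.simps kron_entry e sum_if_diag_right
      using cn[of j]
      by (cases "n = m"; cases "k = l"; cases "m = k"; cases "n = l"; simp)
  next
    case (3 j)
    note e = chain_rep_entries[OF \<rho> 3(1)] dual_chain_entries[OF \<rho> q 3(1)]
    show ?thesis unfolding B_def partial_transpose_hecke_mult_left partial_transpose_hecke_mult_right
        3(2) tensor_rep.simps vector_add_component kron_entry e mat_def vec_lambda_beta if_sum_add sum_if_diag_right
      unfolding chain_char_def inj by (rule dual_E_identity[OF ne])
  next
    case (4 j)
    note e = chain_rep_entries[OF \<rho> 4(1)] dual_chain_entries[OF \<rho> q 4(1)]
    show ?thesis unfolding B_def partial_transpose_hecke_mult_left partial_transpose_hecke_mult_right
        4(2) tensor_rep.simps vector_add_component kron_entry e mat_def vec_lambda_beta if_sum_add sum_if_diag_right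
      unfolding chain_char_def inj by (rule dual_F_identity[OF ne])
  qed
  then show ?thesis by (simp add: vec_eq_iff split_paired_All)
qed

text \<open>The sum telescopes, since \<open>(Q - Q\<^sup>-\<^sup>1) f n = Q f n - Q f (n + 1)\<close>.\<close>

lemma geometric_strict_between:
  fixes f :: "nat \<Rightarrow> complex"
  assumes "Q \<noteq> 0" and f: "\<And>n. f (Suc n) = f n / Q^2" and "a < k"
  shows "(Q - 1 / Q) * (\<Sum>n\<in>{a<..<k}. f n) = f a / Q - Q * f k"
  using \<open>a < k\<close>
proof (induction k)
  case (Suc k)
  show ?case
  proof (cases "a = k")
    case True
    have "{a<..<Suc k} = {}" using True by auto
    then show ?thesis using True assms(1) by (simp add: f power2_eq_square)
  next
    case False
    then have "{a<..<Suc k} = insert k {a<..<k}" using Suc.prems by auto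
    then have "(Q - 1 / Q) * (\<Sum>n\<in>{a<..<Suc k}. f n) = (Q - 1 / Q) * f k + (f a / Q - Q * f k)"
      using Suc False by (simp add: distrib_left)
    then show ?thesis using assms(1) by (simp add: f field_simps power2_eq_square)
  qed
qed simp

lemma geometric_sum_pos:
  fixes f :: "nat \<Rightarrow> complex"
  assumes "Q \<noteq> 0" and f: "\<And>n. f (Suc n) = f n / Q^2" and "a < k" "k \<le> r + 1"
    and bij: "bij_betw pos UNIV {1..r+1}"
  shows "(Q - 1 / Q) * (\<Sum>v\<in>UNIV. if a < pos v \<and> pos v < k then f (pos v) else 0) = f a / Q - Q * f k"
proof -
  have "(\<Sum>v\<in>UNIV. if a < pos v \<and> pos v < k then f (pos v) else 0)
      = (\<Sum>n\<in>{1..r+1}. if a < n \<and> n < k then f n else 0)"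
    by (rule sum.reindex_bij_betw[OF bij])
  also have "\<dots> = (\<Sum>n\<in>{a<..<k}. f n)"
    using assms(4) by (intro sum.mono_neutral_cong_right) auto
  finally show ?thesis using geometric_strict_between[of Q f a k, OF assms(1-3)] by simp
qed

section \<open>Weights and normalizations\<close>

lemma matrix_inv_eqI:
  fixes A B :: "complex ^ 'n::finite ^ 'n"
  assumes "A ** B = mat 1"
  shows "matrix_inv A = B" "B ** A = mat 1"
proof -
  show BA: "B ** A = mat 1" using assms matrix_left_right_inverse by blast
  have "A ** matrix_inv A = mat 1 \<and> matrix_inv A ** A = mat 1"
    unfolding matrix_inv_def by (rule someI[of _ B]) (use assms BA in simp)
  then have "matrix_inv A ** A = mat 1" by simp
  then have "matrix_inv A ** A ** B = B" by simp
  then show "matrix_inv A = B" using assms by (simp add: matrix_mul_assoc[symmetric])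
qed

lemma wt_form_fund_weight:
  assumes "i \<in> {1..r}"
  shows "wt_form r (fund_weight r i) \<mu> = (\<Sum>k=1..i. \<mu> k) - real i / real (r + 1) * (\<Sum>k=1..r+1. \<mu> k)"
proof -
  have "wt_form r (fund_weight r i) \<mu>
      = (\<Sum>k=1..r+1. (if k \<le> i then \<mu> k else 0) - real i / real (r + 1) * \<mu> k)"
    unfolding wt_form_def fund_weight_def by (intro sum.cong) (auto simp: algebra_simps)
  also have "\<dots> = (\<Sum>k=1..r+1. if k \<le> i then \<mu> k else 0) - real i / real (r + 1) * (\<Sum>k=1..r+1. \<mu> k)"
    by (simp only: sum_subtractf sum_distrib_left)
  also have "(\<Sum>k=1..r+1. if k \<le> i then \<mu> k else 0) = (\<Sum>k=1..i. \<mu> k)"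
    using assms by (intro sum.mono_neutral_cong_right) auto
  finally show ?thesis .
qed

lemma fund_weight_sum_zero:
  assumes "i \<in> {1..r}"
  shows "(\<Sum>k=1..r+1. fund_weight r i k) = 0"
proof -
  have "(\<Sum>k=1..r+1. fund_weight r i k) = (\<Sum>k=1..r+1. (if k \<le> i then 1 else 0) - real i / real (r + 1))"
    unfolding fund_weight_def by (intro sum.cong) auto
  also have "\<dots> = (\<Sum>k=1..r+1. if k \<le> i then 1 else 0) - real i"
    by (simp add: sum_subtractf)
  also have "(\<Sum>k=1..r+1. if k \<le> i then 1 else 0) = (\<Sum>k=1..i. 1 :: real)"
    using assms by (intro sum.mono_neutral_cong_right) auto
  finally show ?thesis by simp
qed

lemma sum_w0: "(\<Sum>k=1..r+1. w0 r \<mu> k) = (\<Sum>k=1..r+1. \<mu> k)"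
  unfolding w0_def by (rule sum.reindex_bij_witness[of _ "\<lambda>k. r + 2 - k" "\<lambda>k. r + 2 - k"]) auto

lemma fund_weight_end_norms:
  assumes "1 \<le> r" "s = 1 \<or> s = r"
  shows "wt_form r (fund_weight r s) (fund_weight r s) = real r / real (r + 1)"
    and "wt_form r (fund_weight r s) (w0 r (fund_weight r s)) = - 1 / real (r + 1)"
proof -
  have s: "s \<in> {1..r}" using assms by auto
  note z = fund_weight_sum_zero[OF s] sum_w0[of r "fund_weight r s"]
  have a: "wt_form r (fund_weight r s) (fund_weight r s) = (\<Sum>k=1..s. fund_weight r s k)"
    unfolding wt_form_fund_weight[OF s] z by simp
  also have "\<dots> = (\<Sum>k=1..s. 1 - real s / real (r + 1))"
    using s by (intro sum.cong) (auto simp: fund_weight_def)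
  also have "\<dots> = real r / real (r + 1)" using assms(2) by (auto simp: field_simps)
  finally show "wt_form r (fund_weight r s) (fund_weight r s) = real r / real (r + 1)" .
  have "wt_form r (fund_weight r s) (w0 r (fund_weight r s)) = (\<Sum>k=1..s. w0 r (fund_weight r s) k)"
    unfolding wt_form_fund_weight[OF s] z by simp
  also have "\<dots> = - 1 / real (r + 1)"
    using assms(2)
  proof
    assume "s = 1"
    then show ?thesis using assms(1) by (simp add: w0_def fund_weight_def)
  next
    assume sr: "s = r"
    have "(\<Sum>k=1..r+1. w0 r (fund_weight r s) k) = 0" using z by simp
    then have "(\<Sum>k=1..r. w0 r (fund_weight r s) k) = - w0 r (fund_weight r s) (r + 1)" by simp
    also have "w0 r (fund_weight r s) (r + 1) = 1 / real (r + 1)"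
      using assms(1) sr by (simp add: w0_def fund_weight_def field_simps)
    finally show ?thesis using sr by simp
  qed
  finally show "wt_form r (fund_weight r s) (w0 r (fund_weight r s)) = - 1 / real (r + 1)" .
qed

lemma two_rho_coord:
  assumes "k \<in> {1..r+1}"
  shows "two_rho r k = real r + 2 - 2 * real k"
proof -
  have "(\<Sum>i=1..r. fund_weight r i k) = (\<Sum>i=1..r. (if k \<le> i then 1 else 0) - real i / real (r + 1))"
    unfolding fund_weight_def using assms by (intro sum.cong) auto
  also have "\<dots> = (\<Sum>i=1..r. if k \<le> i then 1 else 0) - (\<Sum>i=1..r. real i) / real (r + 1)"
    by (simp add: sum_subtractf sum_divide_distrib)
  also have "(\<Sum>i=1..r. if k \<le> i then 1 else 0) = (\<Sum>i=k..r. 1 :: real)"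
    using assms by (intro sum.mono_neutral_cong_right) auto
  also have "(\<Sum>i=1..r. real i) = real r / 2 * real (r + 1)"
    by (induction r) (auto simp: field_simps)
  also have "real r / 2 * real (r + 1) / real (r + 1) = real r / 2"
    by (rule nonzero_mult_div_cancel_right) simp
  finally show ?thesis using assms by (simp add: two_rho_def of_nat_diff)
qed

lemma fund_weight_two_rho:
  assumes i: "i \<in> {1..r}"
  shows "wt_form r (fund_weight r i) (two_rho r) = real i * (real r + 1 - real i)"
proof -
  have s: "(\<Sum>k=1..n. real r + 2 - 2 * real k) = real n * (real r + 1 - real n)" for n
    by (induction n) (auto simp: algebra_simps)
  have "(\<Sum>k=1..i. two_rho r k) = (\<Sum>k=1..i. real r + 2 - 2 * real k)"
    using i by (intro sum.cong two_rho_coord) auto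
  moreover have "(\<Sum>k=1..r+1. two_rho r k) = (\<Sum>k=1..r+1. real r + 2 - 2 * real k)"
    by (intro sum.cong two_rho_coord) auto
  ultimately show ?thesis unfolding wt_form_fund_weight[OF i] s by simp
qed

lemma wt_form_sum: "wt_form r (\<lambda>k. \<Sum>i\<in>I. c i * \<mu> i k) \<nu> = (\<Sum>i\<in>I. c i * wt_form r (\<mu> i) \<nu>)"
  unfolding wt_form_def sum_distrib_left sum_distrib_right
  by (subst sum.swap) (simp add: mult.assoc)

text \<open>A weight is the combination of the \<open>\<omega>\<^sub>i\<close> with coefficients \<open>(\<alpha>\<^sub>i, \<nu>)\<close>, and
  \<open>(\<omega>\<^sub>i, 2\<rho>) = i (r + 1 - i)\<close>.\<close>

lemma lattice_weight_two_rho: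
  assumes "\<nu> \<in> weight_lattice r"
  shows "wt_form r \<nu> (two_rho r) =
    (\<Sum>i=1..r. wt_form r (simple_root i) \<nu> * (real i * (real r + 1 - real i)))"
proof -
  obtain n :: "nat \<Rightarrow> int" where n: "\<nu> = (\<lambda>k. \<Sum>i=1..r. of_int (n i) * fund_weight r i k)"
    using assms by (auto simp: weight_lattice_def)
  have "wt_form r (simple_root j) \<nu> = of_int (n j)" if j: "j \<in> {1..r}" for j
  proof -
    have "wt_form r (simple_root j) \<nu> = (\<Sum>i=1..r. of_int (n i) * wt_form r (fund_weight r i) (simple_root j))"
      by (subst wt_form_commute) (simp only: n wt_form_sum)
    also have "\<dots> = (\<Sum>i=1..r. if i = j then of_int (n j) else 0)"
      by (intro sum.cong refl) (subst wt_form_commute, use fund_weight_root[OF j] in auto)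
    finally show ?thesis using j by simp
  qed
  then show ?thesis unfolding n wt_form_sum[of r] by (simp add: fund_weight_two_rho)
qed

lemma chain_exp_sum:
  assumes "p \<in> {1..r+1}"
  shows "(\<Sum>k=1..r. chain_exp k p * (real k * (real r + 1 - real k))) = real r + 2 - 2 * real p"
proof -
  let ?f = "\<lambda>k. real k * (real r + 1 - real k)"
  have "(\<Sum>k=1..r. chain_exp k p * ?f k) =
    (\<Sum>k=1..r. (if k = p then ?f p else 0) - (if k = p - 1 then ?f (p - 1) else 0))"
    using assms by (intro sum.cong) (auto simp: chain_exp_def)
  also have "\<dots> = (if p \<le> r then ?f p else 0) - (if 2 \<le> p then ?f (p - 1) else 0)"
    using assms by (auto simp: sum_subtractf)
  also have "\<dots> = ?f p - ?f (p - 1)"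
  proof -
    have "p = r + 1 \<or> p \<le> r" "p = 1 \<or> 2 \<le> p" using assms by auto
    then show ?thesis by auto
  qed
  also have "\<dots> = real r + 2 - 2 * real p" using assms by (simp add: of_nat_diff algebra_simps)
  finally show ?thesis .
qed

text \<open>The coefficients \<open>i (r + 1 - i)\<close> are invariant under the diagram automorphism, so the value depends
  on the position in the chain only.\<close>

lemma chain_weight_two_rho:
  assumes "lam \<in> weight_lattice r" "p \<in> {1..r+1}"
    and "\<And>j. j \<in> {1..r} \<Longrightarrow> wt_form r (simple_root (diagram_flip r s j)) lam = chain_exp j p"
  shows "wt_form r lam (two_rho r) = real r + 2 - 2 * real p"
proof -
  let ?f = "\<lambda>k. real k * (real r + 1 - real k)"
  have "inj_on (diagram_flip r s) {1..r}" by (rule eq_card_imp_inj_on) (simp_all only: diagram_flip_image finite_atLeastAtMost)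
  then have bij: "bij_betw (diagram_flip r s) {1..r} {1..r}" by (simp only: bij_betw_def diagram_flip_image simp_thms)
  have "wt_form r lam (two_rho r) = (\<Sum>i=1..r. wt_form r (simple_root i) lam * ?f i)"
    by (rule lattice_weight_two_rho[OF assms(1)])
  also have "\<dots> = (\<Sum>j=1..r. wt_form r (simple_root (diagram_flip r s j)) lam * ?f (diagram_flip r s j))"
    by (rule sum.reindex_bij_betw[OF bij, symmetric])
  also have "\<dots> = (\<Sum>j=1..r. chain_exp j p * ?f j)"
  proof (intro sum.cong refl)
    fix j assume j: "j \<in> {1..r}"
    have "?f (diagram_flip r s j) = ?f j"
      using j by (simp add: diagram_flip_def of_nat_diff)
    then show "wt_form r (simple_root (diagram_flip r s j)) lam * ?f (diagram_flip r s j) = chain_exp j p * ?f j"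
      by (simp only: assms(3)[OF j])
  qed
  finally show ?thesis using chain_exp_sum[OF assms(2)] by simp
qed

lemma w0_root:
  assumes "k \<in> {1..r}"
  shows "wt_form r (simple_root k) (w0 r \<mu>) = - wt_form r (simple_root (r + 1 - k)) \<mu>"
proof -
  have "r + 1 - k \<in> {1..r}" using assms by auto
  moreover have "r + 2 - k = Suc (r + 1 - k)" "r + 2 - Suc k = r + 1 - k" using assms by auto
  ultimately show ?thesis using assms by (simp only: simple_root_form w0_def minus_diff_eq)
qed

lemma dual_weight_root:
  assumes "k \<in> {1..r}"
  shows "wt_form r (simple_root k) (dual_weight r \<mu>) = wt_form r (simple_root (r + 1 - k)) \<mu>"
    "wt_form r (simple_root k) (w0 r (dual_weight r \<mu>)) = - wt_form r (simple_root k) \<mu>"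
proof -
  have "wt_form r \<nu> (dual_weight r \<mu>) = - wt_form r \<nu> (w0 r \<mu>)" for \<nu>
    by (simp add: wt_form_def dual_weight_def sum_negf)
  then have 1: "wt_form r (simple_root j) (dual_weight r \<mu>) = wt_form r (simple_root (r + 1 - j)) \<mu>"
    if "j \<in> {1..r}" for j using w0_root[OF that] by simp
  show "wt_form r (simple_root k) (dual_weight r \<mu>) = wt_form r (simple_root (r + 1 - k)) \<mu>"
    by (rule 1[OF assms])
  have "r + 1 - k \<in> {1..r}" "r + 1 - (r + 1 - k) = k" using assms by auto
  then show "wt_form r (simple_root k) (w0 r (dual_weight r \<mu>)) = - wt_form r (simple_root k) \<mu>"
    using w0_root[OF assms, of "dual_weight r \<mu>"] 1[of "r + 1 - k"] by simp
qed

lemma wt_form_w0_dual: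
  "wt_form r \<nu> (w0 r (dual_weight r \<mu>)) = - wt_form r \<nu> \<mu>"
  "wt_form r (dual_weight r \<nu>) (w0 r (dual_weight r \<mu>)) = wt_form r \<mu> (w0 r \<nu>)"
proof -
  have "w0 r (dual_weight r \<mu>) k = - \<mu> k" if "k \<in> {1..r+1}" for k
    using that by (simp add: w0_def dual_weight_def)
  then show "wt_form r \<nu> (w0 r (dual_weight r \<mu>)) = - wt_form r \<nu> \<mu>" for \<nu>
    unfolding wt_form_def sum_negf[symmetric] by (intro sum.cong refl) simp
  then show "wt_form r (dual_weight r \<nu>) (w0 r (dual_weight r \<mu>)) = wt_form r \<mu> (w0 r \<nu>)"
    by (simp add: wt_form_def dual_weight_def sum_negf mult.commute)
qed

lemma diagram_flip_roots:
  assumes "1 \<le> r" "s = 1 \<or> s = r" "k \<in> {1..r}"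
  defines "\<omega> \<equiv> fund_weight r s"
  shows "wt_form r (simple_root (diagram_flip r s k)) \<omega> = of_bool (k = 1)"
    "wt_form r (simple_root (diagram_flip r s k)) (w0 r \<omega>) = - of_bool (k = r)"
    "wt_form r (simple_root (diagram_flip r s (r + 1 - k))) (dual_weight r \<omega>) = of_bool (k = 1)"
    "wt_form r (simple_root (diagram_flip r s (r + 1 - k))) (w0 r (dual_weight r \<omega>)) = - of_bool (k = r)"
proof -
  have s: "s \<in> {1..r}" using assms by auto
  have k': "r + 1 - k \<in> {1..r}" using assms(3) by auto
  have f: "diagram_flip r s j \<in> {1..r}" "r + 1 - diagram_flip r s j \<in> {1..r}" if "j \<in> {1..r}" for j
    using diagram_flip_mem[OF that, of s] by auto
  show "wt_form r (simple_root (diagram_flip r s k)) \<omega> = of_bool (k = 1)"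
    unfolding \<omega>_def fund_weight_root[OF f(1)[OF assms(3)] s] using assms(2,3) by (auto simp: diagram_flip_def)
  show "wt_form r (simple_root (diagram_flip r s k)) (w0 r \<omega>) = - of_bool (k = r)"
    unfolding \<omega>_def w0_root[OF f(1)[OF assms(3)]] fund_weight_root[OF f(2)[OF assms(3)] s]
    using assms(1,2,3) by (auto simp: diagram_flip_def)
  show "wt_form r (simple_root (diagram_flip r s (r + 1 - k))) (dual_weight r \<omega>) = of_bool (k = 1)"
    unfolding \<omega>_def dual_weight_root[OF f(1)[OF k']] fund_weight_root[OF f(2)[OF k'] s]
    using assms(1,2,3) by (auto simp: diagram_flip_def)
  show "wt_form r (simple_root (diagram_flip r s (r + 1 - k))) (w0 r (dual_weight r \<omega>)) = - of_bool (k = r)"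
    unfolding \<omega>_def dual_weight_root[OF f(1)[OF k']] fund_weight_root[OF f(1)[OF k'] s]
    using assms(1,2,3) by (auto simp: diagram_flip_def)
qed

section \<open>Rigidity of the braidings\<close>

text \<open>What the rest of the argument uses about the braidings \<open>R\<close>, \<open>R'\<close>, \<open>Rd\<close> of \<open>V \<otimes> V\<close>, \<open>V \<otimes> V\<^sup>*\<close>,
  \<open>V\<^sup>* \<otimes> V\<^sup>*\<close>. The snake rules say that a strand passes over or under a cap \<open>E\<close>, the trace rules say the same
  for a cap \<open>E'\<close> with weights \<open>D\<close>, and \<open>twist\<close> says that \<open>E'\<close> after the inverse braiding is \<open>C\<close> times \<open>E\<close>.\<close>

locale rigid_braiding =
  fixes R R' Rd :: "complex ^ ('n::finite \<times> 'n) ^ ('n \<times> 'n)" and D :: "'n \<Rightarrow> complex" and C :: complex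
  assumes inverse_R: "matrix_inv R ** R = mat 1"
    and inverse_R': "R' ** matrix_inv R' = mat 1" "matrix_inv R' ** R' = mat 1"
    and inverse_Rd: "Rd ** matrix_inv Rd = mat 1"
    and snake_R': "matrix_inv R' $ (n, m) $ (k, l) = R $ (k, n) $ (l, m)"
    and snake_Rd: "Rd $ (m, l) $ (b, k) = R $ (k, b) $ (l, m)"
    and trace_R: "D a * R' $ (a, l) $ (i, j) = D j * matrix_inv R $ (l, j) $ (a, i)"
    and trace_Rd: "D b * R' $ (k, b) $ (i, j) = D i * matrix_inv Rd $ (i, k) $ (j, b)"
    and twist: "(\<Sum>m\<in>UNIV. D m * matrix_inv R' $ (m, m) $ (k, l)) = (if k = l then C else 0)"

text \<open>All three braidings come from the Hecke-type matrix with \<open>\<kappa> = q\<^bsup>(\<omega>\<^sub>s, w\<^sub>0 \<omega>\<^sub>s)\<^esup> = q\<^bsup>-1/(r+1)\<^esup>\<close>: it is the braiding of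
  \<open>V \<otimes> V\<close>, the reversed order gives \<open>V\<^sup>* \<otimes> V\<^sup>*\<close>, and its bendings give \<open>V \<otimes> V\<^sup>*\<close>. The snake and trace rules then
  compare entries; the twist is a geometric sum.\<close>

lemma quantum_group_rigid_braiding:
  fixes \<rho> :: "'n::finite uq_rep"
  assumes qg: "quantum_group_data r q s \<rho> lam"
  shows "rigid_braiding (R_VV r q s \<rho>) (R_VD r q s \<rho>) (R_DD r q s \<rho>)
     (\<lambda>x. qpow q (wt_form r (lam x) (two_rho r))) (qpow q (par_w r s + par_m r s))"
proof -
  have r: "1 \<le> r" and q: "0 < q" "q < 1" and s: "s = 1 \<or> s = r"
    and lat: "\<And>x. lam x \<in> weight_lattice r"
    using qg by (auto simp: quantum_group_data_def)
  define \<tau> where "\<tau> = diagram_flip r s"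
  obtain pos \<phi> where \<rho>: "chain_rep r q \<rho> \<tau> pos \<phi>"
    and wt: "\<And>j x. j \<in> {1..r} \<Longrightarrow> wt_form r (simple_root (\<tau> j)) (lam x) = chain_exp j (pos x)"
    using quantum_group_chain_rep[OF qg] unfolding \<tau>_def by blast
  note dual = chain_rep_dual[OF \<rho> q(1)]
  have pos: "pos x \<in> {1..r+1}" "pos x = pos y \<longleftrightarrow> x = y" for x y using chain_rep_pos[OF \<rho>] by auto
  have bij: "bij_betw pos UNIV {1..r+1}" using \<rho> by (simp add: chain_rep_def)
  let ?\<omega> = "fund_weight r s"
  define Q where "Q = complex_of_real q"
  define \<kappa> where "\<kappa> = qpow q (- 1 / real (r + 1))"
  \<comment> \<open>\<open>f n\<close> is the weight of the quantum trace at position \<open>n\<close>; the value at \<open>0\<close> occurs as boundary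
    term of the geometric sum for the twist.\<close>
  define f where "f n = qpow q (real r + 2 - 2 * real n)" for n :: nat
  define D where "D x = f (pos x)" for x
  define lt where "lt x y \<longleftrightarrow> pos x < pos y" for x y
  define h where "h = \<kappa> * (Q - 1 / Q)"
  define h' where "h' = - (Q - 1 / Q) / \<kappa>"
  have Q0: "Q \<noteq> 0" and \<kappa>0: "\<kappa> \<noteq> 0" using q by (simp_all add: Q_def \<kappa>_def qpow_def)
  have qadd: "qpow q (x + y) = qpow q x * qpow q y" for x y
    by (simp add: qpow_def powr_add)
  have q1: "qpow q 1 = Q" using q by (simp add: qpow_def Q_def)
  have f: "f (Suc n) = f n / Q^2" for n
  proof -
    have "f n = f (Suc n) * (qpow q 1 * qpow q 1)"
      unfolding f_def qadd[symmetric] by (simp add: algebra_simps)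
    then show ?thesis using Q0 by (simp add: q1 power2_eq_square)
  qed
  have D0: "D x \<noteq> 0" for x using q by (simp add: D_def f_def qpow_def)
  have D: "D x = qpow q (wt_form r (lam x) (two_rho r))" for x
    using chain_weight_two_rho[OF lat pos(1), of s x x] wt unfolding D_def f_def \<tau>_def by metis
  have lt: "lt x y \<Longrightarrow> \<not> lt y x" "x \<noteq> y \<Longrightarrow> lt x y \<or> lt y x" "\<not> lt x x" "lt x y \<Longrightarrow> lt y z \<Longrightarrow> lt x z" for x y z
    using pos(2)[of x y] by (auto simp: lt_def)
  define R where "R = hecke (\<kappa> * Q) \<kappa> h lt"
  define Ri where "Ri = hecke (1 / (\<kappa> * Q)) (1 / \<kappa>) h' (\<lambda>x y. lt y x)"
  define Rd where "Rd = hecke (\<kappa> * Q) \<kappa> h (\<lambda>x y. lt y x)"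
  define Rdi where "Rdi = hecke (1 / (\<kappa> * Q)) (1 / \<kappa>) h' lt"
  define B where "B = partial_transpose R"
  define R' where "R' = weighted_transpose D Ri"
  have coeff: "\<kappa> * Q * (1 / (\<kappa> * Q)) = 1" "\<kappa> * (1 / \<kappa>) = 1" "\<kappa> * h' + h * (1 / \<kappa>) = 0"
    using Q0 \<kappa>0 by (simp_all add: h_def h'_def)
  have RRi: "R ** Ri = mat 1" unfolding R_def Ri_def by (rule hecke_inverse[OF coeff lt(1,2)])
  have RdRdi: "Rd ** Rdi = mat 1"
    unfolding Rd_def Rdi_def by (rule hecke_inverse[OF coeff, of "\<lambda>x y. lt y x"]) (use lt(1,2) in auto)
  have geo0: "(Q - 1 / Q) * (\<Sum>v\<in>UNIV. if a < pos v \<and> pos v < k then f (pos v) else 0) = f a / Q - Q * f k"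
    if "a < k" "k \<le> r + 1" for a k
    by (rule geometric_sum_pos[of Q f, OF Q0 f that bij])
  have R'B: "R' ** B = mat 1"
    unfolding R'_def Ri_def B_def R_def
  proof (rule weighted_transpose_inverse)
    show "1 / (\<kappa> * Q) * (\<kappa> * Q) = 1" "1 / \<kappa> * \<kappa> = 1" using Q0 \<kappa>0 by simp_all
    fix a k assume ak: "lt a k"
    have hh: "h * h' = - ((Q - 1 / Q)^2)" using \<kappa>0
      by (simp add: h_def h'_def power2_eq_square) (simp add: algebra_simps)
    have "h * h' * (\<Sum>v\<in>UNIV. if lt a v \<and> lt v k then D v else 0)
       = - (Q - 1 / Q) * ((Q - 1 / Q) * (\<Sum>v\<in>UNIV. if lt a v \<and> lt v k then D v else 0))"
      unfolding hh by (simp only: power2_eq_square mult.assoc mult_minus_left)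
    also have "\<dots> = - (Q - 1 / Q) * (D a / Q - Q * D k)"
      using ak pos(1)[of k] unfolding lt_def D_def by (subst geo0) auto
    finally have "h * h' * (\<Sum>v\<in>UNIV. if lt a v \<and> lt v k then D v else 0) = - (Q - 1 / Q) * (D a / Q - Q * D k)" .
    moreover have "h' * (\<kappa> * Q) = - (Q - 1 / Q) * Q" "1 / (\<kappa> * Q) * h = (Q - 1 / Q) / Q"
      using \<kappa>0 by (simp_all add: h_def h'_def)
    ultimately have "h' * (\<kappa> * Q) * D k + 1 / (\<kappa> * Q) * h * D a
        + h * h' * (\<Sum>v\<in>UNIV. if lt a v \<and> lt v k then D v else 0)
       = (- (Q - 1 / Q) * Q) * D k + ((Q - 1 / Q) / Q) * D a + - (Q - 1 / Q) * (D a / Q - Q * D k)"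
      by (simp only:)
    also have "\<dots> = 0" using Q0 by (simp add: field_simps)
    finally show "h' * (\<kappa> * Q) * D k + 1 / (\<kappa> * Q) * h * D a
        + h * h' * (\<Sum>v\<in>UNIV. if lt a v \<and> lt v k then D v else 0) = 0" .
  next
    show "D x \<noteq> 0" for x by (rule D0)
    show "\<not> lt x x" for x by (rule lt(3))
    show "lt a k" if "lt a v" "lt v k" for a v k using that by (rule lt(4))
  qed
  note inv = matrix_inv_eqI[OF RRi] matrix_inv_eqI[OF RdRdi] matrix_inv_eqI[OF R'B]
  have axis_entry: "(M *v axis y 1) $ x = M $ x $ y" for M :: "complex ^ ('n \<times> 'n) ^ ('n \<times> 'n)" and x y
    by (rule matrix_axis_component)
  note roots = diagram_flip_roots[OF r s]
  have w: "par_w r s = 1 + - 1 / real (r + 1)" and m: "par_m r s = real r"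
    using fund_weight_end_norms(1)[OF r s] fund_weight_two_rho[of s r] r s
    by (auto simp: par_w_def par_m_def field_simps)
  have norm: "qpow q (wt_form r ?\<omega> (w0 r ?\<omega>)) = \<kappa>" "qpow q (par_w r s) = \<kappa> * Q"
    unfolding fund_weight_end_norms[OF r s] w qadd q1 by (simp_all add: \<kappa>_def)
  have dual_norm: "qpow q (wt_form r (dual_weight r ?\<omega>) (w0 r (dual_weight r ?\<omega>))) = \<kappa>"
    "qpow q (wt_form r ?\<omega> (w0 r (dual_weight r ?\<omega>))) = 1 / (\<kappa> * Q)"
    using norm(2) q unfolding wt_form_w0_dual(2) norm(1) unfolding wt_form_w0_dual(1) par_w_def
    by (simp_all add: qpow_def powr_minus_divide)
  have VV: "R_VV r q s \<rho> = R"
    unfolding R_VV_def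
  proof (rule braiding_eqI[OF \<rho> \<rho> q])
    show "R ** tensor_rep \<rho> \<rho> g = tensor_rep \<rho> \<rho> g ** R" if "g \<in> uq_gens r" for g
      using hecke_intertwiner[OF \<rho> q(1) that, of \<kappa>] unfolding R_def h_def Q_def lt_def .
    fix x y assume "pos x = 1" "pos y = r + 1"
    then have "x \<noteq> y" "\<not> lt y x" using r by (auto simp: lt_def)
    then have "R *v axis (x, y) 1 = \<kappa> *s axis (y, x) 1"
      unfolding vec_eq_iff axis_entry split_paired_All R_def hecke_entry by (auto simp: axis_def)
    then show "R *v axis (x, y) 1 = complex_of_real (q powr wt_form r ?\<omega> (w0 r ?\<omega>)) *s axis (y, x) 1"
      using norm(1) by (simp only: qpow_def)
  qed (use roots(1,2) in \<open>simp_all add: \<tau>_def\<close>)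
  have lt_dual: "(\<lambda>x y. r + 2 - pos x < r + 2 - pos y) = (\<lambda>x y. lt y x)"
  proof (intro ext)
    fix x y show "(r + 2 - pos x < r + 2 - pos y) = lt y x"
      using pos(1)[of x] pos(1)[of y] by (auto simp: lt_def)
  qed
  have DD: "R_DD r q s \<rho> = Rd"
    unfolding R_DD_def
  proof (rule braiding_eqI[OF dual dual q])
    show "Rd ** tensor_rep (dual_rep \<rho>) (dual_rep \<rho>) g = tensor_rep (dual_rep \<rho>) (dual_rep \<rho>) g ** Rd"
      if "g \<in> uq_gens r" for g
      using hecke_intertwiner[OF dual q(1) that, of \<kappa>] unfolding lt_dual Rd_def h_def Q_def .
    fix x y assume "r + 2 - pos x = 1" "r + 2 - pos y = r + 1"
    then have "x \<noteq> y" "\<not> lt x y" using r by (auto simp: lt_def)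
    then have "Rd *v axis (x, y) 1 = \<kappa> *s axis (y, x) 1"
      unfolding vec_eq_iff axis_entry split_paired_All Rd_def hecke_entry by (auto simp: axis_def)
    then show "Rd *v axis (x, y) 1 = complex_of_real (q powr wt_form r (dual_weight r ?\<omega>)
        (w0 r (dual_weight r ?\<omega>))) *s axis (y, x) 1"
      using dual_norm(1) by (simp only: qpow_def)
  qed (use roots(3,4) in \<open>simp_all add: \<tau>_def\<close>)
  have VD: "R_VD r q s \<rho> = R'"
    unfolding R_VD_def
  proof (rule braiding_eqI[OF \<rho> dual q])
    fix g assume "g \<in> uq_gens r"
    then have "B ** tensor_rep (dual_rep \<rho>) \<rho> g = tensor_rep \<rho> (dual_rep \<rho>) g ** B"
      using partial_transpose_hecke_intertwiner[OF \<rho> q(1), of g \<kappa>] unfolding B_def R_def h_def Q_def lt_def by simp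
    then have *: "R' ** (B ** tensor_rep (dual_rep \<rho>) \<rho> g) ** R' = R' ** (tensor_rep \<rho> (dual_rep \<rho>) g ** B) ** R'"
      by simp
    have "R' ** (B ** tensor_rep (dual_rep \<rho>) \<rho> g) ** R' = tensor_rep (dual_rep \<rho>) \<rho> g ** R'"
      by (simp add: matrix_mul_assoc R'B)
    moreover have "R' ** (tensor_rep \<rho> (dual_rep \<rho>) g ** B) ** R' = R' ** tensor_rep \<rho> (dual_rep \<rho>) g"
      by (simp add: matrix_mul_assoc[symmetric] inv(6))
    ultimately show "R' ** tensor_rep \<rho> (dual_rep \<rho>) g = tensor_rep (dual_rep \<rho>) \<rho> g ** R'"
      using * by simp
  next
    fix x y assume "pos x = 1" "r + 2 - pos y = r + 1"
    then have xy: "pos x = pos y" "pos x = 1" using r by auto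
    have "x = y" using xy(1) pos(2)[of x y] by simp
    moreover have "\<not> lt z x" for z using xy(2) pos(1)[of z] by (simp add: lt_def)
    ultimately have "R' *v axis (x, y) 1 = (1 / (\<kappa> * Q)) *s axis (y, x) 1"
      unfolding vec_eq_iff axis_entry split_paired_All R'_def Ri_def weighted_transpose_entry hecke_entry
      using D0 by (auto simp: axis_def)
    then show "R' *v axis (x, y) 1 = complex_of_real (q powr wt_form r ?\<omega> (w0 r (dual_weight r ?\<omega>))) *s axis (y, x) 1"
      using dual_norm(2) by (simp only: qpow_def)
  qed (use roots(1,4) in \<open>simp_all add: \<tau>_def\<close>)
  have "rigid_braiding R R' Rd D (qpow q (par_w r s + par_m r s))"
  proof
    show "matrix_inv R ** R = mat 1" "Rd ** matrix_inv Rd = mat 1"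
      "R' ** matrix_inv R' = mat 1" "matrix_inv R' ** R' = mat 1"
      using RRi RdRdi R'B inv by simp_all
    show "matrix_inv R' $ (n, m) $ (k, l) = R $ (k, n) $ (l, m)" for n m k l
      unfolding inv B_def partial_transpose_entry ..
    show "Rd $ (m, l) $ (b, k) = R $ (k, b) $ (l, m)" for m l b k
      unfolding Rd_def R_def hecke_entry by (intro arg_cong2[of _ _ _ _ "(+)"]) auto
    show "D a * R' $ (a, l) $ (i, j) = D j * matrix_inv R $ (l, j) $ (a, i)" for a l i j
      unfolding inv R'_def weighted_transpose_entry using D0[of a] by simp
    show "D b * R' $ (k, b) $ (i, j) = D i * matrix_inv Rd $ (i, k) $ (j, b)" for b k i j
      unfolding inv R'_def weighted_transpose_entry Ri_def Rdi_def hecke_entry distrib_left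
      using D0[of k] by (intro arg_cong2[of _ _ _ _ "(+)"]) auto
    show "(\<Sum>m\<in>UNIV. D m * matrix_inv R' $ (m, m) $ (k, l)) = (if k = l then qpow q (par_w r s + par_m r s) else 0)"
      for k l
    proof -
      have pos0: "pos m = 0 \<longleftrightarrow> False" for m using pos(1)[of m] by simp
      have "(\<Sum>m\<in>UNIV. D m * matrix_inv R' $ (m, m) $ (k, l)) =
        (\<Sum>m\<in>UNIV. (if m = k then (if k = l then D k * (\<kappa> * Q) else 0) else 0)
           + (if k = l then h * (if 0 < pos m \<and> pos m < pos l then f (pos m) else 0) else 0))"
        unfolding inv B_def R_def partial_transpose_entry hecke_entry distrib_left
        by (intro sum.cong refl arg_cong2[of _ _ _ _ "(+)"]) (auto simp: lt_def D_def pos0)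
      also have "\<dots> = (if k = l then D k * (\<kappa> * Q)
          + h * (\<Sum>m\<in>UNIV. if 0 < pos m \<and> pos m < pos l then f (pos m) else 0) else 0)"
        by (cases "k = l") (simp_all add: sum.distrib sum_distrib_left)
      also have "\<dots> = (if k = l then \<kappa> * (f 0 / Q) else 0)"
        using geo0[of 0 "pos l"] pos(1)[of l] by (simp add: h_def D_def mult.assoc) (simp add: algebra_simps)
      also have "\<kappa> * (f 0 / Q) = qpow q (par_w r s + par_m r s)"
      proof -
        have "f 0 = qpow q 1 * (qpow q 1 * qpow q (real r))" unfolding f_def qadd[symmetric] by (simp add: add.commute)
        then show ?thesis using Q0 unfolding qadd norm(2) m q1 by simp
      qed
      finally show ?thesis .
    qed
  qed
  then show ?thesis unfolding VV DD VD D by (simp add: D[symmetric])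
qed

section \<open>Contractions of braided families\<close>

lemma (in module) scale_sum_if:
  fixes f :: "'i::finite \<Rightarrow> 'b"
  shows "(\<Sum>i\<in>UNIV. (if i = j then c else 0) *s f i) = c *s f j"
proof -
  have "(\<Sum>i\<in>UNIV. (if i = j then c else 0) *s f i) = (\<Sum>i\<in>UNIV. if i = j then c *s f j else 0)"
    by (intro sum.cong) auto
  then show ?thesis by simp
qed

lemma leg_map_4:
  fixes X :: "'n::finite list \<Rightarrow> 'x::ab_group_add"
  shows "leg_map sc M 1 X [x, y, z, w] = (\<Sum>p\<in>UNIV. sc (M $ (x, y) $ p) (X [fst p, snd p, z, w]))"
    and "leg_map sc M 2 X [x, y, z, w] = (\<Sum>p\<in>UNIV. sc (M $ (y, z) $ p) (X [x, fst p, snd p, w]))"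
    and "leg_map sc M 3 X [x, y, z, w] = (\<Sum>p\<in>UNIV. sc (M $ (z, w) $ p) (X [x, y, fst p, snd p]))"
  unfolding leg_map_def by (auto intro!: sum.cong simp: numeral_eq_Suc)

lemma leg_map_2_compose:
  fixes X :: "'n::finite list \<Rightarrow> 'x::ab_group_add"
  assumes "module sc"
  shows "leg_map sc M 2 (leg_map sc N 2 X) [x, y, z, w] = leg_map sc (M ** N) 2 X [x, y, z, w]"
proof -
  interpret module sc by fact
  have "leg_map sc M 2 (leg_map sc N 2 X) [x, y, z, w]
      = (\<Sum>p\<in>UNIV. \<Sum>u\<in>UNIV. sc (M $ (y, z) $ p * N $ p $ u) (X [x, fst u, snd u, w]))"
    unfolding leg_map_4 by (simp add: scale_sum_right)
  also have "\<dots> = (\<Sum>u\<in>UNIV. \<Sum>p\<in>UNIV. sc (M $ (y, z) $ p * N $ p $ u) (X [x, fst u, snd u, w]))"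
    by (rule sum.swap)
  finally show ?thesis unfolding leg_map_4 by (simp add: matrix_matrix_mult_def scale_sum_left)
qed

lemma leg_map_2_id:
  fixes X :: "'n::finite list \<Rightarrow> 'x::ab_group_add"
  assumes "module sc"
  shows "leg_map sc (mat 1) 2 X [x, y, z, w] = X [x, y, z, w]"
proof -
  interpret module sc by fact
  have "leg_map sc (mat 1) 2 X [x, y, z, w]
      = (\<Sum>p\<in>UNIV. sc (if p = (y, z) then 1 else 0) (X [x, fst p, snd p, w]))"
    unfolding leg_map_4 by (intro sum.cong) (auto simp: mat_def)
  then show ?thesis by (simp add: scale_sum_if)
qed

lemma mat_1_entry: "mat 1 $ p $ p' = (if p = p' then 1 else 0)"
  by (simp add: mat_def)

context rigid_braiding
begin

lemma matrix_product_entry: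
  fixes M N :: "complex ^ ('n \<times> 'n) ^ ('n \<times> 'n)"
  assumes "M ** N = mat 1"
  shows "(\<Sum>x\<in>UNIV. \<Sum>u\<in>UNIV. M $ p $ (x, u) * N $ (x, u) $ p') = (if p = p' then 1 else 0)"
  using arg_cong[OF assms, of "\<lambda>A. A $ p $ p'"]
  by (simp add: mat_1_entry matrix_matrix_mult_def sum_pair_UNIV)

lemma trace_over: "(\<Sum>x\<in>UNIV. \<Sum>u\<in>UNIV. D x * R' $ (x, i) $ (u, v) * R $ (x, u) $ p)
    = (if (i, v) = p then D v else 0)"
proof -
  have "(\<Sum>x\<in>UNIV. \<Sum>u\<in>UNIV. D x * R' $ (x, i) $ (u, v) * R $ (x, u) $ p)
      = D v * (\<Sum>x\<in>UNIV. \<Sum>u\<in>UNIV. matrix_inv R $ (i, v) $ (x, u) * R $ (x, u) $ p)"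
    by (simp add: trace_R sum_distrib_left mult.assoc)
  then show ?thesis by (simp add: matrix_product_entry[OF inverse_R])
qed

lemma trace_under: "(\<Sum>e\<in>UNIV. \<Sum>g\<in>UNIV. D e * matrix_inv Rd $ (e, j) $ (g, d) * matrix_inv R' $ (e, g) $ p)
    = (if (j, d) = p then D d else 0)"
proof -
  have "(\<Sum>e\<in>UNIV. \<Sum>g\<in>UNIV. D e * matrix_inv Rd $ (e, j) $ (g, d) * matrix_inv R' $ (e, g) $ p)
      = D d * (\<Sum>e\<in>UNIV. \<Sum>g\<in>UNIV. R' $ (j, d) $ (e, g) * matrix_inv R' $ (e, g) $ p)"
    by (simp add: trace_Rd[symmetric] sum_distrib_left mult.assoc)
  then show ?thesis by (simp add: matrix_product_entry[OF inverse_R'(1)])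
qed

lemma snake_over: "(\<Sum>y\<in>UNIV. \<Sum>a\<in>UNIV. R $ (y, u) $ (a, e) * R' $ (y, a) $ p) = (if (u, e) = p then 1 else 0)"
  by (simp add: snake_R'[symmetric] matrix_product_entry[OF inverse_R'(2)])

lemma snake_under: "(\<Sum>e\<in>UNIV. \<Sum>b\<in>UNIV. matrix_inv R' $ (e, g) $ (b, c) * matrix_inv Rd $ (e, b) $ p)
    = (if (g, c) = p then 1 else 0)"
  by (simp add: snake_R' snake_Rd[symmetric] matrix_product_entry[OF inverse_Rd])

lemma contract_inverse:
  fixes X :: "'n list \<Rightarrow> 'x::ab_group_add"
  assumes "module sc"
  shows "(\<Sum>e\<in>UNIV. sc (D e) (leg_map sc (matrix_inv R') 2 X [i, e, e, j])) = sc C (\<Sum>b\<in>UNIV. X [i, b, b, j])"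
proof -
  interpret module sc by fact
  have "(\<Sum>e\<in>UNIV. sc (D e) (leg_map sc (matrix_inv R') 2 X [i, e, e, j]))
    = (\<Sum>e\<in>UNIV. \<Sum>p\<in>UNIV. sc (D e * matrix_inv R' $ (e, e) $ p) (X [i, fst p, snd p, j]))"
    unfolding leg_map_4 by (simp add: scale_sum_right)
  also have "\<dots> = (\<Sum>p\<in>UNIV. sc (\<Sum>e\<in>UNIV. D e * matrix_inv R' $ (e, e) $ p) (X [i, fst p, snd p, j]))"
    by (subst sum.swap) (simp add: scale_sum_left)
  also have "\<dots> = (\<Sum>b\<in>UNIV. \<Sum>c\<in>UNIV. sc (if c = b then C else 0) (X [i, b, c, j]))"
    unfolding sum_pair_UNIV twist by (simp add: eq_commute)
  finally show ?thesis by (simp add: scale_sum_if scale_sum_right)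
qed

text \<open>If a family is an eigenvector of \<open>S\<^bsub>123\<^esub>\<close>, contract legs 1 and 2 by \<open>E'\<close>. The cap absorbs the two
  outer braidings, leaving \<open>E'\<close> after an inverse braiding, which is a multiple of \<open>E\<close> on legs 2 and 3.\<close>

lemma contract_over_eigenfamily:
  fixes X :: "'n list \<Rightarrow> 'x::ab_group_add"
  assumes "module sc"
    and eig: "\<And>x y z w. leg_map sc R' 2 (leg_map sc R 1 (leg_map sc (matrix_inv R') 2 X)) [x, y, z, w]
         = sc \<mu> (X [x, y, z, w])"
  shows "sc \<mu> (\<Sum>x\<in>UNIV. sc (D x) (X [x, x, i, j])) = sc C (\<Sum>b\<in>UNIV. X [i, b, b, j])"
proof -
  interpret module sc by fact
  define Y where "Y = leg_map sc (matrix_inv R') 2 X"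
  have "sc \<mu> (\<Sum>x\<in>UNIV. sc (D x) (X [x, x, i, j]))
      = (\<Sum>x\<in>UNIV. sc (D x) (leg_map sc R' 2 (leg_map sc R 1 Y) [x, x, i, j]))"
    unfolding Y_def eig by (simp add: scale_sum_right mult.commute)
  also have "\<dots> = (\<Sum>x\<in>UNIV. \<Sum>u\<in>UNIV. \<Sum>v\<in>UNIV. \<Sum>p\<in>UNIV.
      sc (D x * R' $ (x, i) $ (u, v) * R $ (x, u) $ p) (Y [fst p, snd p, v, j]))"
    unfolding leg_map_4 by (simp add: scale_sum_right mult.assoc sum_pair_UNIV)
  also have "\<dots> = (\<Sum>v\<in>UNIV. \<Sum>p\<in>UNIV. \<Sum>x\<in>UNIV. \<Sum>u\<in>UNIV.
      sc (D x * R' $ (x, i) $ (u, v) * R $ (x, u) $ p) (Y [fst p, snd p, v, j]))"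
    unfolding sum.cartesian_product
    by (rule sum.reindex_bij_witness[of _ "\<lambda>(v, p, x, u). (x, u, v, p)" "\<lambda>(x, u, v, p). (v, p, x, u)"]) auto
  also have "\<dots> = (\<Sum>v\<in>UNIV. \<Sum>p\<in>UNIV. sc (if p = (i, v) then D v else 0) (Y [fst p, snd p, v, j]))"
    unfolding scale_sum_left[symmetric] trace_over by (simp add: eq_commute)
  also have "\<dots> = (\<Sum>v\<in>UNIV. sc (D v) (Y [i, v, v, j]))"
    by (simp add: scale_sum_if)
  finally show ?thesis unfolding Y_def contract_inverse[OF assms(1)] .
qed

text \<open>The same for an eigenvector of the conjugate operator and the cap \<open>E'\<close> on legs 3 and 4. Here pulling
  the cap through the outer braiding does not cancel \<open>Rd\<^sup>-\<^sup>1\<close> but repeats it; since the family is an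
  eigenvector of \<open>Rd\<^sup>-\<^sup>1\<close> after the inner braiding, this contributes one more factor \<open>\<mu>\<close>.\<close>

lemma contract_under_eigenfamily:
  fixes X :: "'n list \<Rightarrow> 'x::ab_group_add"
  assumes "module sc"
    and eig: "\<And>x y z w. leg_map sc R' 2 (leg_map sc (matrix_inv Rd) 3 (leg_map sc (matrix_inv R') 2 X)) [x, y, z, w]
         = sc \<mu> (X [x, y, z, w])"
  shows "sc \<mu> (\<Sum>x\<in>UNIV. sc (D x) (X [i, j, x, x])) = sc (\<mu> * \<mu> * C) (\<Sum>b\<in>UNIV. X [i, b, b, j])"
proof -
  interpret module sc by fact
  define Y where "Y = leg_map sc (matrix_inv R') 2 X"
  define W where "W = leg_map sc (matrix_inv Rd) 3 Y"
  have W: "W [x, y, z, w] = sc \<mu> (Y [x, y, z, w])" for x y z w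
  proof -
    have "W [x, y, z, w] = leg_map sc (matrix_inv R') 2 (leg_map sc R' 2 W) [x, y, z, w]"
      by (simp add: leg_map_2_compose[OF assms(1)] inverse_R' leg_map_2_id[OF assms(1)])
    also have "\<dots> = leg_map sc (matrix_inv R') 2 (\<lambda>l. sc \<mu> (X l)) [x, y, z, w]"
      unfolding leg_map_4(2)[of sc "matrix_inv R'"] W_def Y_def eig ..
    also have "\<dots> = sc \<mu> (Y [x, y, z, w])"
      unfolding Y_def leg_map_4 by (simp add: scale_sum_right mult.commute)
    finally show ?thesis .
  qed
  have "sc \<mu> (\<Sum>x\<in>UNIV. sc (D x) (X [i, j, x, x]))
      = (\<Sum>x\<in>UNIV. sc (D x) (leg_map sc R' 2 W [i, j, x, x]))"
    unfolding W_def Y_def eig by (simp add: scale_sum_right mult.commute)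
  also have "\<dots> = (\<Sum>x\<in>UNIV. \<Sum>u\<in>UNIV. \<Sum>v\<in>UNIV. sc (D x * R' $ (j, x) $ (u, v)) (W [i, u, v, x]))"
    unfolding leg_map_4 sum_pair_UNIV by (simp add: scale_sum_right)
  also have "\<dots> = (\<Sum>x\<in>UNIV. \<Sum>u\<in>UNIV. \<Sum>v\<in>UNIV. sc (D u * matrix_inv Rd $ (u, j) $ (v, x)) (W [i, u, v, x]))"
    unfolding trace_Rd ..
  also have "\<dots> = (\<Sum>u\<in>UNIV. \<Sum>v\<in>UNIV. \<Sum>x\<in>UNIV. sc (D u * matrix_inv Rd $ (u, j) $ (v, x)) (W [i, u, v, x]))"
    unfolding sum.cartesian_product
    by (rule sum.reindex_bij_witness[of _ "\<lambda>(u, v, x). (x, u, v)" "\<lambda>(x, u, v). (u, v, x)"]) auto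
  also have "\<dots> = (\<Sum>u\<in>UNIV. sc (D u) (leg_map sc (matrix_inv Rd) 3 W [i, u, u, j]))"
    unfolding leg_map_4 sum_pair_UNIV by (simp add: scale_sum_right)
  also have "\<dots> = (\<Sum>u\<in>UNIV. sc (D u) (sc \<mu> (W [i, u, u, j])))"
  proof (intro sum.cong refl arg_cong[of _ _ "sc _"])
    fix u
    have "leg_map sc (matrix_inv Rd) 3 W [i, u, u, j] = sc \<mu> (leg_map sc (matrix_inv Rd) 3 Y [i, u, u, j])"
      unfolding leg_map_4 W by (simp add: scale_sum_right mult.commute)
    then show "leg_map sc (matrix_inv Rd) 3 W [i, u, u, j] = sc \<mu> (W [i, u, u, j])"
      by (simp add: W_def)
  qed
  also have "\<dots> = sc (\<mu> * \<mu>) (\<Sum>u\<in>UNIV. sc (D u) (Y [i, u, u, j]))"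
    by (simp add: W scale_sum_right mult_ac)
  finally show ?thesis unfolding Y_def contract_inverse[OF assms(1)] by simp
qed

text \<open>The matrix entries of \<open>T\<^bsub>1234\<^esub>\<close>, which carries a pair of legs \<open>V \<otimes> V\<^sup>*\<close> past another such pair, factor
  into the passage of the \<open>V\<close> leg over the other pair and of the \<open>V\<^sup>*\<close> leg under it.\<close>

definition over_coeff where
  "over_coeff x y i a e v = (\<Sum>u\<in>UNIV. R' $ (y, i) $ (u, v) * R $ (x, u) $ (a, e))"
definition under_coeff where
  "under_coeff e v j b c d = (\<Sum>g\<in>UNIV. matrix_inv Rd $ (v, j) $ (g, d) * matrix_inv R' $ (e, g) $ (b, c))"
definition swap_coeff :: "'n \<times> 'n \<Rightarrow> 'n \<times> 'n \<Rightarrow> 'n \<times> 'n \<Rightarrow> 'n \<times> 'n \<Rightarrow> complex" where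
  "swap_coeff u w s t = (\<Sum>e\<in>UNIV. \<Sum>v\<in>UNIV. over_coeff (fst u) (snd u) (fst w) (fst s) e v *
      under_coeff e v (snd w) (snd s) (fst t) (snd t))"

text \<open>Passing two pairs in succession and then capping their adjacent legs by \<open>E\<close> equals passing the
  capped pair: the strand slides off the cap.\<close>

lemma over_coeff_compose:
  "(\<Sum>y\<in>UNIV. \<Sum>a\<in>UNIV. over_coeff y z i a e v * over_coeff x y a a' e' v') =
     (if v' = e then over_coeff x z i a' e' v else 0)"
proof -
  have "(\<Sum>y\<in>UNIV. \<Sum>a\<in>UNIV. over_coeff y z i a e v * over_coeff x y a a' e' v') =
    (\<Sum>y\<in>UNIV. \<Sum>a\<in>UNIV. \<Sum>u\<in>UNIV. \<Sum>u'\<in>UNIV. R' $ (z, i) $ (u, v) * R $ (x, u') $ (a', e') *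
        (R $ (y, u) $ (a, e) * R' $ (y, a) $ (u', v')))"
    unfolding over_coeff_def sum_product by (simp add: mult_ac)
  also have "\<dots> = (\<Sum>u\<in>UNIV. \<Sum>u'\<in>UNIV. \<Sum>y\<in>UNIV. \<Sum>a\<in>UNIV. R' $ (z, i) $ (u, v) * R $ (x, u') $ (a', e') *
        (R $ (y, u) $ (a, e) * R' $ (y, a) $ (u', v')))"
    unfolding sum.cartesian_product
    by (rule sum.reindex_bij_witness[of _ "\<lambda>(u, u', y, a). (y, a, u, u')" "\<lambda>(y, a, u, u'). (u, u', y, a)"]) auto
  also have "\<dots> = (\<Sum>u\<in>UNIV. \<Sum>u'\<in>UNIV. R' $ (z, i) $ (u, v) * R $ (x, u') $ (a', e') *
        (if (u, e) = (u', v') then 1 else 0))"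
    unfolding sum_distrib_left[symmetric] snake_over ..
  also have "\<dots> = (\<Sum>u\<in>UNIV. \<Sum>u'\<in>UNIV. if u' = u then
       (if v' = e then R' $ (z, i) $ (u, v) * R $ (x, u) $ (a', e') else 0) else 0)"
    by (intro sum.cong refl) auto
  also have "\<dots> = (if v' = e then over_coeff x z i a' e' v else 0)"
    by (simp add: over_coeff_def)
  finally show ?thesis .
qed

lemma under_coeff_compose:
  "(\<Sum>e\<in>UNIV. \<Sum>b\<in>UNIV. under_coeff e v j b c d * under_coeff e' e b b' c' d') =
     (if d' = c then under_coeff e' v j b' c' d else 0)"
proof -
  have "(\<Sum>e\<in>UNIV. \<Sum>b\<in>UNIV. under_coeff e v j b c d * under_coeff e' e b b' c' d') =
    (\<Sum>e\<in>UNIV. \<Sum>b\<in>UNIV. \<Sum>g\<in>UNIV. \<Sum>g'\<in>UNIV. matrix_inv Rd $ (v, j) $ (g, d) * matrix_inv R' $ (e', g') $ (b', c') *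
        (matrix_inv R' $ (e, g) $ (b, c) * matrix_inv Rd $ (e, b) $ (g', d')))"
    unfolding under_coeff_def sum_product by (simp add: mult_ac)
  also have "\<dots> = (\<Sum>g\<in>UNIV. \<Sum>g'\<in>UNIV. \<Sum>e\<in>UNIV. \<Sum>b\<in>UNIV. matrix_inv Rd $ (v, j) $ (g, d) * matrix_inv R' $ (e', g') $ (b', c') *
        (matrix_inv R' $ (e, g) $ (b, c) * matrix_inv Rd $ (e, b) $ (g', d')))"
    unfolding sum.cartesian_product
    by (rule sum.reindex_bij_witness[of _ "\<lambda>(u, u', y, a). (y, a, u, u')" "\<lambda>(y, a, u, u'). (u, u', y, a)"]) auto
  also have "\<dots> = (\<Sum>g\<in>UNIV. \<Sum>g'\<in>UNIV. matrix_inv Rd $ (v, j) $ (g, d) * matrix_inv R' $ (e', g') $ (b', c') *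
        (if (g, c) = (g', d') then 1 else 0))"
    unfolding sum_distrib_left[symmetric] snake_under ..
  also have "\<dots> = (\<Sum>g\<in>UNIV. \<Sum>g'\<in>UNIV. if g' = g then
       (if d' = c then matrix_inv Rd $ (v, j) $ (g, d) * matrix_inv R' $ (e', g) $ (b', c') else 0) else 0)"
    by (intro sum.cong refl) auto
  also have "\<dots> = (if d' = c then under_coeff e' v j b' c' d else 0)"
    by (simp add: under_coeff_def)
  finally show ?thesis .
qed

text \<open>First the over strand and then the under strand slides off the cap. This is what lets \<open>p\<close> pass a
  matrix product of families as if it were a single family.\<close>

lemma swap_coeff_compose:
  "(\<Sum>y\<in>UNIV. \<Sum>s\<in>UNIV. swap_coeff (y, z) w s (c, d) * swap_coeff (x, y) s s' (c', d')) =
     (if d' = c then swap_coeff (x, z) w s' (c', d) else 0)"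
proof -
  obtain i j a' b' where w: "w = (i, j)" "s' = (a', b')" by (cases w; cases s')
  let ?A = over_coeff and ?B = under_coeff
  have "(\<Sum>y\<in>UNIV. \<Sum>s\<in>UNIV. swap_coeff (y, z) w s (c, d) * swap_coeff (x, y) s s' (c', d')) =
    (\<Sum>y\<in>UNIV. \<Sum>a\<in>UNIV. \<Sum>b\<in>UNIV. (\<Sum>e\<in>UNIV. \<Sum>v\<in>UNIV. ?A y z i a e v * ?B e v j b c d) *
       (\<Sum>e'\<in>UNIV. \<Sum>v'\<in>UNIV. ?A x y a a' e' v' * ?B e' v' b b' c' d'))"
    by (simp add: sum_pair_UNIV swap_coeff_def w)
  also have "\<dots> = (\<Sum>y\<in>UNIV. \<Sum>a\<in>UNIV. \<Sum>b\<in>UNIV. \<Sum>e\<in>UNIV. \<Sum>e'\<in>UNIV. \<Sum>v\<in>UNIV. \<Sum>v'\<in>UNIV.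
       (?A y z i a e v * ?A x y a a' e' v') * (?B e v j b c d * ?B e' v' b b' c' d'))"
    unfolding sum_product by (simp add: mult_ac)
  also have "\<dots> = (\<Sum>v\<in>UNIV. \<Sum>e'\<in>UNIV. \<Sum>e\<in>UNIV. \<Sum>b\<in>UNIV. \<Sum>v'\<in>UNIV. \<Sum>y\<in>UNIV. \<Sum>a\<in>UNIV.
       (?A y z i a e v * ?A x y a a' e' v') * (?B e v j b c d * ?B e' v' b b' c' d'))"
    unfolding sum.cartesian_product
    by (rule sum.reindex_bij_witness[of _ "\<lambda>(v, e', e, b, v', y, a). (y, a, b, e, e', v, v')"
          "\<lambda>(y, a, b, e, e', v, v'). (v, e', e, b, v', y, a)"]) auto
  also have "\<dots> = (\<Sum>v\<in>UNIV. \<Sum>e'\<in>UNIV. \<Sum>e\<in>UNIV. \<Sum>b\<in>UNIV. \<Sum>v'\<in>UNIV.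
       (if v' = e then ?A x z i a' e' v else 0) * (?B e v j b c d * ?B e' v' b b' c' d'))"
    unfolding sum_distrib_right[symmetric] over_coeff_compose ..
  also have "\<dots> = (\<Sum>v\<in>UNIV. \<Sum>e'\<in>UNIV. \<Sum>e\<in>UNIV. \<Sum>b\<in>UNIV. \<Sum>v'\<in>UNIV.
       if v' = e then ?A x z i a' e' v * (?B e v j b c d * ?B e' e b b' c' d') else 0)"
    by (intro sum.cong refl) auto
  also have "\<dots> = (\<Sum>v\<in>UNIV. \<Sum>e'\<in>UNIV. \<Sum>e\<in>UNIV. \<Sum>b\<in>UNIV.
       ?A x z i a' e' v * (?B e v j b c d * ?B e' e b b' c' d'))"
    by simp
  also have "\<dots> = (\<Sum>v\<in>UNIV. \<Sum>e'\<in>UNIV. ?A x z i a' e' v * (if d' = c then ?B e' v j b' c' d else 0))"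
    unfolding sum_distrib_left[symmetric] under_coeff_compose ..
  also have "\<dots> = (if d' = c then \<Sum>e'\<in>UNIV. \<Sum>v\<in>UNIV. ?A x z i a' e' v * ?B e' v j b' c' d else 0)"
    by (cases "d' = c") (simp_all add: sum.swap[of "\<lambda>v e'. ?A x z i a' e' v * ?B e' v j b' c' d"])
  finally show ?thesis unfolding w swap_coeff_def by simp
qed

text \<open>Both strands slide off the cap \<open>E'\<close> as well, so a pair of legs carried past a traced pair comes out
  unchanged.\<close>

lemma swap_coeff_trace:
  "(\<Sum>x\<in>UNIV. D x * swap_coeff (x, x) w s t) = (if s = w \<and> fst t = snd t then D (snd t) else 0)"
proof -
  obtain i j a b c d where w: "w = (i, j)" "s = (a, b)" "t = (c, d)" by (cases w; cases s; cases t)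
  have "(\<Sum>x\<in>UNIV. D x * swap_coeff (x, x) w s t)
    = (\<Sum>x\<in>UNIV. \<Sum>e\<in>UNIV. \<Sum>v\<in>UNIV. \<Sum>u\<in>UNIV. D x * R' $ (x, i) $ (u, v) * R $ (x, u) $ (a, e) * under_coeff e v j b c d)"
    by (simp add: swap_coeff_def w over_coeff_def sum_distrib_left sum_distrib_right mult.assoc)
  also have "\<dots> = (\<Sum>e\<in>UNIV. \<Sum>v\<in>UNIV. \<Sum>x\<in>UNIV. \<Sum>u\<in>UNIV. D x * R' $ (x, i) $ (u, v) * R $ (x, u) $ (a, e) * under_coeff e v j b c d)"
    unfolding sum.cartesian_product
    by (rule sum.reindex_bij_witness[of _ "\<lambda>(e, v, x, u). (x, e, v, u)" "\<lambda>(x, e, v, u). (e, v, x, u)"]) auto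
  also have "\<dots> = (\<Sum>e\<in>UNIV. \<Sum>v\<in>UNIV. (if (i, v) = (a, e) then D v else 0) * under_coeff e v j b c d)"
    unfolding sum_distrib_right[symmetric] trace_over ..
  also have "\<dots> = (\<Sum>e\<in>UNIV. \<Sum>v\<in>UNIV. if v = e then (if a = i then D e * under_coeff e e j b c d else 0) else 0)"
    by (intro sum.cong refl) auto
  also have "\<dots> = (if a = i then \<Sum>e\<in>UNIV. D e * under_coeff e e j b c d else 0)"
    by simp
  also have "(\<Sum>e\<in>UNIV. D e * under_coeff e e j b c d)
      = (\<Sum>e\<in>UNIV. \<Sum>g\<in>UNIV. D e * matrix_inv Rd $ (e, j) $ (g, d) * matrix_inv R' $ (e, g) $ (b, c))"
    by (simp add: under_coeff_def sum_distrib_left mult.assoc)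
  also have "\<dots> = (if (j, d) = (b, c) then D d else 0)"
    by (rule trace_under)
  finally show ?thesis by (auto simp: w)
qed

text \<open>In the composition of the two factors of \<open>T\<^bsub>1234\<^esub>\<close> the adjacent mixed braidings cancel.\<close>

lemma leg_maps_swap_coeff:
  fixes X :: "'n list \<Rightarrow> 'x::ab_group_add"
  assumes "module sc"
  shows "leg_map sc R' 2 (leg_map sc R 1 (leg_map sc (matrix_inv R') 2
          (leg_map sc R' 2 (leg_map sc (matrix_inv Rd) 3 (leg_map sc (matrix_inv R') 2 X))))) [x, y, i, j]
     = (\<Sum>s\<in>UNIV. \<Sum>t\<in>UNIV. sc (swap_coeff (x, y) (i, j) s t) (X [fst s, snd s, fst t, snd t]))"
proof -
  interpret module sc by fact
  define Y where "Y = leg_map sc (matrix_inv Rd) 3 (leg_map sc (matrix_inv R') 2 X)"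
  have "leg_map sc R' 2 (leg_map sc R 1 (leg_map sc (matrix_inv R') 2 (leg_map sc R' 2 Y))) [x, y, i, j]
     = (\<Sum>u\<in>UNIV. \<Sum>v\<in>UNIV. \<Sum>a\<in>UNIV. \<Sum>e\<in>UNIV. sc (R' $ (y, i) $ (u, v) * R $ (x, u) $ (a, e)) (Y [a, e, v, j]))"
    unfolding leg_map_4(2)[of sc R' "leg_map sc R 1 _"] leg_map_4(1) sum_pair_UNIV
    by (simp add: leg_map_2_compose[OF assms] inverse_R' leg_map_2_id[OF assms] scale_sum_right)
  also have "\<dots> = (\<Sum>u\<in>UNIV. \<Sum>v\<in>UNIV. \<Sum>a\<in>UNIV. \<Sum>e\<in>UNIV. \<Sum>g\<in>UNIV. \<Sum>d\<in>UNIV. \<Sum>b\<in>UNIV. \<Sum>c\<in>UNIV.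
       sc (R' $ (y, i) $ (u, v) * R $ (x, u) $ (a, e) * (matrix_inv Rd $ (v, j) $ (g, d) * matrix_inv R' $ (e, g) $ (b, c)))
          (X [a, b, c, d]))"
    unfolding Y_def leg_map_4 sum_pair_UNIV by (simp add: scale_sum_right)
  also have "\<dots> = (\<Sum>a\<in>UNIV. \<Sum>b\<in>UNIV. \<Sum>c\<in>UNIV. \<Sum>d\<in>UNIV. \<Sum>e\<in>UNIV. \<Sum>v\<in>UNIV. \<Sum>u\<in>UNIV. \<Sum>g\<in>UNIV.
       sc (R' $ (y, i) $ (u, v) * R $ (x, u) $ (a, e) * (matrix_inv Rd $ (v, j) $ (g, d) * matrix_inv R' $ (e, g) $ (b, c)))
          (X [a, b, c, d]))"
    unfolding sum.cartesian_product
    by (rule sum.reindex_bij_witness[of _ "\<lambda>(a, b, c, d, e, v, u, g). (u, v, a, e, g, d, b, c)"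
          "\<lambda>(u, v, a, e, g, d, b, c). (a, b, c, d, e, v, u, g)"]) auto
  also have "\<dots> = (\<Sum>a\<in>UNIV. \<Sum>b\<in>UNIV. \<Sum>c\<in>UNIV. \<Sum>d\<in>UNIV. sc (swap_coeff (x, y) (i, j) (a, b) (c, d)) (X [a, b, c, d]))"
    unfolding swap_coeff_def over_coeff_def under_coeff_def sum_product scale_sum_left by simp
  finally show ?thesis unfolding Y_def by (simp add: sum_pair_UNIV)
qed

end

section \<open>Universal property of tensor products\<close>

lemma poly_mapping_add_induct [case_names zero single add]:
  fixes f :: "'a \<Rightarrow>\<^sub>0 'b::monoid_add"
  assumes "P 0" and "\<And>a b. P (Poly_Mapping.single a b)" and "\<And>f g. P f \<Longrightarrow> P g \<Longrightarrow> P (f + g)"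
  shows "P f"
proof (induction f rule: update_induct)
  case const
  show ?case by (rule assms)
next
  case (update f a b)
  have "Poly_Mapping.update a b f = f + Poly_Mapping.single a b"
    using update(1) by (intro poly_mapping_eqI) (auto simp: lookup_update lookup_add lookup_single in_keys_iff)
  then show ?case using update(3) assms(2,3) by simp
qed

definition additive_map :: "('a::ab_group_add \<Rightarrow> 'b::ab_group_add) \<Rightarrow> bool" where
  "additive_map f \<longleftrightarrow> (\<forall>x y. f (x + y) = f x + f y)"

lemma additive_map_simps:
  assumes "additive_map f"
  shows "f (x + y) = f x + f y" "f 0 = 0" "f (- x) = - f x" "f (x - y) = f x - f y"
    "f (sum g I) = (\<Sum>i\<in>I. f (g i))"
proof -
  interpret additive f using assms by unfold_locales (simp add: additive_map_def)
  show "f (x + y) = f x + f y" "f 0 = 0" "f (- x) = - f x" "f (x - y) = f x - f y"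
    "f (sum g I) = (\<Sum>i\<in>I. f (g i))"
    by (simp_all add: add zero minus diff sum)
qed

definition int_multiple :: "int \<Rightarrow> 'a::ab_group_add \<Rightarrow> 'a" where
  "int_multiple n x = (\<Sum>i\<in>{0..<n}. x) - (\<Sum>i\<in>{n..<0}. x)"

lemma int_multiple_add: "int_multiple (m + n) x = int_multiple m x + int_multiple n x"
proof -
  have succ: "int_multiple (n + 1) x = int_multiple n x + x" for n
  proof (cases "0 \<le> n")
    case True
    then have "{0..<n + 1} = insert n {0..<n}" "{n + 1..<0} = {}" "{n..<0} = {}" by auto
    then show ?thesis by (simp add: int_multiple_def add.commute)
  next
    case False
    then have "{n..<0} = insert n {n + 1..<0}" "{0..<n + 1} = {}" "{0..<n} = {}" by auto
    then show ?thesis by (simp add: int_multiple_def)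
  qed
  show ?thesis
  proof (induction n rule: int_induct[where k = 0])
    case base
    show ?case by (simp add: int_multiple_def)
  next
    case (step1 i)
    then show ?case using succ[of "m + i"] succ[of i] by (simp add: add.assoc)
  next
    case (step2 i)
    then show ?case using succ[of "m + (i - 1)"] succ[of "i - 1"] by (simp add: algebra_simps)
  qed
qed

lemma int_multiple_0 [simp]: "int_multiple 0 x = 0" and int_multiple_1 [simp]: "int_multiple 1 x = x"
proof -
  show "int_multiple 0 x = 0" by (simp add: int_multiple_def)
  have "{0..<1::int} = {0}" by auto
  then show "int_multiple 1 x = x" by (simp add: int_multiple_def)
qed

text \<open>The universal property of the free abelian group on a type.\<close>

lemma free_abelian_group_extension:
  fixes b :: "'a \<Rightarrow> 'z::ab_group_add"
  obtains g :: "('a \<Rightarrow>\<^sub>0 int) \<Rightarrow> 'z" where "additive_map g" "\<And>x. g (Poly_Mapping.single x 1) = b x"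
proof
  let ?g = "\<lambda>w. \<Sum>k\<in>Poly_Mapping.keys w. int_multiple (Poly_Mapping.lookup w k) (b k)"
  have ext: "?g w = (\<Sum>k\<in>K. int_multiple (Poly_Mapping.lookup w k) (b k))"
    if "finite K" "Poly_Mapping.keys w \<subseteq> K" for w K
    using that by (intro sum.mono_neutral_left) (auto simp: in_keys_iff)
  show "additive_map ?g"
    unfolding additive_map_def
  proof (intro allI)
    fix v w :: "'a \<Rightarrow>\<^sub>0 int"
    let ?K = "Poly_Mapping.keys v \<union> Poly_Mapping.keys w"
    have "?g (v + w) = (\<Sum>k\<in>?K. int_multiple (Poly_Mapping.lookup (v + w) k) (b k))"
      using Poly_Mapping.keys_add[of v w] by (intro ext) auto
    also have "\<dots> = ?g v + ?g w"
      by (simp add: ext[of ?K v] ext[of ?K w] lookup_add int_multiple_add sum.distrib)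
    finally show "?g (v + w) = ?g v + ?g w" .
  qed
  show "?g (Poly_Mapping.single x 1) = b x" for x by simp
qed

definition balanced_map where
  "balanced_map M N \<beta> \<longleftrightarrow> (\<forall>x x' y. \<beta> (x + x') y = \<beta> x y + \<beta> x' y) \<and>
     (\<forall>x y y'. \<beta> x (y + y') = \<beta> x y + \<beta> x y') \<and> (\<forall>x b y. \<beta> (ract M x b) y = \<beta> x (lact N b y))"

lemma balanced_map_additive:
  assumes "balanced_map M N \<beta>"
  shows "additive_map (\<beta> x)" "additive_map (\<lambda>x. \<beta> x y)" "\<beta> (ract M x b) y = \<beta> x (lact N b y)"
  using assms by (auto simp: balanced_map_def additive_map_def)

lemma tensor_product_balanced:
  fixes M :: "('r::ring_1, 'a::ab_group_add) bimod" and N :: "('r, 'b::ab_group_add) bimod"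
    and T :: "('r, 'c::ab_group_add) bimod" and t :: "'a \<Rightarrow> 'b \<Rightarrow> 'c"
  assumes "tensor_product \<iota> M N T t"
  shows "balanced_map M N t"
proof -
  let ?e = "\<lambda>x y. Poly_Mapping.single (x, y) (1::int)"
  obtain \<pi> :: "(('a \<times> 'b) \<Rightarrow>\<^sub>0 int) \<Rightarrow> 'c" where "\<forall>x y. \<pi> (x + y) = \<pi> x + \<pi> y"
    and e: "\<And>x y. \<pi> (?e x y) = t x y" and ker: "{z. \<pi> z = 0} = subgroup_hull (tensor_relators M N)"
    using assms by (auto simp: tensor_product_def)
  then have add: "additive_map \<pi>" by (simp add: additive_map_def)
  have rel: "\<pi> z = 0" if "z \<in> tensor_relators M N" for z
    using ker subgroup_hull.base[OF that] by blast
  show ?thesis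
    unfolding balanced_map_def
  proof (intro conjI allI)
    fix x x' y
    have "?e (x + x') y - ?e x y - ?e x' y \<in> tensor_relators M N"
      unfolding tensor_relators_def Let_def by blast
    from rel[OF this] show "t (x + x') y = t x y + t x' y"
      by (simp add: additive_map_simps[OF add] e algebra_simps)
  next
    fix x y y'
    have "?e x (y + y') - ?e x y - ?e x y' \<in> tensor_relators M N"
      unfolding tensor_relators_def Let_def by blast
    from rel[OF this] show "t x (y + y') = t x y + t x y'"
      by (simp add: additive_map_simps[OF add] e algebra_simps)
  next
    fix x b y
    have "?e (ract M x b) y - ?e x (lact N b y) \<in> tensor_relators M N"
      unfolding tensor_relators_def Let_def by blast
    from rel[OF this] show "t (ract M x b) y = t x (lact N b y)"
      by (simp add: additive_map_simps[OF add] e)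
  qed
qed

text \<open>Closure under sums suffices, since \<open>- (x \<otimes> y) = (- x) \<otimes> y\<close>.\<close>

lemma tensor_product_induct [consumes 1, case_names tensor add]:
  fixes M :: "('r::ring_1, 'a::ab_group_add) bimod" and N :: "('r, 'b::ab_group_add) bimod"
    and T :: "('r, 'c::ab_group_add) bimod" and t :: "'a \<Rightarrow> 'b \<Rightarrow> 'c"
  assumes T: "tensor_product \<iota> M N T t"
    and tensor: "\<And>x y. P (t x y)" and add: "\<And>z z'. P z \<Longrightarrow> P z' \<Longrightarrow> P (z + z')"
  shows "P z"
proof -
  note bal = balanced_map_additive[OF tensor_product_balanced[OF T]]
  obtain \<pi> :: "(('a \<times> 'b) \<Rightarrow>\<^sub>0 int) \<Rightarrow> 'c" where "\<forall>x y. \<pi> (x + y) = \<pi> x + \<pi> y"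
    and e: "\<And>x y. \<pi> (Poly_Mapping.single (x, y) 1) = t x y" and surj: "surj \<pi>"
    using T by (auto simp: tensor_product_def)
  then have \<pi>: "additive_map \<pi>" by (simp add: additive_map_def)
  obtain w where z: "z = \<pi> w" using surj by (metis surjD)
  have "P (\<pi> w) \<and> P (- \<pi> w)"
    using subset_UNIV[of "Poly_Mapping.keys w"]
  proof (induction w rule: frag_induction)
    case zero
    have "P (t 0 0)" by (rule tensor)
    then show ?case by (simp add: additive_map_simps[OF \<pi>] additive_map_simps(2)[OF bal(1)])
  next
    case (one p)
    have "- t x y = t (- x) y" for x y using additive_map_simps(3)[OF bal(2)] by simp
    then show ?case using tensor by (cases p) (simp add: e)
  next
    case (diff a b)
    then have "P (\<pi> a + - \<pi> b)" "P (\<pi> b + - \<pi> a)" using add by blast+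
    then show ?case by (simp add: additive_map_simps[OF \<pi>])
  qed
  then show ?thesis using z by simp
qed

text \<open>The additive extension of a balanced map to the free abelian group kills the relators, hence
  descends; it is unique because elementary tensors generate.\<close>

lemma tensor_lift_universal:
  fixes M :: "('r::ring_1, 'a::ab_group_add) bimod" and N :: "('r, 'b::ab_group_add) bimod"
    and T :: "('r, 'c::ab_group_add) bimod" and t :: "'a \<Rightarrow> 'b \<Rightarrow> 'c"
    and \<beta> :: "'a \<Rightarrow> 'b \<Rightarrow> 'z::ab_group_add"
  assumes T: "tensor_product \<iota> M N T t" and \<beta>: "balanced_map M N \<beta>"
  shows "additive_map (tensor_lift t \<beta>)" "tensor_lift t \<beta> (t x y) = \<beta> x y"
proof -
  obtain \<pi> :: "(('a \<times> 'b) \<Rightarrow>\<^sub>0 int) \<Rightarrow> 'c" where "\<forall>x y. \<pi> (x + y) = \<pi> x + \<pi> y"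
    and e: "\<And>x y. \<pi> (Poly_Mapping.single (x, y) 1) = t x y" and surj: "surj \<pi>"
    and ker: "{z. \<pi> z = 0} = subgroup_hull (tensor_relators M N)"
    using T by (auto simp: tensor_product_def)
  then have \<pi>: "additive_map \<pi>" by (simp add: additive_map_def)
  obtain g :: "(('a \<times> 'b) \<Rightarrow>\<^sub>0 int) \<Rightarrow> 'z" where g: "additive_map g" and ge: "\<And>p. g (Poly_Mapping.single p 1) = (case p of (x, y) \<Rightarrow> \<beta> x y)"
    by (rule free_abelian_group_extension[of "\<lambda>p. case p of (x, y) \<Rightarrow> \<beta> x y"]) (rule that)
  note bal = balanced_map_additive[OF \<beta>]
  have "g w = 0" if "w \<in> subgroup_hull (tensor_relators M N)" for w
    using that
  proof induction
    case (base w)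
    then show ?case
      unfolding tensor_relators_def Let_def
      by (auto simp: additive_map_simps[OF g] ge additive_map_simps(1)[OF bal(1)]
          additive_map_simps(1)[OF bal(2)] bal(3))
  qed (simp_all add: additive_map_simps[OF g])
  then have kernel: "g w = g w'" if "\<pi> w = \<pi> w'" for w w'
  proof -
    have "w - w' \<in> subgroup_hull (tensor_relators M N)"
      unfolding ker[symmetric] mem_Collect_eq using that by (simp add: additive_map_simps[OF \<pi>])
    then have "g (w - w') = 0" by (rule \<open>\<And>w. w \<in> subgroup_hull (tensor_relators M N) \<Longrightarrow> g w = 0\<close>)
    then show ?thesis by (simp add: additive_map_simps[OF g])
  qed
  define f where "f z = g (inv \<pi> z)" for z
  have f: "f (\<pi> w) = g w" for w
    unfolding f_def by (rule kernel) (simp add: surj_f_inv_f[OF surj])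
  have fadd: "f (z + z') = f z + f z'" for z z'
  proof -
    obtain w w' where "z = \<pi> w" "z' = \<pi> w'" using surj by (metis surjD)
    then show ?thesis using f[of "w + w'"] by (simp add: additive_map_simps[OF \<pi>] additive_map_simps[OF g] f)
  qed
  have ft: "f (t x y) = \<beta> x y" for x y
    unfolding e[symmetric] f ge by simp
  have "tensor_lift t \<beta> = f"
    unfolding tensor_lift_def
  proof (rule the_equality)
    show "(\<forall>x y. f (x + y) = f x + f y) \<and> (\<forall>x y. f (t x y) = \<beta> x y)" using fadd ft by simp
    fix f' assume f': "(\<forall>x y. f' (x + y) = f' x + f' y) \<and> (\<forall>x y. f' (t x y) = \<beta> x y)"
    show "f' = f"
    proof
      fix z show "f' z = f z"
        using T by (induction z rule: tensor_product_induct) (use f' fadd ft in simp_all)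
    qed
  qed
  then show "additive_map (tensor_lift t \<beta>)" "tensor_lift t \<beta> (t x y) = \<beta> x y"
    using fadd ft by (simp_all add: additive_map_def)
qed

text \<open>Every element of a presented module is a combination of the generators.\<close>

lemma presented_left_module_induct [consumes 1, case_names generator add]:
  fixes l :: "'b::ring_1 \<Rightarrow> 'c::ab_group_add \<Rightarrow> 'c" and gen :: "'a \<Rightarrow> 'c"
  assumes "presented_left_module l gen Rel"
    and generator: "\<And>b g. P (l b (gen g))" and add: "\<And>x y. P x \<Longrightarrow> P y \<Longrightarrow> P (x + y)"
  shows "P x"
proof -
  obtain \<pi> :: "('a \<Rightarrow>\<^sub>0 'b) \<Rightarrow> 'c" where \<pi>: "\<forall>x y. \<pi> (x + y) = \<pi> x + \<pi> y"
    and s: "\<And>b g. \<pi> (Poly_Mapping.single g b) = l b (gen g)" and surj: "surj \<pi>"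
    using assms(1) by (auto simp: presented_left_module_def)
  obtain w where w: "x = \<pi> w" using surj by (metis surjD)
  have "P (\<pi> w)"
  proof (induction w rule: poly_mapping_add_induct)
    case zero
    have "P (\<pi> (Poly_Mapping.single undefined 0))" unfolding s by (rule generator)
    then show ?case by simp
  qed (simp_all add: s generator \<pi> add)
  then show ?thesis using w by simp
qed

section \<open>Relations in algebras and modules given by generators\<close>

lemma complex_algebra_simps:
  assumes "complex_algebra \<iota>"
  shows "\<iota> 1 = 1" "\<iota> (c + d) = \<iota> c + \<iota> d" "\<iota> (c * d) = \<iota> c * \<iota> d" "\<iota> c * b = b * \<iota> c" "\<iota> 0 = 0"
    "module (\<lambda>c x. \<iota> c * x)"
proof -
  show b: "\<iota> 1 = 1" "\<iota> (c + d) = \<iota> c + \<iota> d" "\<iota> (c * d) = \<iota> c * \<iota> d" "\<iota> c * b = b * \<iota> c" for c d b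
    using assms unfolding complex_algebra_def by blast+
  show "\<iota> 0 = 0" using b(2)[of 0 0] by simp
  show "module (\<lambda>c x. \<iota> c * x)"
    by unfold_locales (simp_all add: b(1-3) distrib_left distrib_right mult.assoc)
qed

lemma bimodule_simps:
  assumes "bimodule \<iota> M"
  shows "additive_map (lact M a)" "additive_map (\<lambda>a. lact M a x)" "additive_map (\<lambda>x. ract M x a)"
    "additive_map (ract M x)" "lact M (a * b) x = lact M a (lact M b x)"
    "ract M x (a * b) = ract M (ract M x a) b" "lact M a (ract M x b) = ract M (lact M a x) b"
    "lact M 1 x = x" "ract M x 1 = x" "lact M (\<iota> c) x = ract M x (\<iota> c)"
  using assms unfolding bimodule_def additive_map_def by blast+

lemma cscale_module:
  assumes alg: "complex_algebra \<iota>" and M: "bimodule \<iota> M"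
  shows "module (cscale \<iota> M)"
  by unfold_locales (simp_all add: cscale_def complex_algebra_simps(1-3)[OF alg] bimodule_simps(5,8)[OF M]
      additive_map_simps(1)[OF bimodule_simps(1)[OF M]] additive_map_simps(1)[OF bimodule_simps(2)[OF M]])

lemma cscale_commutes:
  assumes alg: "complex_algebra \<iota>" and M: "bimodule \<iota> M"
  shows "lact M b (cscale \<iota> M c x) = cscale \<iota> M c (lact M b x)"
    "ract M (cscale \<iota> M c x) b = cscale \<iota> M c (ract M x b)"
    "ract M x (\<iota> c) = cscale \<iota> M c x" "lact M (\<iota> c * b) x = cscale \<iota> M c (lact M b x)"
  unfolding cscale_def bimodule_simps(10)[OF M, symmetric]
  by (simp_all add: bimodule_simps(5)[OF M, symmetric] bimodule_simps(7)[OF M] complex_algebra_simps(4)[OF alg, of c b])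

lemma bimodule_bimod_sum:
  assumes M: "bimodule \<iota> M" and N: "bimodule \<iota> N"
  shows "bimodule \<iota> (bimod_sum M N)"
  using M N unfolding bimodule_def bimod_sum_def by (auto simp: prod_eq_iff)

text \<open>Maps on legs commute with maps on components. This transports the relators of a presentation to
  relations between the generators of the presented object.\<close>

lemma leg_map_natural:
  assumes "additive_map \<pi>" "\<And>c x. \<pi> (sc c x) = sc' c (\<pi> x)"
  shows "\<pi> (leg_map sc M k X l) = leg_map sc' M k (\<lambda>l. \<pi> (X l)) l"
  unfolding leg_map_def by (simp add: additive_map_simps(5)[OF assms(1)] assms(2) split_def)

lemma leg_contract_natural:
  assumes "additive_map \<pi>" "\<And>c x. \<pi> (sc c x) = sc' c (\<pi> x)"
  shows "\<pi> (leg_contract sc e k X l) = leg_contract sc' e k (\<lambda>l. \<pi> (X l)) l"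
  unfolding leg_contract_def by (simp add: additive_map_simps(5)[OF assms(1)] assms(2))

lemma lookup_free_scale: "Poly_Mapping.lookup (free_scale b x) k = b * Poly_Mapping.lookup x k"
  by (auto simp: free_scale_def map.rep_eq when_def)

lemma free_scale_single: "free_scale b (Poly_Mapping.single g c) = Poly_Mapping.single g (b * c)"
  by (intro poly_mapping_eqI) (auto simp: lookup_free_scale lookup_single when_def)

lemma free_scale_0: "free_scale b 0 = 0"
  by (intro poly_mapping_eqI) (simp add: lookup_free_scale)

lemma free_scale_add: "free_scale b (x + y) = free_scale b x + free_scale b y"
  by (intro poly_mapping_eqI) (simp add: lookup_free_scale lookup_add distrib_left)

lemma free_scale_natural:
  assumes \<pi>: "additive_map \<pi>" and s: "\<And>b g. \<pi> (Poly_Mapping.single g b) = lact M b (gen g)" and M: "bimodule \<iota> M"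
  shows "\<pi> (free_scale b x) = lact M b (\<pi> x)"
proof (induction x rule: poly_mapping_add_induct)
  case zero
  show ?case by (simp add: free_scale_0 additive_map_simps(2)[OF \<pi>] additive_map_simps(2)[OF bimodule_simps(1)[OF M]])
next
  case (single g c)
  show ?case by (simp add: free_scale_single s bimodule_simps(5)[OF M])
next
  case (add f g)
  then show ?case
    by (simp add: free_scale_add additive_map_simps(1)[OF \<pi>] additive_map_simps(1)[OF bimodule_simps(1)[OF M]])
qed

lemma E'_leg_pair:
  fixes X :: "'n::finite list \<Rightarrow> 'x::ab_group_add"
  assumes "module sc"
  shows "E'_leg r q lam sc 1 X [] = (\<Sum>x\<in>UNIV. sc (qpow q (wt_form r (lam x) (two_rho r))) (X [x, x]))"
proof -
  interpret module sc by fact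
  have "E'_leg r q lam sc 1 X [] = (\<Sum>a\<in>UNIV. \<Sum>b\<in>UNIV.
      sc (if b = a then qpow q (wt_form r (lam a) (two_rho r)) else 0) (X [a, b]))"
    by (simp add: E'_leg_def leg_contract_def eq_commute)
  then show ?thesis by (simp add: scale_sum_if)
qed

lemma E_leg_2:
  fixes X :: "'n::finite list \<Rightarrow> 'x::ab_group_add"
  assumes "module sc"
  shows "E_leg sc 2 X (x # l) = (\<Sum>a\<in>UNIV. X (x # a # a # l))"
proof -
  interpret module sc by fact
  have "E_leg sc 2 X (x # l) = (\<Sum>a\<in>UNIV. \<Sum>b\<in>UNIV. sc (if b = a then 1 else 0) (X (x # a # b # l)))"
    by (simp add: E_leg_def leg_contract_def eq_commute)
  then show ?thesis by (simp add: scale_sum_if)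
qed

lemma fam2_4:
  "fprod 2 f (fam2 a) (fam2 b) [x, y, z, w] = f (a (x, y)) (b (z, w))"
  by (simp add: fprod_def fam2_def)

lemma presented_algebra_relations:
  fixes \<iota> :: "complex \<Rightarrow> 'b::ring_1" and p :: "'n::finite \<times> 'n \<Rightarrow> 'b"
  assumes "presented_algebra \<iota> p (B_relators r q s \<rho> lam)"
  defines "sc \<equiv> \<lambda>c x. \<iota> c * x"
  shows "S123 r q s \<rho> sc (fprod 2 (*) (fam2 p) (fam2 p)) [x, y, z, w] = sc (qpow q (par_w r s)) (p (x, y) * p (z, w))"
    and "E'_leg r q lam sc 1 (fam2 p) [] = \<iota> (qpow q (par_m r s))"
proof -
  obtain \<pi> :: "('n \<times> 'n) free_algebra \<Rightarrow> 'b" where \<pi>: "\<forall>x y. \<pi> (x + y) = \<pi> x + \<pi> y \<and> \<pi> (x * y) = \<pi> x * \<pi> y"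
    and c: "\<And>c. \<pi> (Poly_Mapping.single 0 c) = \<iota> c" and g: "\<And>g. \<pi> (Poly_Mapping.single (Word [g]) 1) = p g"
    and ker: "{x. \<pi> x = 0} = ideal_hull (B_relators r q s \<rho> lam)"
    using assms(1) unfolding presented_algebra_def by blast
  have add: "additive_map \<pi>" using \<pi> by (simp add: additive_map_def)
  have mult: "\<pi> (x * y) = \<pi> x * \<pi> y" for x y using \<pi> by simp
  have rel: "\<pi> x = 0" if "x \<in> B_relators r q s \<rho> lam" for x
    using ideal_hull.base[OF that, of 1 1] unfolding ker[symmetric] by simp
  let ?sc = "\<lambda>c (x :: ('n \<times> 'n) free_algebra). Poly_Mapping.single 0 c * x"
  let ?P = "fam2 (\<lambda>g. Poly_Mapping.single (Word [g]) 1) :: 'n list \<Rightarrow> ('n \<times> 'n) free_algebra"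
  let ?PP = "fprod 2 (*) ?P ?P"
  have sc: "\<pi> (?sc c x) = sc c (\<pi> x)" for c x by (simp add: sc_def mult c)
  have PP: "(\<lambda>l. \<pi> (?PP l)) = fprod 2 (*) (fam2 p) (fam2 p)" and P: "(\<lambda>l. \<pi> (?P l)) = fam2 p"
    by (auto simp: fprod_def fam2_def mult g)
  have "S123 r q s \<rho> ?sc ?PP [x, y, z, w] - ?sc (qpow q (par_w r s)) (?PP [x, y, z, w]) \<in> B_relators r q s \<rho> lam"
    unfolding B_relators_def Let_def by force
  from rel[OF this] show "S123 r q s \<rho> sc (fprod 2 (*) (fam2 p) (fam2 p)) [x, y, z, w] = sc (qpow q (par_w r s)) (p (x, y) * p (z, w))"
    unfolding S123_def comp_def
    by (simp add: additive_map_simps(4)[OF add] leg_map_natural[of \<pi> _ sc, OF add sc] sc PP fam2_4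
        mult g c sc_def)
  have "E'_leg r q lam ?sc 1 ?P [] - Poly_Mapping.single 0 (qpow q (par_m r s)) \<in> B_relators r q s \<rho> lam"
    unfolding B_relators_def Let_def by blast
  from rel[OF this] show "E'_leg r q lam sc 1 (fam2 p) [] = \<iota> (qpow q (par_m r s))"
    unfolding E'_leg_def by (simp add: additive_map_simps(4)[OF add] leg_contract_natural[of \<pi> _ sc, OF add sc] c P)
qed

text \<open>The projection from the free left module, with its effect on the families from which the relators
  of the two summands of the calculus are built.\<close>

lemma presented_form_relation:
  fixes \<iota> :: "complex \<Rightarrow> 'b::ring_1" and M :: "('b, 'x::ab_group_add) bimod" and p :: "'n::finite \<times> 'n \<Rightarrow> 'b"
    and gen :: "'n \<times> 'n \<Rightarrow> 'x"
  assumes pres: "presented_left_module (lact M) gen Rel" and M: "bimodule \<iota> M"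
  obtains \<pi> :: "('n \<times> 'n \<Rightarrow>\<^sub>0 'b) \<Rightarrow> 'x"
  where "additive_map \<pi>" "\<And>c x. \<pi> (free_scale (\<iota> c) x) = cscale \<iota> M c (\<pi> x)"
    "\<And>l. \<pi> (fam2 (\<lambda>g. Poly_Mapping.single g 1) l) = fam2 gen l"
    "\<And>l. \<pi> (fprod 2 free_scale (fam2 p) (fam2 (\<lambda>g. Poly_Mapping.single g 1)) l) = fprod 2 (lact M) (fam2 p) (fam2 gen) l"
    "\<And>x. x \<in> Rel \<Longrightarrow> \<pi> x = 0"
proof -
  obtain \<pi> :: "('n \<times> 'n \<Rightarrow>\<^sub>0 'b) \<Rightarrow> 'x" where "\<forall>x y. \<pi> (x + y) = \<pi> x + \<pi> y"
    and s: "\<And>b g. \<pi> (Poly_Mapping.single g b) = lact M b (gen g)" and ker: "{x. \<pi> x = 0} = left_hull Rel"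
    using pres by (auto simp: presented_left_module_def)
  then have add: "additive_map \<pi>" by (simp add: additive_map_def)
  note fs = free_scale_natural[of \<pi> M gen, OF add s M]
  have fs1: "free_scale 1 x = x" for x :: "'n \<times> 'n \<Rightarrow>\<^sub>0 'b"
    by (intro poly_mapping_eqI) (simp add: lookup_free_scale)
  show ?thesis
  proof (rule that[of \<pi>])
    show "additive_map \<pi>" by (rule add)
    show "\<pi> (free_scale (\<iota> c) x) = cscale \<iota> M c (\<pi> x)" for c x by (simp add: fs cscale_def)
    show "\<pi> (fam2 (\<lambda>g. Poly_Mapping.single g 1) l) = fam2 gen l" for l
      by (simp add: fam2_def s bimodule_simps(8)[OF M])
    show "\<pi> (fprod 2 free_scale (fam2 p) (fam2 (\<lambda>g. Poly_Mapping.single g 1)) l) = fprod 2 (lact M) (fam2 p) (fam2 gen) l" for l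
      by (simp add: fprod_def fam2_def fs s bimodule_simps(8)[OF M])
    show "\<pi> x = 0" if "x \<in> Rel" for x
      using left_hull.base[OF that, of 1] unfolding fs1 ker[symmetric] by simp
  qed
qed

lemma plus_form_relations:
  fixes \<iota> :: "complex \<Rightarrow> 'b::ring_1" and p :: "'n::finite \<times> 'n \<Rightarrow> 'b"
    and Op :: "('b, 'x::ab_group_add) bimod" and gen :: "'n \<times> 'n \<Rightarrow> 'x"
  assumes pres: "presented_left_module (lact Op) gen (Omega_plus_relators r q s \<rho> lam \<iota> p)" and M: "bimodule \<iota> Op"
  shows "St234 r q s \<rho> (cscale \<iota> Op) (fprod 2 (lact Op) (fam2 p) (fam2 gen)) [x, y, z, w]
      = cscale \<iota> Op (qpow q (- par_w r s)) (lact Op (p (x, y)) (gen (z, w)))"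
    and "E'_leg r q lam (cscale \<iota> Op) 1 (fam2 gen) [] = 0"
proof -
  let ?D = "fam2 (\<lambda>g. Poly_Mapping.single g 1)" and ?sc = "\<lambda>c. free_scale (\<iota> c)"
  let ?PD = "fprod 2 free_scale (fam2 p) ?D"
  obtain \<pi> where add: "additive_map \<pi>" and sc: "\<And>c x. \<pi> (free_scale (\<iota> c) x) = cscale \<iota> Op c (\<pi> x)"
    and D: "\<And>l. \<pi> (?D l) = fam2 gen l" and PD: "\<And>l. \<pi> (?PD l) = fprod 2 (lact Op) (fam2 p) (fam2 gen) l"
    and rel: "\<And>x. x \<in> Omega_plus_relators r q s \<rho> lam \<iota> p \<Longrightarrow> \<pi> x = 0"
    using presented_form_relation[OF pres M, where p = p] by blast
  have "St234 r q s \<rho> ?sc ?PD [x, y, z, w] - ?sc (qpow q (- par_w r s)) (?PD [x, y, z, w])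
      \<in> Omega_plus_relators r q s \<rho> lam \<iota> p"
    unfolding Omega_plus_relators_def Let_def by force
  from rel[OF this] show "St234 r q s \<rho> (cscale \<iota> Op) (fprod 2 (lact Op) (fam2 p) (fam2 gen)) [x, y, z, w]
      = cscale \<iota> Op (qpow q (- par_w r s)) (lact Op (p (x, y)) (gen (z, w)))"
    unfolding St234_def comp_def
    by (simp add: additive_map_simps(4)[OF add] leg_map_natural[of \<pi> _ "cscale \<iota> Op", OF add sc] sc PD fam2_4[of "lact Op"])
  have "E'_leg r q lam ?sc 1 ?D [] \<in> Omega_plus_relators r q s \<rho> lam \<iota> p"
    unfolding Omega_plus_relators_def Let_def by blast
  from rel[OF this] show "E'_leg r q lam (cscale \<iota> Op) 1 (fam2 gen) [] = 0"
    unfolding E'_leg_def by (simp add: leg_contract_natural[of \<pi> _ "cscale \<iota> Op", OF add sc] D)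
qed

lemma minus_form_relations:
  fixes \<iota> :: "complex \<Rightarrow> 'b::ring_1" and p :: "'n::finite \<times> 'n \<Rightarrow> 'b"
    and Om :: "('b, 'x::ab_group_add) bimod" and gen :: "'n \<times> 'n \<Rightarrow> 'x"
  assumes pres: "presented_left_module (lact Om) gen (Omega_minus_relators r q s \<rho> lam \<iota> p)" and M: "bimodule \<iota> Om"
  shows "S123 r q s \<rho> (cscale \<iota> Om) (fprod 2 (lact Om) (fam2 p) (fam2 gen)) [x, y, z, w]
      = cscale \<iota> Om (qpow q (par_w r s)) (lact Om (p (x, y)) (gen (z, w)))"
proof -
  let ?D = "fam2 (\<lambda>g. Poly_Mapping.single g 1)" and ?sc = "\<lambda>c. free_scale (\<iota> c)"
  let ?PD = "fprod 2 free_scale (fam2 p) ?D"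
  obtain \<pi> where add: "additive_map \<pi>" and sc: "\<And>c x. \<pi> (free_scale (\<iota> c) x) = cscale \<iota> Om c (\<pi> x)"
    and "\<And>l. \<pi> (?D l) = fam2 gen l" and PD: "\<And>l. \<pi> (?PD l) = fprod 2 (lact Om) (fam2 p) (fam2 gen) l"
    and rel: "\<And>x. x \<in> Omega_minus_relators r q s \<rho> lam \<iota> p \<Longrightarrow> \<pi> x = 0"
    using presented_form_relation[OF pres M, where p = p] by blast
  have "S123 r q s \<rho> ?sc ?PD [x, y, z, w] - ?sc (qpow q (par_w r s)) (?PD [x, y, z, w])
      \<in> Omega_minus_relators r q s \<rho> lam \<iota> p"
    unfolding Omega_minus_relators_def Let_def by force
  from rel[OF this] show ?thesis
    unfolding S123_def comp_def
    by (simp add: additive_map_simps(4)[OF add] leg_map_natural[of \<pi> _ "cscale \<iota> Om", OF add sc] sc PD fam2_4[of "lact Om"])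
qed

section \<open>Families commuting with \<open>p\<close> up to \<open>T\<close>\<close>

lemma module_cancel:
  fixes sc :: "complex \<Rightarrow> 'a::ab_group_add \<Rightarrow> 'a"
  assumes "module sc" "c \<noteq> 0" "sc c x = sc c y"
  shows "x = y"
proof -
  interpret module sc by fact
  have "sc (1 / c) (sc c x) = sc (1 / c) (sc c y)" using assms(3) by simp
  then show ?thesis using assms(2) by simp
qed

lemma par_a_value:
  assumes "quantum_group_data r q s \<rho> lam"
  shows "par_a r s = 2"
proof -
  have s: "s \<in> {1..r}" using assms by (auto simp: quantum_group_data_def)
  show ?thesis unfolding par_a_def simple_root_form[OF s] by (simp add: simple_root_def)
qed

definition bimodule_product :: "('b, 'v::ab_group_add) bimod \<Rightarrow> ('b, 'w::ab_group_add) bimod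
    \<Rightarrow> ('b, 'z::ab_group_add) bimod \<Rightarrow> ('v \<Rightarrow> 'w \<Rightarrow> 'z) \<Rightarrow> bool" where
  "bimodule_product V W Z f \<longleftrightarrow> balanced_map V W f \<and>
     (\<forall>b x y. lact Z b (f x y) = f (lact V b x) y \<and> ract Z (f x y) b = f x (ract W y b))"

lemma bimodule_product_simps:
  assumes "bimodule_product V W Z f"
  shows "additive_map (f x)" "additive_map (\<lambda>x. f x y)" "f (ract V x b) y = f x (lact W b y)"
    "lact Z b (f x y) = f (lact V b x) y" "ract Z (f x y) b = f x (ract W y b)"
  using assms balanced_map_additive[of V W f] by (auto simp: bimodule_product_def)

lemma bimodule_product_cscale:
  assumes f: "bimodule_product V W Z f" and V: "bimodule \<iota> V"
  shows "f (cscale \<iota> V c x) y = cscale \<iota> Z c (f x y)" "f x (cscale \<iota> W c y) = cscale \<iota> Z c (f x y)"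
  unfolding cscale_def bimodule_product_simps(4)[OF f] bimodule_product_simps(3)[OF f, symmetric]
    bimodule_simps(10)[OF V] by simp_all

context rigid_braiding
begin

text \<open>The right module structure \<open>X p = \<alpha> T\<^bsub>1234\<^esub> p X\<close> of the calculus, stated for an arbitrary matrix \<open>X\<close>
  of elements of a bimodule.\<close>

definition braided_commuting where
  "braided_commuting \<iota> V p \<alpha> X \<longleftrightarrow> (\<forall>u w. ract V (X u) (p w) =
     cscale \<iota> V \<alpha> (\<Sum>s\<in>UNIV. \<Sum>t\<in>UNIV. cscale \<iota> V (swap_coeff u w s t) (lact V (p s) (X t))))"

text \<open>Move \<open>p\<close> past \<open>Y\<close> and then past \<open>X\<close>; the two operators \<open>T\<close> compose to one on the matrix product.\<close>

lemma braided_commuting_product: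
  assumes alg: "complex_algebra \<iota>" and V: "bimodule \<iota> V" and W: "bimodule \<iota> W" and Z: "bimodule \<iota> Z"
    and f: "bimodule_product V W Z f"
    and X: "braided_commuting \<iota> V p \<alpha> X" and Y: "braided_commuting \<iota> W p \<beta> Y"
  shows "braided_commuting \<iota> Z p (\<alpha> * \<beta>) (\<lambda>u. \<Sum>y\<in>UNIV. f (X (fst u, y)) (Y (y, snd u)))"
proof -
  interpret Z: module "cscale \<iota> Z" by (rule cscale_module[OF alg Z])
  note fs = bimodule_product_simps[OF f] and fc = bimodule_product_cscale[OF f V]
  have X': "ract V (X u) (p w) =
       cscale \<iota> V \<alpha> (\<Sum>s\<in>UNIV. \<Sum>t\<in>UNIV. cscale \<iota> V (swap_coeff u w s t) (lact V (p s) (X t)))"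
    and Y': "ract W (Y u) (p w) =
       cscale \<iota> W \<beta> (\<Sum>s\<in>UNIV. \<Sum>t\<in>UNIV. cscale \<iota> W (swap_coeff u w s t) (lact W (p s) (Y t)))" for u w
    using X Y unfolding braided_commuting_def by blast+
  let ?F = "\<lambda>u. \<Sum>y\<in>UNIV. f (X (fst u, y)) (Y (y, snd u))" and ?sc = "cscale \<iota> Z"
  have "ract Z (?F u) (p w) = ?sc (\<alpha> * \<beta>)
     (\<Sum>s\<in>UNIV. \<Sum>t\<in>UNIV. ?sc (swap_coeff u w s t) (lact Z (p s) (?F t)))" for u w
  proof -
    obtain x z where u: "u = (x, z)" by (cases u)
    have compose: "(\<Sum>y\<in>UNIV. \<Sum>s\<in>UNIV. swap_coeff (y, z) w s t * swap_coeff (x, y) s s' t')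
        = (if snd t' = fst t then swap_coeff (x, z) w s' (fst t', snd t) else 0)" for t s' t'
      using swap_coeff_compose[of z w "fst t" "snd t" x s' "fst t'" "snd t'"] by simp
    have "ract Z (?F u) (p w) = (\<Sum>y\<in>UNIV. f (X (x, y)) (ract W (Y (y, z)) (p w)))"
      by (simp add: u additive_map_simps(5)[OF bimodule_simps(3)[OF Z]] fs(5))
    also have "\<dots> = (\<Sum>y\<in>UNIV. ?sc \<beta> (\<Sum>s\<in>UNIV. \<Sum>t\<in>UNIV. ?sc (swap_coeff (y, z) w s t)
        (f (ract V (X (x, y)) (p s)) (Y t))))"
      unfolding Y' by (simp add: fc additive_map_simps(5)[OF fs(1)] fs(3))
    also have "\<dots> = (\<Sum>y\<in>UNIV. ?sc \<beta> (\<Sum>s\<in>UNIV. \<Sum>t\<in>UNIV. ?sc (swap_coeff (y, z) w s t)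
        (?sc \<alpha> (\<Sum>s'\<in>UNIV. \<Sum>t'\<in>UNIV. ?sc (swap_coeff (x, y) s s' t') (lact Z (p s') (f (X t') (Y t)))))))"
      unfolding X' by (simp add: fc additive_map_simps(5)[OF fs(2)] fs(4))
    also have "\<dots> = ?sc (\<alpha> * \<beta>) (\<Sum>y\<in>UNIV. \<Sum>s\<in>UNIV. \<Sum>t\<in>UNIV. \<Sum>s'\<in>UNIV. \<Sum>t'\<in>UNIV.
        ?sc (swap_coeff (y, z) w s t * swap_coeff (x, y) s s' t') (lact Z (p s') (f (X t') (Y t))))"
      by (simp add: Z.scale_sum_right mult_ac)
    also have "(\<Sum>y\<in>UNIV. \<Sum>s\<in>UNIV. \<Sum>t\<in>UNIV. \<Sum>s'\<in>UNIV. \<Sum>t'\<in>UNIV.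
        ?sc (swap_coeff (y, z) w s t * swap_coeff (x, y) s s' t') (lact Z (p s') (f (X t') (Y t))))
      = (\<Sum>t\<in>UNIV. \<Sum>s'\<in>UNIV. \<Sum>t'\<in>UNIV. \<Sum>y\<in>UNIV. \<Sum>s\<in>UNIV.
        ?sc (swap_coeff (y, z) w s t * swap_coeff (x, y) s s' t') (lact Z (p s') (f (X t') (Y t))))"
      unfolding sum.cartesian_product
      by (rule sum.reindex_bij_witness[of _ "\<lambda>(t, s', t', y, s). (y, s, t, s', t')"
          "\<lambda>(y, s, t, s', t'). (t, s', t', y, s)"]) auto
    also have "\<dots> = (\<Sum>t\<in>UNIV. \<Sum>s'\<in>UNIV. \<Sum>t'\<in>UNIV.
        ?sc (if snd t' = fst t then swap_coeff (x, z) w s' (fst t', snd t) else 0) (lact Z (p s') (f (X t') (Y t))))"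
      unfolding Z.scale_sum_left[symmetric] compose ..
    also have "\<dots> = (\<Sum>c\<in>UNIV. \<Sum>d\<in>UNIV. \<Sum>s'\<in>UNIV. \<Sum>c'\<in>UNIV. \<Sum>d'\<in>UNIV. if d' = c then
        ?sc (swap_coeff (x, z) w s' (c', d)) (lact Z (p s') (f (X (c', c)) (Y (c, d)))) else 0)"
      unfolding sum_pair_UNIV[of "\<lambda>t. \<Sum>s'\<in>UNIV. _ t s'"] sum_pair_UNIV[of "\<lambda>t'. ?sc (_ t') (_ t')"]
      by (intro sum.cong refl) auto
    also have "\<dots> = (\<Sum>c\<in>UNIV. \<Sum>d\<in>UNIV. \<Sum>s'\<in>UNIV. \<Sum>c'\<in>UNIV.
        ?sc (swap_coeff (x, z) w s' (c', d)) (lact Z (p s') (f (X (c', c)) (Y (c, d)))))"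
      by simp
    also have "\<dots> = (\<Sum>s'\<in>UNIV. \<Sum>c'\<in>UNIV. \<Sum>d\<in>UNIV. \<Sum>c\<in>UNIV.
        ?sc (swap_coeff (x, z) w s' (c', d)) (lact Z (p s') (f (X (c', c)) (Y (c, d)))))"
      unfolding sum.cartesian_product
      by (rule sum.reindex_bij_witness[of _ "\<lambda>(s, c', d, c). (c, d, s, c')" "\<lambda>(c, d, s, c'). (s, c', d, c)"]) auto
    also have "\<dots> = (\<Sum>s\<in>UNIV. \<Sum>t\<in>UNIV. ?sc (swap_coeff u w s t) (lact Z (p s) (?F t)))"
      by (simp add: u additive_map_simps(5)[OF bimodule_simps(1)[OF Z]] Z.scale_sum_right sum_pair_UNIV)
    finally show ?thesis .
  qed
  then show ?thesis by (simp add: braided_commuting_def)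
qed

lemma braided_commuting_trace:
  assumes alg: "complex_algebra \<iota>" and Z: "bimodule \<iota> Z" and F: "braided_commuting \<iota> Z p \<gamma> F"
  defines "h \<equiv> \<Sum>x\<in>UNIV. cscale \<iota> Z (D x) (F (x, x))"
  shows "ract Z h (p w) = cscale \<iota> Z \<gamma> (lact Z (p w) h)"
proof -
  interpret Z: module "cscale \<iota> Z" by (rule cscale_module[OF alg Z])
  have F': "ract Z (F u) (p w) =
       cscale \<iota> Z \<gamma> (\<Sum>s\<in>UNIV. \<Sum>t\<in>UNIV. cscale \<iota> Z (swap_coeff u w s t) (lact Z (p s) (F t)))" for u w
    using F unfolding braided_commuting_def by blast
  let ?sc = "cscale \<iota> Z"
  have "ract Z h (p w) = (\<Sum>x\<in>UNIV. ?sc (D x) (ract Z (F (x, x)) (p w)))"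
    by (simp add: h_def additive_map_simps(5)[OF bimodule_simps(3)[OF Z]] cscale_commutes(2)[OF alg Z])
  also have "\<dots> = (\<Sum>x\<in>UNIV. \<Sum>s\<in>UNIV. \<Sum>t\<in>UNIV. ?sc (\<gamma> * (D x * swap_coeff (x, x) w s t)) (lact Z (p s) (F t)))"
    unfolding F' by (simp add: Z.scale_sum_right mult_ac)
  also have "\<dots> = (\<Sum>s\<in>UNIV. \<Sum>t\<in>UNIV. \<Sum>x\<in>UNIV. ?sc (\<gamma> * (D x * swap_coeff (x, x) w s t)) (lact Z (p s) (F t)))"
    unfolding sum.cartesian_product
    by (rule sum.reindex_bij_witness[of _ "\<lambda>(s, t, x). (x, s, t)" "\<lambda>(x, s, t). (s, t, x)"]) auto
  also have "\<dots> = (\<Sum>s\<in>UNIV. \<Sum>t\<in>UNIV. ?sc (\<gamma> * (if s = w \<and> fst t = snd t then D (snd t) else 0)) (lact Z (p s) (F t)))"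
    unfolding Z.scale_sum_left[symmetric] sum_distrib_left[symmetric] swap_coeff_trace ..
  also have "\<dots> = (\<Sum>s\<in>UNIV. if s = w then
      \<Sum>t\<in>UNIV. ?sc (\<gamma> * (if fst t = snd t then D (snd t) else 0)) (lact Z (p w) (F t)) else 0)"
    by (intro sum.cong refl) simp
  also have "\<dots> = (\<Sum>t\<in>UNIV. ?sc (\<gamma> * (if fst t = snd t then D (snd t) else 0)) (lact Z (p w) (F t)))"
    by simp
  also have "\<dots> = (\<Sum>c\<in>UNIV. \<Sum>d\<in>UNIV. if d = c then ?sc (\<gamma> * D c) (lact Z (p w) (F (c, c))) else 0)"
    unfolding sum_pair_UNIV by (intro sum.cong refl) auto
  also have "\<dots> = (\<Sum>c\<in>UNIV. ?sc (\<gamma> * D c) (lact Z (p w) (F (c, c))))"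
    by simp
  also have "\<dots> = ?sc \<gamma> (lact Z (p w) h)"
    by (simp add: h_def additive_map_simps(5)[OF bimodule_simps(1)[OF Z]] cscale_commutes(1)[OF alg Z] Z.scale_sum_right)
  finally show ?thesis .
qed

text \<open>By the previous lemma \<open>h p = \<gamma> p h\<close> for the quantum trace \<open>h\<close> of \<open>F\<close>. As the quantum trace of \<open>p\<close>
  is the scalar \<open>c\<close>, taking it on both sides gives \<open>c h = \<gamma> c h\<close>.\<close>

lemma braided_commuting_trace_zero:
  assumes alg: "complex_algebra \<iota>" and Z: "bimodule \<iota> Z" and F: "braided_commuting \<iota> Z p \<gamma> F"
    and tr: "(\<Sum>x\<in>UNIV. \<iota> (D x) * p (x, x)) = \<iota> c" and "c \<noteq> 0" "\<gamma> \<noteq> 1"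
  shows "(\<Sum>x\<in>UNIV. cscale \<iota> Z (D x) (F (x, x))) = 0"
proof -
  interpret Z: module "cscale \<iota> Z" by (rule cscale_module[OF alg Z])
  define h where "h = (\<Sum>x\<in>UNIV. cscale \<iota> Z (D x) (F (x, x)))"
  have "cscale \<iota> Z c h = ract Z h (\<iota> c)" by (simp add: cscale_commutes(3)[OF alg Z])
  also have "\<dots> = (\<Sum>x\<in>UNIV. cscale \<iota> Z (D x) (ract Z h (p (x, x))))"
    by (simp add: tr[symmetric] additive_map_simps(5)[OF bimodule_simps(4)[OF Z]] bimodule_simps(6)[OF Z]
        cscale_commutes(2,3)[OF alg Z])
  also have "\<dots> = cscale \<iota> Z \<gamma> (\<Sum>x\<in>UNIV. lact Z (\<iota> (D x) * p (x, x)) h)"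
    unfolding h_def braided_commuting_trace[OF alg Z F]
    by (simp add: Z.scale_sum_right cscale_commutes(4)[OF alg Z] mult.commute)
  also have "\<dots> = cscale \<iota> Z \<gamma> (cscale \<iota> Z c h)"
    by (simp add: additive_map_simps(5)[OF bimodule_simps(2)[OF Z], symmetric] tr)
      (simp add: cscale_def complex_algebra_simps(3)[OF alg] bimodule_simps(5)[OF Z])
  finally have "cscale \<iota> Z c h = cscale \<iota> Z (\<gamma> * c) h" by simp
  then have "cscale \<iota> Z (c - \<gamma> * c) h = 0"
    by (simp only: Z.scale_left_diff_distrib diff_self)
  then have "cscale \<iota> Z ((1 - \<gamma>) * c) h = cscale \<iota> Z ((1 - \<gamma>) * c) 0"
    by (simp only: left_diff_distrib mult_1 Z.scale_zero_right)
  then show ?thesis unfolding h_def by (rule module_cancel[OF Z.module_axioms, rotated]) (use assms in simp)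
qed

end

section \<open>Curvature of the Levi-Civita connection\<close>

locale projective_levi_civita =
  fixes r s :: nat and q :: real
    and \<rho> :: "'n::finite uq_rep" and lam :: "'n \<Rightarrow> weight"
    and \<iota> :: "complex \<Rightarrow> 'b::ring_1" and p :: "'n \<times> 'n \<Rightarrow> 'b"
    and Op :: "('b, 'x::ab_group_add) bimod" and del :: "'b \<Rightarrow> 'x"
    and Om :: "('b, 'y::ab_group_add) bimod" and delb :: "'b \<Rightarrow> 'y"
    and T :: "('b, 't::ab_group_add) bimod" and t :: "'x \<times> 'y \<Rightarrow> 'x \<times> 'y \<Rightarrow> 't"
    and U :: "('b, 'u::ab_group_add) bimod" and pr :: "'t \<Rightarrow> 'u" and d1 :: "'x \<times> 'y \<Rightarrow> 'u"
    and Z :: "('b, 'z::ab_group_add) bimod" and t2 :: "'u \<Rightarrow> 'x \<times> 'y \<Rightarrow> 'z"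
    and nabla :: "'x \<times> 'y \<Rightarrow> 't"
  assumes qg: "quantum_group_data r q s \<rho> lam"
    and hk: "hk_calculus r q s \<rho> lam \<iota> p Op del Om delb"
    and tensor_T: "tensor_product \<iota> (bimod_sum Op Om) (bimod_sum Op Om) T t"
    and two: "two_forms \<iota> (bimod_sum Op Om) (diff del delb) T t U pr"
    and ext: "is_exterior_d (bimod_sum Op Om) (diff del delb) (wedge t pr) d1"
    and tensor_Z: "tensor_product \<iota> U (bimod_sum Op Om) Z t2"
    and lc: "levi_civita r q s \<rho> lam \<iota> p Op del Om delb T t nabla"
begin

abbreviation "M \<equiv> bimod_sum Op Om"
abbreviation "d \<equiv> diff del delb"
abbreviation "wdg \<equiv> wedge t pr"
text \<open>The weights of the quantum trace.\<close>

definition "pivot x = qpow q (wt_form r (lam x) (two_rho r))"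
definition "P u = (del (p u), 0 :: 'y)"
definition "Q u = (0 :: 'x, delb (p u))"

lemma rigid: "rigid_braiding (R_VV r q s \<rho>) (R_VD r q s \<rho>) (R_DD r q s \<rho>) pivot (qpow q (par_w r s + par_m r s))"
  using quantum_group_rigid_braiding[OF qg] by (simp add: pivot_def[abs_def])

lemma alg: "complex_algebra \<iota>"
  using hk by (simp add: hk_calculus_def presented_algebra_def)

lemma bimodules: "bimodule \<iota> Op" "bimodule \<iota> Om" "bimodule \<iota> M" "bimodule \<iota> T" "bimodule \<iota> U" "bimodule \<iota> Z"
  using hk tensor_T two tensor_Z bimodule_bimod_sum[of \<iota> Op Om]
  by (auto simp: hk_calculus_def tensor_product_def two_forms_def)

lemma derivations: "derivation \<iota> Op del" "derivation \<iota> Om delb"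
  using hk by (simp_all add: hk_calculus_def)

lemma qpow_nz: "qpow q x \<noteq> 0"
  using qg by (simp add: qpow_def quantum_group_data_def)

lemma qpow_add: "qpow q (x + y) = qpow q x * qpow q y"
  by (simp add: qpow_def powr_add)

lemma quantum_trace_p: "(\<Sum>x\<in>UNIV. \<iota> (pivot x) * p (x, x)) = \<iota> (qpow q (par_m r s))"
proof -
  have "presented_algebra \<iota> p (B_relators r q s \<rho> lam)" using hk by (simp add: hk_calculus_def)
  from presented_algebra_relations(2)[OF this] show ?thesis
    unfolding E'_leg_pair[OF complex_algebra_simps(6)[OF alg]] by (simp add: pivot_def fam2_def)
qed

text \<open>Contract the relation \<open>S\<^bsub>123\<^esub> p p = q\<^sup>w p p\<close> by \<open>E'\<close> on the first two legs and use that the quantum trace of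
  \<open>p\<close> is \<open>q\<^sup>m\<close>.\<close>

lemma p_idempotent: "(\<Sum>b\<in>UNIV. p (i, b) * p (b, j)) = p (i, j)"
proof -
  let ?sc = "\<lambda>c x. \<iota> c * x" and ?w = "qpow q (par_w r s)" and ?m = "qpow q (par_m r s)"
  note mod = complex_algebra_simps(6)[OF alg]
  have pres: "presented_algebra \<iota> p (B_relators r q s \<rho> lam)" using hk by (simp add: hk_calculus_def)
  have "?sc ?w (\<Sum>x\<in>UNIV. ?sc (pivot x) (p (x, x) * p (i, j)))
      = ?sc (qpow q (par_w r s + par_m r s)) (\<Sum>b\<in>UNIV. p (i, b) * p (b, j))"
    using rigid_braiding.contract_over_eigenfamily[OF rigid mod, of "fprod 2 (*) (fam2 p) (fam2 p)" ?w i j]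
      presented_algebra_relations(1)[OF pres] by (simp add: fam2_4 S123_def)
  also have "(\<Sum>x\<in>UNIV. ?sc (pivot x) (p (x, x) * p (i, j))) = ?sc ?m (p (i, j))"
    by (simp add: quantum_trace_p[symmetric] sum_distrib_right mult.assoc)
  finally have "?sc (?w * ?m) (p (i, j)) = ?sc (?w * ?m) (\<Sum>b\<in>UNIV. p (i, b) * p (b, j))"
    by (simp add: qpow_add complex_algebra_simps(3)[OF alg] mult.assoc)
  from module_cancel[OF mod _ this] show ?thesis using qpow_nz by simp
qed

text \<open>The same contraction of the relation between \<open>p\<close> and the conjugate one-forms.\<close>

lemma p_delb: "(\<Sum>b\<in>UNIV. lact Om (p (i, b)) (delb (p (b, j)))) = delb (p (i, j))"
proof -
  let ?sc = "cscale \<iota> Om" and ?w = "qpow q (par_w r s)" and ?m = "qpow q (par_m r s)"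
  note mod = cscale_module[OF alg bimodules(2)] and bs = bimodule_simps[OF bimodules(2)]
  interpret module ?sc by (rule mod)
  have pres: "presented_left_module (lact Om) (delb \<circ> p) (Omega_minus_relators r q s \<rho> lam \<iota> p)"
    using hk by (simp add: hk_calculus_def)
  have "?sc ?w (\<Sum>x\<in>UNIV. ?sc (pivot x) (lact Om (p (x, x)) (delb (p (i, j)))))
      = ?sc (qpow q (par_w r s + par_m r s)) (\<Sum>b\<in>UNIV. lact Om (p (i, b)) (delb (p (b, j))))"
    using rigid_braiding.contract_over_eigenfamily[OF rigid mod, of "fprod 2 (lact Om) (fam2 p) (fam2 (delb \<circ> p))" ?w i j]
      minus_form_relations[OF pres bimodules(2)] by (simp add: fam2_4 S123_def)
  also have "(\<Sum>x\<in>UNIV. ?sc (pivot x) (lact Om (p (x, x)) (delb (p (i, j)))))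
      = lact Om (\<Sum>x\<in>UNIV. \<iota> (pivot x) * p (x, x)) (delb (p (i, j)))"
    by (simp add: additive_map_simps(5)[OF bs(2)] cscale_commutes(4)[OF alg bimodules(2)])
  also have "\<dots> = ?sc ?m (delb (p (i, j)))" by (simp add: quantum_trace_p cscale_def)
  finally have "?sc (?w * ?m) (delb (p (i, j))) = ?sc (?w * ?m) (\<Sum>b\<in>UNIV. lact Om (p (i, b)) (delb (p (b, j))))"
    by (simp add: qpow_add)
  from module_cancel[OF mod _ this] show ?thesis using qpow_nz by simp
qed

lemma quantum_trace_del: "(\<Sum>x\<in>UNIV. cscale \<iota> Op (pivot x) (del (p (x, x)))) = 0"
proof -
  have "presented_left_module (lact Op) (del \<circ> p) (Omega_plus_relators r q s \<rho> lam \<iota> p)"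
    using hk by (simp add: hk_calculus_def)
  from plus_form_relations(2)[OF this bimodules(1)] show ?thesis
    unfolding E'_leg_pair[OF cscale_module[OF alg bimodules(1)]] by (simp add: pivot_def fam2_def)
qed

text \<open>For \<open>\<partial>p\<close> the contraction is taken on the last two legs, where the quantum trace vanishes.\<close>

lemma p_del: "(\<Sum>b\<in>UNIV. lact Op (p (i, b)) (del (p (b, j)))) = 0"
proof -
  let ?sc = "cscale \<iota> Op" and ?w = "qpow q (- par_w r s)" and ?C = "qpow q (par_w r s + par_m r s)"
  note mod = cscale_module[OF alg bimodules(1)] and bs = bimodule_simps[OF bimodules(1)]
  interpret module ?sc by (rule mod)
  have pres: "presented_left_module (lact Op) (del \<circ> p) (Omega_plus_relators r q s \<rho> lam \<iota> p)"
    using hk by (simp add: hk_calculus_def)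
  have "?sc ?w (\<Sum>x\<in>UNIV. ?sc (pivot x) (lact Op (p (i, j)) (del (p (x, x)))))
      = ?sc (?w * ?w * ?C) (\<Sum>b\<in>UNIV. lact Op (p (i, b)) (del (p (b, j))))"
    using rigid_braiding.contract_under_eigenfamily[OF rigid mod, of "fprod 2 (lact Op) (fam2 p) (fam2 (del \<circ> p))" ?w i j]
      plus_form_relations(1)[OF pres bimodules(1)] by (simp add: fam2_4 St234_def)
  also have "(\<Sum>x\<in>UNIV. ?sc (pivot x) (lact Op (p (i, j)) (del (p (x, x)))))
      = lact Op (p (i, j)) (\<Sum>x\<in>UNIV. ?sc (pivot x) (del (p (x, x))))"
    by (simp add: additive_map_simps(5)[OF bs(1)] cscale_commutes(1)[OF alg bimodules(1)])
  also have "\<dots> = 0" by (simp add: quantum_trace_del additive_map_simps(2)[OF bs(1)])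
  finally have "?sc (?w * ?w * ?C) (\<Sum>b\<in>UNIV. lact Op (p (i, b)) (del (p (b, j)))) = ?sc (?w * ?w * ?C) 0"
    by simp
  from module_cancel[OF mod _ this] show ?thesis using qpow_nz by simp
qed

text \<open>Differentiating \<open>p p = p\<close> turns the left relations \<open>p P = 0\<close> and \<open>p Q = Q\<close> into the right relations
  \<open>P p = P\<close> and \<open>Q p = 0\<close>.\<close>

lemma derivation_idempotent:
  assumes "derivation \<iota> V \<delta>"
  shows "(\<Sum>b\<in>UNIV. ract V (\<delta> (p (i, b))) (p (b, j))) + (\<Sum>b\<in>UNIV. lact V (p (i, b)) (\<delta> (p (b, j)))) = \<delta> (p (i, j))"
proof -
  have add: "additive_map \<delta>" and prod: "\<delta> (x * y) = ract V (\<delta> x) y + lact V x (\<delta> y)" for x y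
    using assms by (auto simp: derivation_def additive_map_def)
  have "\<delta> (p (i, j)) = \<delta> (\<Sum>b\<in>UNIV. p (i, b) * p (b, j))" by (simp add: p_idempotent)
  then show ?thesis by (simp add: additive_map_simps(5)[OF add] prod sum.distrib)
qed

lemma M_simps: "lact M b z = (lact Op b (fst z), lact Om b (snd z))" "ract M z b = (ract Op (fst z) b, ract Om (snd z) b)"
  by (simp_all add: bimod_sum_def)

lemma sum_Pair: "(\<Sum>i\<in>I. (f i, g i)) = (sum f I, sum g I)"
  for f :: "'i \<Rightarrow> 'x" and g :: "'i \<Rightarrow> 'y"
  by (induction I rule: infinite_finite_induct) (auto simp: zero_prod_def)

lemma zero_acts: "lact Op b 0 = 0" "lact Om b 0 = 0" "ract Op 0 b = 0" "ract Om 0 b = 0"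
  using additive_map_simps(2)[OF bimodule_simps(1)[OF bimodules(1)]] additive_map_simps(2)[OF bimodule_simps(1)[OF bimodules(2)]]
    additive_map_simps(2)[OF bimodule_simps(3)[OF bimodules(1)]] additive_map_simps(2)[OF bimodule_simps(3)[OF bimodules(2)]]
  by auto

lemma p_P: "(\<Sum>b\<in>UNIV. lact M (p (i, b)) (P (b, j))) = 0"
  and P_p: "(\<Sum>b\<in>UNIV. ract M (P (i, b)) (p (b, j))) = P (i, j)"
  and p_Q: "(\<Sum>b\<in>UNIV. lact M (p (i, b)) (Q (b, j))) = Q (i, j)"
  and Q_p: "(\<Sum>b\<in>UNIV. ract M (Q (i, b)) (p (b, j))) = 0"
  using derivation_idempotent[OF derivations(1), of i j] derivation_idempotent[OF derivations(2), of i j]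
  by (simp_all add: M_simps P_def Q_def zero_acts sum_Pair p_del p_delb zero_prod_def)

lemma d_p: "d (p u) = P u + Q u"
  by (simp add: diff_def P_def Q_def)

lemma d_mult: "d (a * b) = ract M (d a) b + lact M a (d b)"
  using derivations by (simp add: derivation_def diff_def M_simps)

text \<open>The module \<open>\<Omega>\<^sub>+ \<oplus> \<Omega>\<^sub>-\<close> is spanned by the forms \<open>a db\<close>: its generators are \<open>P = dp - p dp\<close> and
  \<open>Q = p dp\<close>.\<close>

lemma form_induct [case_names exact add]:
  assumes exact: "\<And>a b. F (lact M a (d b))" and add: "\<And>z z'. F z \<Longrightarrow> F z' \<Longrightarrow> F (z + z')"
  shows "F z"
proof -
  note bs = bimodule_simps[OF bimodules(3)]
  have F0: "F 0" using exact[of 0 0] by (simp add: additive_map_simps(2)[OF bs(2)])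
  have Fsum: "F (\<Sum>i\<in>I. f i)" if "\<And>i. F (f i)" for I :: "'n set" and f
    by (induction I rule: infinite_finite_induct) (auto simp: F0 that add)
  have "lact M a (P (i, j)) = lact M a (d (p (i, j))) + (\<Sum>k\<in>UNIV. lact M (- a * p (i, k)) (d (p (k, j))))" for a i j
  proof -
    have "(\<Sum>k\<in>UNIV. lact M (- a * p (i, k)) (d (p (k, j)))) = lact M (- a) (\<Sum>k\<in>UNIV. lact M (p (i, k)) (d (p (k, j))))"
      by (simp only: bs(5) additive_map_simps(5)[OF bs(1)])
    also have "\<dots> = lact M (- a) (Q (i, j))"
      by (simp add: d_p additive_map_simps(1)[OF bs(1)] sum.distrib p_P p_Q)
    finally show ?thesis by (simp add: d_p additive_map_simps(1)[OF bs(1)] additive_map_simps(3)[OF bs(2)])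
  qed
  then have FP: "F (lact M a (P (i, j)))" for a i j by (simp only: add Fsum exact)
  have "lact M a (Q (i, j)) = (\<Sum>k\<in>UNIV. lact M (a * p (i, k)) (d (p (k, j))))" for a i j
  proof -
    have "(\<Sum>k\<in>UNIV. lact M (a * p (i, k)) (d (p (k, j)))) = lact M a (\<Sum>k\<in>UNIV. lact M (p (i, k)) (d (p (k, j))))"
      by (simp only: bs(5) additive_map_simps(5)[OF bs(1)])
    also have "\<dots> = lact M a (Q (i, j))"
      by (simp add: d_p additive_map_simps(1)[OF bs(1)] sum.distrib p_P p_Q)
    finally show ?thesis by simp
  qed
  then have FQ: "F (lact M a (Q (i, j)))" for a i j by (simp only: Fsum exact)
  \<comment> \<open>The two summands are generated by the entries of \<open>P\<close> and \<open>Q\<close>.\<close>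
  have presP: "presented_left_module (lact Op) (del \<circ> p) (Omega_plus_relators r q s \<rho> lam \<iota> p)"
    and presQ: "presented_left_module (lact Om) (delb \<circ> p) (Omega_minus_relators r q s \<rho> lam \<iota> p)"
    using hk by (simp_all add: hk_calculus_def)
  have "F (x, 0)" for x
    using presP
  proof (induction x rule: presented_left_module_induct)
    case (generator b g)
    then show ?case using FP[of b "fst g" "snd g"] by (simp add: M_simps P_def zero_acts)
  next
    case (add x y)
    then show ?case using assms(2)[of "(x, 0)" "(y, 0)"] by simp
  qed
  moreover have "F (0, y)" for y
    using presQ
  proof (induction y rule: presented_left_module_induct)
    case (generator b g)
    then show ?case using FQ[of b "fst g" "snd g"] by (simp add: M_simps Q_def zero_acts)
  next
    case (add x y)
    then show ?case using assms(2)[of "(0, x)" "(0, y)"] by simp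
  qed
  ultimately have "F ((fst z, 0) + (0, snd z))" by (rule add)
  then show ?thesis by simp
qed

lemma tensor_T_product: "bimodule_product M M T t" and tensor_Z_product: "bimodule_product U M Z t2"
  using tensor_product_balanced[OF tensor_T] tensor_product_balanced[OF tensor_Z] tensor_T tensor_Z
  unfolding bimodule_product_def tensor_product_def by blast+

lemma wedge_product: "bimodule_product M M U wdg"
proof -
  have pr: "additive_map pr" "pr (lact T b x) = lact U b (pr x)" "pr (ract T x b) = ract U (pr x) b" for b x
    using two by (auto simp: two_forms_def additive_map_def)
  note ts = bimodule_product_simps[OF tensor_T_product]
  show ?thesis
    unfolding bimodule_product_def balanced_map_def wedge_def
    by (simp add: additive_map_simps(1)[OF pr(1)] additive_map_simps(1)[OF ts(1)] additive_map_simps(1)[OF ts(2)]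
        ts(3) pr(2,3)[symmetric] ts(4,5))
qed

lemma d1: "additive_map d1" "d1 (lact M a (d b)) = wdg (d a) (d b)"
  using ext by (auto simp: is_exterior_d_def additive_map_def)

text \<open>The graded Leibniz rules follow from \<open>d (a db) = da \<and> db\<close>, since forms \<open>a db\<close> span.\<close>

lemma d1_lact: "d1 (lact M b z) = wdg (d b) z + lact U b (d1 z)"
proof (induction z rule: form_induct)
  case (exact a c)
  have "d1 (lact M b (lact M a (d c))) = wdg (d (b * a)) (d c)"
    by (simp add: bimodule_simps(5)[OF bimodules(3), symmetric] d1)
  then show ?case
    by (simp add: d_mult additive_map_simps(1)[OF bimodule_product_simps(2)[OF wedge_product]]
        bimodule_product_simps(3,4)[OF wedge_product] d1)
next
  case (add z z')
  then show ?case
    by (simp add: additive_map_simps(1)[OF bimodule_simps(1)[OF bimodules(3)]] additive_map_simps(1)[OF d1(1)]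
        additive_map_simps(1)[OF bimodule_product_simps(1)[OF wedge_product]]
        additive_map_simps(1)[OF bimodule_simps(1)[OF bimodules(5)]])
qed

lemma d1_ract: "d1 (ract M z b) = ract U (d1 z) b - wdg z (d b)"
proof (induction z rule: form_induct)
  case (exact a c)
  have "ract M (lact M a (d c)) b = lact M a (d (c * b)) - lact M (a * c) (d b)"
    by (simp add: d_mult additive_map_simps(1)[OF bimodule_simps(1)[OF bimodules(3)]]
        bimodule_simps(5,7)[OF bimodules(3)])
  then have "d1 (ract M (lact M a (d c)) b) = wdg (d a) (d (c * b)) - wdg (d (a * c)) (d b)"
    by (simp add: additive_map_simps(4)[OF d1(1)] d1)
  then show ?case
    by (simp add: d_mult additive_map_simps(1)[OF bimodule_product_simps(1)[OF wedge_product]]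
        additive_map_simps(1)[OF bimodule_product_simps(2)[OF wedge_product]]
        bimodule_product_simps(3)[OF wedge_product] bimodule_product_simps(5)[OF wedge_product] d1)
next
  case (add z z')
  then show ?case
    by (simp add: additive_map_simps(1)[OF bimodule_simps(3)[OF bimodules(3)]] additive_map_simps(1)[OF d1(1)]
        additive_map_simps(1)[OF bimodule_product_simps(2)[OF wedge_product]]
        additive_map_simps(1)[OF bimodule_simps(3)[OF bimodules(5)]])
qed

abbreviation "wid \<equiv> wedge_id t pr t2"

text \<open>For a one-form \<open>x\<close> and \<open>z\<close> in the tensor square, \<open>wid x z\<close> is \<open>x \<and> z\<close>. The next lemmas are its
  bilinearity and its compatibility with scalars.\<close>

lemma wid_balanced: "balanced_map M M (\<lambda>y y'. t2 (wdg x y) y')"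
  unfolding balanced_map_def
  by (simp add: additive_map_simps(1)[OF bimodule_product_simps(1)[OF wedge_product]]
      additive_map_simps(1)[OF bimodule_product_simps(1)[OF tensor_Z_product]]
      additive_map_simps(1)[OF bimodule_product_simps(2)[OF tensor_Z_product]]
      bimodule_product_simps(5)[OF wedge_product, symmetric] bimodule_product_simps(3)[OF tensor_Z_product])

lemma wid_add: "additive_map (wid x)" and wid_tensor: "wid x (t y y') = t2 (wdg x y) y'"
  using tensor_lift_universal[OF tensor_T wid_balanced[of x]] by (simp_all add: wedge_id_def[abs_def])

lemma wid_add_left: "additive_map (\<lambda>x. wid x z)"
  unfolding additive_map_def
proof (intro allI)
  fix x x'
  show "wid (x + x') z = wid x z + wid x' z"
    using tensor_T
    by (induction z rule: tensor_product_induct)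
      (simp_all add: wid_tensor additive_map_simps(1)[OF bimodule_product_simps(2)[OF wedge_product]]
        additive_map_simps(1)[OF bimodule_product_simps(2)[OF tensor_Z_product]] additive_map_simps(1)[OF wid_add])
qed

lemma wid_lact: "wid x (lact T b z) = wid (ract M x b) z"
  using tensor_T
proof (induction z rule: tensor_product_induct)
  case (tensor y y')
  show ?case by (simp add: bimodule_product_simps(4)[OF tensor_T_product] wid_tensor bimodule_product_simps(3)[OF wedge_product])
next
  case (add z z')
  then show ?case by (simp add: additive_map_simps(1)[OF wid_add] additive_map_simps(1)[OF bimodule_simps(1)[OF bimodules(4)]])
qed

lemma lact_wid: "lact Z b (wid x z) = wid (lact M b x) z"
  using tensor_T
proof (induction z rule: tensor_product_induct)
  case (tensor y y')
  show ?case by (simp add: bimodule_product_simps(4)[OF tensor_Z_product] wid_tensor bimodule_product_simps(4)[OF wedge_product])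
next
  case (add z z')
  then show ?case by (simp add: additive_map_simps(1)[OF wid_add] additive_map_simps(1)[OF bimodule_simps(1)[OF bimodules(6)]])
qed

lemma nabla: "additive_map nabla" "nabla (lact M b x) = t (d b) x + lact T b (nabla x)"
  using lc unfolding levi_civita_def Let_def additive_map_def by blast+

text \<open>The covariant exterior derivative on the tensor square, first on elementary tensors.\<close>

definition "cov_ext_d_pair y y' = t2 (d1 y) y' - wid y (nabla y')"
definition "cov_ext_d = tensor_lift t cov_ext_d_pair"

text \<open>The terms \<open>y \<and> db \<otimes> y'\<close> from the two Leibniz rules, of \<open>d\<close> on the right and of \<open>\<nabla>\<close> on the left, cancel.\<close>

lemma cov_ext_d_pair_balanced: "balanced_map M M cov_ext_d_pair"
  unfolding balanced_map_def cov_ext_d_pair_def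
  by (auto simp: additive_map_simps(1)[OF d1(1)] additive_map_simps(1)[OF bimodule_product_simps(1)[OF tensor_Z_product]]
      additive_map_simps(1)[OF bimodule_product_simps(2)[OF tensor_Z_product]]
      additive_map_simps(4)[OF bimodule_product_simps(2)[OF tensor_Z_product]]
      additive_map_simps(1)[OF wid_add] additive_map_simps(1)[OF wid_add_left] additive_map_simps(1)[OF nabla(1)]
      d1_ract nabla(2) bimodule_product_simps(3)[OF tensor_Z_product] wid_lact wid_tensor)

lemma cov_ext_d_add: "additive_map cov_ext_d" and cov_ext_d_tensor: "cov_ext_d (t y y') = cov_ext_d_pair y y'"
  using tensor_lift_universal[OF tensor_T cov_ext_d_pair_balanced] by (simp_all add: cov_ext_d_def[abs_def])

lemma riemann_eq: "riemann t pr t2 d1 nabla x = cov_ext_d (nabla x)"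
  by (simp add: riemann_def cov_ext_d_def cov_ext_d_pair_def[abs_def])

lemma cov_ext_d_lact: "cov_ext_d (lact T b z) = wid (d b) z + lact Z b (cov_ext_d z)"
  using tensor_T
proof (induction z rule: tensor_product_induct)
  case (tensor y y')
  show ?case
    by (simp add: bimodule_product_simps(4)[OF tensor_T_product] cov_ext_d_tensor cov_ext_d_pair_def d1_lact wid_tensor
        additive_map_simps(1)[OF bimodule_product_simps(2)[OF tensor_Z_product]]
        bimodule_product_simps(4)[OF tensor_Z_product, symmetric] lact_wid[symmetric]
        additive_map_simps(4)[OF bimodule_simps(1)[OF bimodules(6)]])
next
  case (add z z')
  then show ?case
    by (simp add: additive_map_simps(1)[OF cov_ext_d_add] additive_map_simps(1)[OF wid_add]
        additive_map_simps(1)[OF bimodule_simps(1)[OF bimodules(4)]]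
        additive_map_simps(1)[OF bimodule_simps(1)[OF bimodules(6)]])
qed

interpretation braid: rigid_braiding "R_VV r q s \<rho>" "R_VD r q s \<rho>" "R_DD r q s \<rho>" pivot
    "qpow q (par_w r s + par_m r s)"
  by (rule rigid)

lemma d_scalar: "d (\<iota> c) = 0"
proof -
  have "\<delta> (\<iota> c) = 0" if der: "derivation \<iota> V \<delta>" and V: "bimodule \<iota> V"
    for V :: "('b, 'v::ab_group_add) bimod" and \<delta>
  proof -
    have "\<delta> (1 * 1) = ract V (\<delta> 1) 1 + lact V 1 (\<delta> 1)" using der unfolding derivation_def by blast
    then have "\<delta> 1 = 0" by (simp add: bimodule_simps(8,9)[OF V])
    moreover have "\<delta> (\<iota> c * 1) = cscale \<iota> V c (\<delta> 1)" using der unfolding derivation_def by blast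
    ultimately show ?thesis by (simp add: cscale_def additive_map_simps(2)[OF bimodule_simps(1)[OF V]])
  qed
  from this[OF derivations(1) bimodules(1)] this[OF derivations(2) bimodules(2)] show ?thesis
    by (simp add: diff_def zero_prod_def)
qed

lemma wid_cscale: "wid x (cscale \<iota> T c z) = cscale \<iota> Z c (wid x z)"
  by (simp add: cscale_def wid_lact lact_wid bimodule_simps(10)[OF bimodules(3)])

lemma cov_ext_d_cscale: "cov_ext_d (cscale \<iota> T c z) = cscale \<iota> Z c (cov_ext_d z)"
  by (simp add: cscale_def cov_ext_d_lact d_scalar additive_map_simps(2)[OF wid_add_left])

text \<open>\<open>P \<otimes> P = P p \<otimes> P = P \<otimes> p P = 0\<close> and \<open>Q \<otimes> Q = Q \<otimes> p Q = Q p \<otimes> Q = 0\<close>, for any product balanced over the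
  algebra.\<close>

lemma balanced_PP: "balanced_map M M \<beta> \<Longrightarrow> (\<Sum>l\<in>UNIV. \<beta> (P (i, l)) (P (l, k))) = 0"
  and balanced_QQ: "balanced_map M M \<beta> \<Longrightarrow> (\<Sum>l\<in>UNIV. \<beta> (Q (i, l)) (Q (l, k))) = 0"
  for \<beta> :: "'x \<times> 'y \<Rightarrow> 'x \<times> 'y \<Rightarrow> 'v::ab_group_add"
proof -
  assume \<beta>: "balanced_map M M \<beta>"
  note bs = balanced_map_additive[OF \<beta>]
  have "(\<Sum>l\<in>UNIV. \<beta> (P (i, l)) (P (l, k))) = (\<Sum>l\<in>UNIV. \<beta> (\<Sum>b\<in>UNIV. ract M (P (i, b)) (p (b, l))) (P (l, k)))"
    by (simp only: P_p)
  also have "\<dots> = (\<Sum>b\<in>UNIV. \<Sum>l\<in>UNIV. \<beta> (P (i, b)) (lact M (p (b, l)) (P (l, k))))"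
    by (subst sum.swap) (simp only: additive_map_simps(5)[OF bs(2)] bs(3))
  also have "\<dots> = (\<Sum>b\<in>UNIV. \<beta> (P (i, b)) (\<Sum>l\<in>UNIV. lact M (p (b, l)) (P (l, k))))"
    by (simp only: additive_map_simps(5)[OF bs(1)])
  finally show "(\<Sum>l\<in>UNIV. \<beta> (P (i, l)) (P (l, k))) = 0"
    by (simp add: p_P additive_map_simps(2)[OF bs(1)])
  have "(\<Sum>l\<in>UNIV. \<beta> (Q (i, l)) (Q (l, k))) = (\<Sum>l\<in>UNIV. \<beta> (Q (i, l)) (\<Sum>b\<in>UNIV. lact M (p (l, b)) (Q (b, k))))"
    by (simp only: p_Q)
  also have "\<dots> = (\<Sum>b\<in>UNIV. \<Sum>l\<in>UNIV. \<beta> (ract M (Q (i, l)) (p (l, b))) (Q (b, k)))"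
    by (subst sum.swap) (simp only: additive_map_simps(5)[OF bs(1)] bs(3))
  also have "\<dots> = (\<Sum>b\<in>UNIV. \<beta> (\<Sum>l\<in>UNIV. ract M (Q (i, l)) (p (l, b))) (Q (b, k)))"
    by (simp only: additive_map_simps(5)[OF bs(2)])
  finally show "(\<Sum>l\<in>UNIV. \<beta> (Q (i, l)) (Q (l, k))) = 0"
    by (simp add: Q_p additive_map_simps(2)[OF bs(2)])
qed

lemma wedge_balanced: "balanced_map M M wdg"
  using wedge_product by (simp add: bimodule_product_def)

text \<open>\<open>P = dp - p dp\<close> gives \<open>dP = - dp \<and> dp\<close>, and \<open>P \<and> P = Q \<and> Q = 0\<close>.\<close>

lemma d1_P: "d1 (P (i, k)) = - (\<Sum>l\<in>UNIV. wdg (P (i, l)) (Q (l, k))) - (\<Sum>l\<in>UNIV. wdg (Q (i, l)) (P (l, k)))"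
proof -
  note ws = bimodule_product_simps[OF wedge_product]
  have one: "d1 (d b) = 0" for b
  proof -
    have "d 1 = 0" using d_scalar[of 1] by (simp add: complex_algebra_simps(1)[OF alg])
    then show ?thesis using d1(2)[of 1 b] by (simp add: bimodule_simps(8)[OF bimodules(3)] additive_map_simps(2)[OF ws(2)])
  qed
  have "(\<Sum>l\<in>UNIV. lact M (p (i, l)) (d (p (l, k)))) = Q (i, k)"
    by (simp add: d_p additive_map_simps(1)[OF bimodule_simps(1)[OF bimodules(3)]] sum.distrib p_P p_Q)
  then have "P (i, k) = d (p (i, k)) - (\<Sum>l\<in>UNIV. lact M (p (i, l)) (d (p (l, k))))"
    by (simp add: d_p)
  then have "d1 (P (i, k)) = - (\<Sum>l\<in>UNIV. wdg (d (p (i, l))) (d (p (l, k))))"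
    by (simp add: additive_map_simps(4,5)[OF d1(1)] one d1(2))
  also have "\<dots> = - ((\<Sum>l\<in>UNIV. wdg (P (i, l)) (P (l, k))) + (\<Sum>l\<in>UNIV. wdg (Q (i, l)) (P (l, k)))
      + ((\<Sum>l\<in>UNIV. wdg (P (i, l)) (Q (l, k))) + (\<Sum>l\<in>UNIV. wdg (Q (i, l)) (Q (l, k)))))"
    by (simp only: d_p additive_map_simps(1)[OF ws(1)] additive_map_simps(1)[OF ws(2)] sum.distrib)
  finally show ?thesis by (simp add: balanced_PP[OF wedge_balanced] balanced_QQ[OF wedge_balanced])
qed

lemma braided_commuting_P: "braid.braided_commuting \<iota> M p (qpow q (par_a r s)) P"
  and braided_commuting_Q: "braid.braided_commuting \<iota> M p (qpow q (- par_a r s)) Q"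
proof -
  have Op: "ract Op (del (p u)) (p w) = cscale \<iota> Op (qpow q (par_a r s))
     (\<Sum>s\<in>UNIV. \<Sum>t\<in>UNIV. cscale \<iota> Op (braid.swap_coeff u w s t) (lact Op (p s) (del (p t))))" for u w
  proof -
    have "\<forall>l. length l = 4 \<longrightarrow>
        fprod 2 (ract Op) (fam2 (del \<circ> p)) (fam2 p) l
          = cscale \<iota> Op (qpow q (par_a r s))
              (T1234 r q s \<rho> (cscale \<iota> Op) (fprod 2 (lact Op) (fam2 p) (fam2 (del \<circ> p))) l)"
      using hk unfolding hk_calculus_def by blast
    from this[rule_format, of "[fst u, snd u, fst w, snd w]"] show ?thesis
      unfolding T1234_def S123_def St234_def comp_apply
        braid.leg_maps_swap_coeff[OF cscale_module[OF alg bimodules(1)]] fam2_4 by simp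
  qed
  have Om: "ract Om (delb (p u)) (p w) = cscale \<iota> Om (qpow q (- par_a r s))
     (\<Sum>s\<in>UNIV. \<Sum>t\<in>UNIV. cscale \<iota> Om (braid.swap_coeff u w s t) (lact Om (p s) (delb (p t))))" for u w
  proof -
    have "\<forall>l. length l = 4 \<longrightarrow>
        fprod 2 (ract Om) (fam2 (delb \<circ> p)) (fam2 p) l
          = cscale \<iota> Om (qpow q (- par_a r s))
              (T1234 r q s \<rho> (cscale \<iota> Om) (fprod 2 (lact Om) (fam2 p) (fam2 (delb \<circ> p))) l)"
      using hk unfolding hk_calculus_def by blast
    from this[rule_format, of "[fst u, snd u, fst w, snd w]"] show ?thesis
      unfolding T1234_def S123_def St234_def comp_apply
        braid.leg_maps_swap_coeff[OF cscale_module[OF alg bimodules(2)]] fam2_4 by simp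
  qed
  have sc: "cscale \<iota> M c z = (cscale \<iota> Op c (fst z), cscale \<iota> Om c (snd z))" for c z
    by (simp add: cscale_def M_simps)
  interpret Op: module "cscale \<iota> Op" by (rule cscale_module[OF alg bimodules(1)])
  interpret Om: module "cscale \<iota> Om" by (rule cscale_module[OF alg bimodules(2)])
  show "braid.braided_commuting \<iota> M p (qpow q (par_a r s)) P"
    unfolding braid.braided_commuting_def sc M_simps P_def fst_conv snd_conv Op zero_acts
    by (simp add: sum_Pair)
  show "braid.braided_commuting \<iota> M p (qpow q (- par_a r s)) Q"
    unfolding braid.braided_commuting_def sc M_simps Q_def fst_conv snd_conv Om zero_acts
    by (simp add: sum_Pair)
qed

definition "QPQ i j = (\<Sum>k\<in>UNIV. t2 (\<Sum>l\<in>UNIV. wdg (Q (i, l)) (P (l, k))) (Q (k, j)))"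

text \<open>The matrix \<open>Q \<and> P \<otimes> Q\<close> commutes with \<open>p\<close> up to \<open>T\<close> and the scalar \<open>q\<^sup>-\<^sup>a q\<^sup>a q\<^sup>-\<^sup>a = q\<^sup>-\<^sup>2\<close>, which is not \<open>1\<close>.\<close>

lemma quantum_trace_QPQ: "(\<Sum>x\<in>UNIV. cscale \<iota> Z (pivot x) (QPQ x x)) = 0"
proof -
  let ?F = "\<lambda>u. \<Sum>k\<in>UNIV. t2 (\<Sum>l\<in>UNIV. wdg (Q (fst u, l)) (P (l, k))) (Q (k, snd u))"
  have "braid.braided_commuting \<iota> U p (qpow q (- par_a r s) * qpow q (par_a r s))
      (\<lambda>u. \<Sum>l\<in>UNIV. wdg (Q (fst u, l)) (P (l, snd u)))"
    by (rule braid.braided_commuting_product[OF alg bimodules(3) bimodules(3) bimodules(5) wedge_product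
          braided_commuting_Q braided_commuting_P])
  from braid.braided_commuting_product[OF alg bimodules(5) bimodules(3) bimodules(6) tensor_Z_product
      this braided_commuting_Q]
  have F: "braid.braided_commuting \<iota> Z p (qpow q (- par_a r s) * qpow q (par_a r s) * qpow q (- par_a r s)) ?F"
    by simp
  have "qpow q (- par_a r s) * qpow q (par_a r s) * qpow q (- par_a r s) \<noteq> 1"
  proof -
    have q: "0 < q" "q < 1" using qg by (auto simp: quantum_group_data_def)
    then have "q powr (- 2) \<noteq> 1" by (simp add: powr_eq_one_iff_gen)
    then have "qpow q (- 2) \<noteq> 1" unfolding qpow_def of_real_eq_1_iff .
    then show ?thesis unfolding qpow_add[symmetric] par_a_value[OF qg] by simp
  qed
  from braid.braided_commuting_trace_zero[OF alg bimodules(6) F quantum_trace_p qpow_nz this]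
  show ?thesis by (simp add: QPQ_def)
qed

definition "g = (\<Sum>x\<in>UNIV. cscale \<iota> T (pivot x) (\<Sum>k\<in>UNIV. t (P (x, k)) (Q (k, x))))"

lemma dp_eq: "dp p del [i, j] = P (i, j)" "dbp p delb [i, j] = Q (i, j)"
  by (simp_all add: dp_def dbp_def fam2_def P_def Q_def)

lemma metric_eq: "metric_comp r q lam (cscale \<iota> T) t (dp p del) (dbp p delb) = g"
  unfolding metric_comp_def E'_leg_pair[OF cscale_module[OF alg bimodules(4)]]
    E_leg_2[OF cscale_module[OF alg bimodules(4)]]
  by (simp add: fprod_def g_def pivot_def dp_eq)

lemma nabla_Q: "nabla (Q (i, j)) = (\<Sum>k\<in>UNIV. t (P (i, k)) (Q (k, j)))
    - cscale \<iota> T (qpow q (- par_m r s)) (lact T (p (i, j)) g)"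
proof -
  have "nabla (dbp p delb [i, j]) = E_leg (cscale \<iota> T) 2 (fprod 2 t (dp p del) (dbp p delb)) [i, j]
     - cscale \<iota> T (qpow q (- par_m r s)) (lact T (p (i, j)) (metric_comp r q lam (cscale \<iota> T) t (dp p del) (dbp p delb)))"
    using lc unfolding levi_civita_def Let_def by blast
  then show ?thesis
    unfolding metric_eq E_leg_2[OF cscale_module[OF alg bimodules(4)]] dp_eq by (simp add: fprod_def dp_eq)
qed

text \<open>Of \<open>dP \<otimes> Q\<close> only \<open>- Q \<and> P \<otimes> Q\<close> survives because \<open>Q \<otimes> Q = 0\<close>; in \<open>P \<and> \<nabla>Q\<close> the term \<open>P \<and> P \<otimes> Q\<close> vanishes,
  and the metric term simplifies by \<open>P p = P\<close>.\<close>

lemma cov_ext_d_PQ: "cov_ext_d (\<Sum>k\<in>UNIV. t (P (i, k)) (Q (k, j)))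
    = - QPQ i j + cscale \<iota> Z (qpow q (- par_m r s)) (wid (P (i, j)) g)"
proof -
  let ?m = "qpow q (- par_m r s)"
  interpret Z: module "cscale \<iota> Z" by (rule cscale_module[OF alg bimodules(6)])
  note ts = bimodule_product_simps[OF tensor_Z_product]
  have PQQ: "(\<Sum>k\<in>UNIV. t2 (\<Sum>l\<in>UNIV. wdg (P (i, l)) (Q (l, k))) (Q (k, j))) = 0"
  proof -
    have "(\<Sum>k\<in>UNIV. t2 (\<Sum>l\<in>UNIV. wdg (P (i, l)) (Q (l, k))) (Q (k, j)))
       = (\<Sum>l\<in>UNIV. \<Sum>k\<in>UNIV. t2 (wdg (P (i, l)) (Q (l, k))) (Q (k, j)))"
      by (subst sum.swap) (simp only: additive_map_simps(5)[OF ts(2)])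
    then show ?thesis by (simp add: balanced_QQ[OF wid_balanced])
  qed
  have PPQ: "(\<Sum>k\<in>UNIV. \<Sum>l\<in>UNIV. t2 (wdg (P (i, k)) (P (k, l))) (Q (l, j))) = 0"
    by (subst sum.swap)
      (simp add: additive_map_simps(5)[OF ts(2), symmetric] balanced_PP[OF wedge_balanced] additive_map_simps(2)[OF ts(2)])
  have d1_part: "(\<Sum>k\<in>UNIV. t2 (d1 (P (i, k))) (Q (k, j))) = - QPQ i j"
    by (simp add: d1_P additive_map_simps(3,4)[OF ts(2)] sum_subtractf sum_negf PQQ QPQ_def)
  have "(\<Sum>k\<in>UNIV. wid (P (i, k)) (nabla (Q (k, j)))) =
     (\<Sum>k\<in>UNIV. \<Sum>l\<in>UNIV. t2 (wdg (P (i, k)) (P (k, l))) (Q (l, j)))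
     - cscale \<iota> Z ?m (wid (\<Sum>k\<in>UNIV. ract M (P (i, k)) (p (k, j))) g)"
    by (simp add: nabla_Q additive_map_simps(4,5)[OF wid_add] wid_tensor wid_cscale wid_lact sum_subtractf
        additive_map_simps(5)[OF wid_add_left] Z.scale_sum_right)
  also have "\<dots> = - cscale \<iota> Z ?m (wid (P (i, j)) g)" by (simp add: PPQ P_p)
  finally show ?thesis
    by (simp add: additive_map_simps(5)[OF cov_ext_d_add] cov_ext_d_tensor cov_ext_d_pair_def sum_subtractf d1_part)
qed

text \<open>The metric is the quantum trace of \<open>P \<otimes> Q\<close>, and both contributions of the previous lemma have
  quantum trace zero.\<close>

lemma cov_ext_d_metric: "cov_ext_d g = 0"
proof -
  interpret Z: module "cscale \<iota> Z" by (rule cscale_module[OF alg bimodules(6)])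
  have "(\<Sum>x\<in>UNIV. lact M (\<iota> (pivot x)) (P (x, x))) = 0"
    using quantum_trace_del by (simp add: M_simps P_def zero_acts sum_Pair cscale_def zero_prod_def)
  then have tr: "(\<Sum>x\<in>UNIV. cscale \<iota> Z (pivot x) (wid (P (x, x)) g)) = 0"
    by (simp add: cscale_def lact_wid additive_map_simps(5)[OF wid_add_left, symmetric] additive_map_simps(2)[OF wid_add_left])
  have "cov_ext_d g = (\<Sum>x\<in>UNIV. cscale \<iota> Z (pivot x) (- QPQ x x + cscale \<iota> Z (qpow q (- par_m r s)) (wid (P (x, x)) g)))"
    by (subst g_def) (simp only: additive_map_simps(5)[OF cov_ext_d_add] cov_ext_d_cscale
        cov_ext_d_PQ[unfolded additive_map_simps(5)[OF cov_ext_d_add]])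
  also have "\<dots> = - (\<Sum>x\<in>UNIV. cscale \<iota> Z (pivot x) (QPQ x x))
      + cscale \<iota> Z (qpow q (- par_m r s)) (\<Sum>x\<in>UNIV. cscale \<iota> Z (pivot x) (wid (P (x, x)) g))"
    by (simp add: Z.scale_right_diff_distrib sum_subtractf Z.scale_sum_right mult.commute)
  finally show ?thesis by (simp add: quantum_trace_QPQ tr)
qed

lemma riemann_Q: "riemann t pr t2 d1 nabla (Q (i, j)) =
    - QPQ i j - cscale \<iota> Z (qpow q (- par_m r s)) (wid (Q (i, j)) g)"
proof -
  interpret Z: module "cscale \<iota> Z" by (rule cscale_module[OF alg bimodules(6)])
  show ?thesis
    by (simp add: riemann_eq nabla_Q additive_map_simps(4)[OF cov_ext_d_add] cov_ext_d_PQ cov_ext_d_cscale cov_ext_d_lact cov_ext_d_metric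
        d_p additive_map_simps(1)[OF wid_add_left] Z.scale_right_distrib additive_map_simps(2)[OF bimodule_simps(1)[OF bimodules(6)]])
qed

lemma E_leg_QPQ: "E_leg (cscale \<iota> Z) 2 (E_leg (cscale \<iota> Z) 2
          (fprod 4 t2 (fprod 2 wdg (dbp p delb) (dp p del)) (dbp p delb))) [i, j] = QPQ i j"
  unfolding E_leg_2[OF cscale_module[OF alg bimodules(6)]] QPQ_def
  by (simp add: fprod_def dp_eq additive_map_simps(5)[OF bimodule_product_simps(2)[OF tensor_Z_product]])

lemma riemann_dbp: "riemann t pr t2 d1 nabla (dbp p delb [i, j]) =
      - E_leg (cscale \<iota> Z) 2 (E_leg (cscale \<iota> Z) 2
          (fprod 4 t2 (fprod 2 wdg (dbp p delb) (dp p del)) (dbp p delb))) [i, j]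
      - cscale \<iota> Z (qpow q (- wt_form r (fund_weight r s) (two_rho r)))
          (wid (dbp p delb [i, j]) (metric_comp r q lam (cscale \<iota> T) t (dp p del) (dbp p delb)))"
  unfolding E_leg_QPQ metric_eq dp_eq riemann_Q par_m_def ..

end



theorem lemma5p2:
  fixes r s :: nat and q :: real
    and \<rho> :: "'n::finite uq_rep" and lam :: "'n \<Rightarrow> weight"
    and \<iota> :: "complex \<Rightarrow> 'b::ring_1" and p :: "'n \<times> 'n \<Rightarrow> 'b"
    and Op :: "('b, 'x::ab_group_add) bimod" and del :: "'b \<Rightarrow> 'x"
    and Om :: "('b, 'y::ab_group_add) bimod" and delb :: "'b \<Rightarrow> 'y"
    and T :: "('b, 't::ab_group_add) bimod" and t :: "'x \<times> 'y \<Rightarrow> 'x \<times> 'y \<Rightarrow> 't"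
    and U :: "('b, 'u::ab_group_add) bimod" and pr :: "'t \<Rightarrow> 'u" and d1 :: "'x \<times> 'y \<Rightarrow> 'u"
    and Z :: "('b, 'z::ab_group_add) bimod" and t2 :: "'u \<Rightarrow> 'x \<times> 'y \<Rightarrow> 'z"
    and nabla :: "'x \<times> 'y \<Rightarrow> 't"
  assumes "quantum_group_data r q s \<rho> lam"
    and "hk_calculus r q s \<rho> lam \<iota> p Op del Om delb"
    and "tensor_product \<iota> (bimod_sum Op Om) (bimod_sum Op Om) T t"
    and "two_forms \<iota> (bimod_sum Op Om) (diff del delb) T t U pr"
    and "is_exterior_d (bimod_sum Op Om) (diff del delb) (wedge t pr) d1"
    and "tensor_product \<iota> U (bimod_sum Op Om) Z t2"
    and "levi_civita r q s \<rho> lam \<iota> p Op del Om delb T t nabla"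
  shows "\<forall>i j. riemann t pr t2 d1 nabla (dbp p delb [i, j]) =
      - E_leg (cscale \<iota> Z) 2 (E_leg (cscale \<iota> Z) 2
          (fprod 4 t2 (fprod 2 (wedge t pr) (dbp p delb) (dp p del)) (dbp p delb))) [i, j]
      - cscale \<iota> Z (qpow q (- wt_form r (fund_weight r s) (two_rho r)))
          (wedge_id t pr t2 (dbp p delb [i, j])
             (metric_comp r q lam (cscale \<iota> T) t (dp p del) (dbp p delb)))"
proof -
  interpret projective_levi_civita r s q \<rho> lam \<iota> p Op del Om delb T t U pr d1 Z t2 nabla
    by (rule projective_levi_civita.intro) (fact assms)+
  show ?thesis by (intro allI) (rule riemann_dbp)
qed

end
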